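(* Let $\mu\in\mathcal M_a(\mathcal N')$ be a non-degenerate probability measure and let $\Phi\in(\mathcal N)^{-1}_\mu$. Let $F:\mathbb C\to\mathbb C$ be analytic in a neighborhood of the point $z_0=\mathbb E_\mu(\Phi)$. Then $F^{\diamond}(\Phi)$, defined by $S_\mu(F^\diamond(\Phi))=F(S_\mu\Phi)$, exists in $(\mathcal N)^{-1}_\mu$.
   Context: Nuclear triple: $\mathcal H$ is a real separable Hilbert space with norm $|\cdot|$; $\mathcal N\subset\mathcal H$ is a separable nuclear Fréchet space, densely and continuously embedded, $\mathcal N=\bigcap_{p\in\mathbb N}\mathcal H_p$ with the projective limit topology, where the $\mathcal H_p$ are Hilbert spaces with norms $|\cdot|_p$, $|\cdot|\le|\cdot|_p\le|\cdot|_q$ for $p<q$, and for every $p$ there is $p'>p$ such that the embedding $\mathcal H_{p'}\hookrightarrow\mathcal H_p$ is Hilbert–Schmidt. $\mathcal N'=\bigcup_p\mathcal H_{-p}$ is the dual, $\mathcal H_{-p}$ being the dual of $\mathcal H_p$ with respect to $\mathcal H$, with norm $|\cdot|_{-p}$; $\langle\cdot,\cdot\rangle$ is the bilinear dual pairing. A subscript $\mathbb C$ denotes complexification, $\hat\otimes$ the symmetric tensor product; $|\cdot|_{\pm p}$ also denotes the norm on $\mathcal H_{\pm p,\mathbb C}^{\hat\otimes n}$ (complex modulus if $n=0$); $\mathcal N_{\mathbb C}^{\hat\otimes n}$ is the projective limit of the $\mathcal H_{p,\mathbb C}^{\hat\otimes n}$, and its dual is the inductive limit of the $\mathcal H_{-p,\mathbb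 C}^{\hat\otimes n}$. Measures: $\mathcal M_a(\mathcal N')$ is the set of measures $\mu$ on the cylinder $\sigma$-algebra of $\mathcal N'$ whose Laplace transform $l_\mu(\theta)=\int_{\mathcal N'}e^{\langle x,\theta\rangle}\,d\mu(x)$ is holomorphic in a neighborhood of $0\in\mathcal N_{\mathbb C}$ (holomorphic = Gâteaux-holomorphic and locally bounded). $\mathcal P(\mathcal N')$ is the set of functions $\varphi(x)=\sum_{n=0}^N\langle x^{\otimes n},\tilde\varphi^{(n)}\rangle$ on $\mathcal N'$ with $\tilde\varphi^{(n)}\in\mathcal N_{\mathbb C}^{\hat\otimes n}$, topologized as the topological direct sum $\bigoplus_n\mathcal N_{\mathbb C}^{\hat\otimes n}$; $\mu$ is non-degenerate if $\varphi\in\mathcal P(\mathcal N')$, $\varphi=0$ $\mu$-a.e. implies $\varphi\equiv0$. Appell system: $e_\mu(\theta;z)=e^{\langle z,\theta\rangle}/l_\mu(\theta)=\sum_{n}\frac1{n!}\langle P_n^\mu(z),\theta^{\otimes n}\rangle$ ($\theta$ near $0$ in $\mathcal N_{\mathbb C}$, $z\in\mathcal N'_{\mathbb C}$) defines $P_n^\mu(z)\in(\mathcal N_{\mathbb C}^{\hat\otimes n})'$. Every $\varphi\in\mathcal P(\mathcal N')$ is uniquely $\sum_{n=0}^N\langle P_n^\mu,\varphi^{(n)}\rangle$ with $\varphi^{(n)}\in\mathcal N_{\mathbb C}^{\hat\otimes n}$. $\mathcal P'_\mu(\mathcal N')$ is the dual of $\mathcal P(\mathcal N')$, with bilinear pairing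 $\langle\!\langle\cdot,\cdot\rangle\!\rangle_\mu$ extending $\langle\!\langle f,\varphi\rangle\!\rangle_\mu=\int f\varphi\,d\mu$ ($f\in L^2(\mu)$). Every $\Phi\in\mathcal P'_\mu(\mathcal N')$ is uniquely of the form $\Phi=\sum_nQ_n^\mu(\Phi^{(n)})$, $\Phi^{(n)}\in(\mathcal N_{\mathbb C}^{\hat\otimes n})'$, acting by $\langle\!\langle\Phi,\varphi\rangle\!\rangle_\mu=\sum_nn!\langle\Phi^{(n)},\varphi^{(n)}\rangle$. Distributions: $(\mathcal N)^{-1}_\mu=\bigcup_{p,q\in\mathbb N}(\mathcal H_{-p})^{-1}_{-q,\mu}$, where $(\mathcal H_{-p})^{-1}_{-q,\mu}$ is the space of $\Phi\in\mathcal P'_\mu(\mathcal N')$ with $\sum_n2^{-qn}|\Phi^{(n)}|_{-p}^2<\infty$. For $\Phi\in(\mathcal N)^{-1}_\mu$, $\mathbb E_\mu(\Phi)=\langle\!\langle\Phi,1\rangle\!\rangle_\mu$. $S_\mu$-transform: for $\Phi\in(\mathcal H_{-p})^{-1}_{-q,\mu}$ and $\theta\in\mathcal H_{p,\mathbb C}$ with $2^q|\theta|_p^2<1$, $S_\mu\Phi(\theta)=\langle\!\langle\Phi,e_\mu(\theta;\cdot)\rangle\!\rangle_\mu=\sum_n\langle\Phi^{(n)},\theta^{\otimes n}\rangle$. $S_\mu\Phi$ and $F(S_\mu\Phi)=F\circ S_\mu\Phi$ are regarded as germs at $0\in\mathcal N_{\mathbb C}$ (functions agreeing on a neighborhood of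 $0$ are identified). *)

theory Defs
  imports "HOL-Probability.Probability"
begin

definition hilbert_on :: "'h::real_vector set \<Rightarrow> ('h \<Rightarrow> 'h \<Rightarrow> real) \<Rightarrow> bool" where
  "hilbert_on S b \<longleftrightarrow>
     subspace S \<and>
     (\<forall>\<xi>\<in>S. \<forall>\<eta>\<in>S. b \<xi> \<eta> = b \<eta> \<xi>) \<and>
     (\<forall>\<xi>\<in>S. \<forall>\<xi>'\<in>S. \<forall>\<eta>\<in>S. \<forall>c d. b (c *\<^sub>R \<xi> + d *\<^sub>R \<xi>') \<eta> = c * b \<xi> \<eta> + d * b \<xi>' \<eta>) \<and>
     (\<forall>\<xi>\<in>S. \<xi> \<noteq> 0 \<longrightarrow> 0 < b \<xi> \<xi>) \<and>
     (\<forall>u. (\<forall>k. u k \<in> S) \<and>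
        (\<forall>\<epsilon>>0. \<exists>M. \<forall>j\<ge>M. \<forall>k\<ge>M. sqrt (b (u j - u k) (u j - u k)) < \<epsilon>) \<longrightarrow>
        (\<exists>\<xi>\<in>S. (\<lambda>k. sqrt (b (u k - \<xi>) (u k - \<xi>))) \<longlonglongrightarrow> 0))"

text \<open>The complexification of a real space is represented by pairs: \<open>(\<xi>, \<eta>)\<close> stands for
  \<open>\<xi> + \<i> \<eta>\<close>.\<close>

definition cscale :: "complex \<Rightarrow> 'h::real_vector \<times> 'h \<Rightarrow> 'h \<times> 'h" where
  "cscale c \<theta> = (Re c *\<^sub>R fst \<theta> - Im c *\<^sub>R snd \<theta>, Im c *\<^sub>R fst \<theta> + Re c *\<^sub>R snd \<theta>)"

definition pair_real :: "('h \<Rightarrow> real) \<Rightarrow> 'h \<times> 'h \<Rightarrow> complex" where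
  "pair_real x \<theta> = Complex (x (fst \<theta>)) (x (snd \<theta>))"

definition pair_cplx :: "('h \<Rightarrow> real) \<times> ('h \<Rightarrow> real) \<Rightarrow> 'h \<times> 'h \<Rightarrow> complex" where
  "pair_cplx z \<theta> = pair_real (fst z) \<theta> + \<i> * pair_real (snd z) \<theta>"

text \<open>The type \<open>'h\<close> is the central Hilbert space; \<open>Hs p\<close> with inner product \<open>ip p\<close> is the
  \<open>p\<close>-th Hilbert space of the chain, realized as a linear subspace of \<open>'h\<close>.\<close>

locale hilbert_scale =
  fixes Hs :: "nat \<Rightarrow> 'h::{real_inner, complete_space, second_countable_topology} set"
    and ip :: "nat \<Rightarrow> 'h \<Rightarrow> 'h \<Rightarrow> real"
begin

definition nrm :: "nat \<Rightarrow> 'h \<Rightarrow> real" where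
  "nrm p \<xi> = sqrt (ip p \<xi> \<xi>)"

definition orthonormal :: "nat \<Rightarrow> 'h set \<Rightarrow> bool" where
  "orthonormal p B \<longleftrightarrow> B \<subseteq> Hs p \<and> (\<forall>e\<in>B. \<forall>f\<in>B. ip p e f = (if e = f then 1 else 0))"

definition orthonormal_basis :: "nat \<Rightarrow> 'h set \<Rightarrow> bool" where
  "orthonormal_basis p B \<longleftrightarrow>
     orthonormal p B \<and> (\<forall>\<xi>\<in>Hs p. (\<forall>e\<in>B. ip p \<xi> e = 0) \<longrightarrow> \<xi> = 0)"

definition hilbert_schmidt_embedding :: "nat \<Rightarrow> nat \<Rightarrow> bool" where
  "hilbert_schmidt_embedding p' p \<longleftrightarrow>
     Hs p' \<subseteq> Hs p \<and> (\<exists>B. orthonormal_basis p' B \<and> (\<lambda>e. (nrm p e)\<^sup>2) summable_on B)"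

definition N :: "'h set" where
  "N = (\<Inter>p. Hs p)"

text \<open>Elements of the dual are real functionals on \<open>N\<close>, extended by \<open>0\<close> outside \<open>N\<close> so that
  equality of HOL functions is equality on \<open>N\<close>. The dual of \<open>Hs p\<close> consists of those functionals
  that are continuous with respect to the norm of \<open>Hs p\<close>.\<close>

definition Hneg :: "nat \<Rightarrow> ('h \<Rightarrow> real) set" where
  "Hneg p = {x. (\<forall>\<xi>\<in>N. \<forall>\<eta>\<in>N. \<forall>c d. x (c *\<^sub>R \<xi> + d *\<^sub>R \<eta>) = c * x \<xi> + d * x \<eta>) \<and>
                (\<exists>C. \<forall>\<xi>\<in>N. \<bar>x \<xi>\<bar> \<le> C * nrm p \<xi>) \<and>
                (\<forall>\<xi>. \<xi> \<notin> N \<longrightarrow> x \<xi> = 0)}"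

definition N' :: "('h \<Rightarrow> real) set" where
  "N' = (\<Union>p. Hneg p)"

definition riesz :: "nat \<Rightarrow> 'h \<Rightarrow> 'h \<Rightarrow> real" where
  "riesz p e = (\<lambda>\<xi>. if \<xi> \<in> N then ip p e \<xi> else 0)"

definition cylinder_algebra :: "('h \<Rightarrow> real) measure" where
  "cylinder_algebra = sigma N' {{x \<in> N'. x \<xi> \<in> A} |\<xi> A. \<xi> \<in> N \<and> A \<in> sets borel}"

definition NC :: "('h \<times> 'h) set" where
  "NC = N \<times> N"

definition nrmC :: "nat \<Rightarrow> 'h \<times> 'h \<Rightarrow> real" where
  "nrmC p \<theta> = sqrt ((nrm p (fst \<theta>))\<^sup>2 + (nrm p (snd \<theta>))\<^sup>2)"

text \<open>The norms are increasing in \<open>p\<close>, so single-norm balls form a base of the projective limit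
  topology.\<close>

definition NC_open :: "('h \<times> 'h) set \<Rightarrow> bool" where
  "NC_open U \<longleftrightarrow> U \<subseteq> NC \<and>
     (\<forall>\<theta>\<in>U. \<exists>p. \<exists>\<epsilon>>0. \<forall>\<eta>\<in>NC. nrmC p (\<eta> - \<theta>) < \<epsilon> \<longrightarrow> \<eta> \<in> U)"

definition NC_holomorphic_on :: "('h \<times> 'h \<Rightarrow> complex) \<Rightarrow> ('h \<times> 'h) set \<Rightarrow> bool" where
  "NC_holomorphic_on g U \<longleftrightarrow>
     (\<forall>\<theta>\<in>U. \<forall>\<eta>\<in>NC. (\<lambda>c. g (\<theta> + cscale c \<eta>)) analytic_on {0}) \<and>
     (\<forall>\<theta>\<in>U. \<exists>V. NC_open V \<and> \<theta> \<in> V \<and> bounded (g ` (U \<inter> V)))"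

definition germ_eq :: "('h \<times> 'h \<Rightarrow> complex) \<Rightarrow> ('h \<times> 'h \<Rightarrow> complex) \<Rightarrow> bool" where
  "germ_eq f g \<longleftrightarrow> (\<exists>U. NC_open U \<and> 0 \<in> U \<and> (\<forall>\<theta>\<in>U. f \<theta> = g \<theta>))"

text \<open>The Hilbert tensor power of order \<open>n\<close> of a Hilbert space is the space of Hilbert-Schmidt
  \<open>n\<close>-linear forms on its dual, \<open>\<xi>\<^sub>1 \<otimes> \<dots> \<otimes> \<xi>\<^sub>n\<close> being the form
  \<open>(x\<^sub>1, \<dots>, x\<^sub>n) \<mapsto> \<langle>x\<^sub>1, \<xi>\<^sub>1\<rangle> \<cdots> \<langle>x\<^sub>n, \<xi>\<^sub>n\<rangle>\<close>; complex values account for the complexification.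
  An element of the projective limit is thus a form on the union \<open>N'\<close> of the duals which is
  Hilbert-Schmidt on each of them. Arguments are lists of length \<open>n\<close>; forms are extended by \<open>0\<close>.

  \<open>tnorm p\<close> is the Hilbert-Schmidt norm on the dual of \<open>Hs p\<close>, whose orthonormal systems are the
  images under \<open>riesz p\<close> of those of \<open>Hs p\<close>; the sum of squares over an orthonormal basis is the
  supremum over finite orthonormal systems.\<close>

definition hs_sums :: "nat \<Rightarrow> nat \<Rightarrow> (('h \<Rightarrow> real) list \<Rightarrow> complex) \<Rightarrow> real set" where
  "hs_sums p n \<phi> =
     {\<Sum>es | set es \<subseteq> B \<and> length es = n. (cmod (\<phi> (map (riesz p) es)))\<^sup>2 |B.
        finite B \<and> orthonormal p B}"

definition tnorm :: "nat \<Rightarrow> nat \<Rightarrow> (('h \<Rightarrow> real) list \<Rightarrow> complex) \<Rightarrow> real" where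
  "tnorm p n \<phi> = sqrt (Sup (hs_sums p n \<phi>))"

definition symmetric_form :: "nat \<Rightarrow> (('h \<Rightarrow> real) list \<Rightarrow> complex) \<Rightarrow> bool" where
  "symmetric_form n \<phi> \<longleftrightarrow>
     (\<forall>xs ys. mset xs = mset ys \<longrightarrow> \<phi> xs = \<phi> ys) \<and>
     (\<forall>x\<in>N'. \<forall>y\<in>N'. \<forall>xs c d. set xs \<subseteq> N' \<and> Suc (length xs) = n \<longrightarrow>
        \<phi> ((\<lambda>\<xi>. c * x \<xi> + d * y \<xi>) # xs)
          = complex_of_real c * \<phi> (x # xs) + complex_of_real d * \<phi> (y # xs)) \<and>
     (\<forall>xs. \<not> (length xs = n \<and> set xs \<subseteq> N') \<longrightarrow> \<phi> xs = 0)"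

definition tens :: "nat \<Rightarrow> (('h \<Rightarrow> real) list \<Rightarrow> complex) set" where
  "tens n = {\<phi>. symmetric_form n \<phi> \<and> (\<forall>p. bdd_above (hs_sums p n \<phi>))}"

definition tpow :: "'h \<times> 'h \<Rightarrow> nat \<Rightarrow> ('h \<Rightarrow> real) list \<Rightarrow> complex" where
  "tpow \<theta> n = (\<lambda>xs. if length xs = n \<and> set xs \<subseteq> N'
                   then prod_list (map (\<lambda>x. pair_real x \<theta>) xs) else 0)"

definition tens_neg :: "nat \<Rightarrow> nat \<Rightarrow> ((('h \<Rightarrow> real) list \<Rightarrow> complex) \<Rightarrow> complex) set" where
  "tens_neg p n =
     {L. (\<forall>\<phi>\<in>tens n. \<forall>\<psi>\<in>tens n. \<forall>c d. L (\<lambda>xs. c * \<phi> xs + d * \<psi> xs) = c * L \<phi> + d * L \<psi>) \<and>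
         (\<exists>C. \<forall>\<phi>\<in>tens n. cmod (L \<phi>) \<le> C * tnorm p n \<phi>) \<and>
         (\<forall>\<phi>. \<phi> \<notin> tens n \<longrightarrow> L \<phi> = 0)}"

definition tens_dual :: "nat \<Rightarrow> ((('h \<Rightarrow> real) list \<Rightarrow> complex) \<Rightarrow> complex) set" where
  "tens_dual n = (\<Union>p. tens_neg p n)"

definition dnorm :: "nat \<Rightarrow> nat \<Rightarrow> ((('h \<Rightarrow> real) list \<Rightarrow> complex) \<Rightarrow> complex) \<Rightarrow> real" where
  "dnorm p n L = Sup {cmod (L \<phi>) |\<phi>. \<phi> \<in> tens n \<and> tnorm p n \<phi> \<le> 1}"

definition poly_fun ::
  "nat \<Rightarrow> (nat \<Rightarrow> ('h \<Rightarrow> real) list \<Rightarrow> complex) \<Rightarrow> ('h \<Rightarrow> real) \<Rightarrow> complex" where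
  "poly_fun m \<phi> = (\<lambda>x. if x \<in> N' then \<Sum>n\<le>m. \<phi> n (replicate n x) else 0)"

definition polys :: "(('h \<Rightarrow> real) \<Rightarrow> complex) set" where
  "polys = {poly_fun m \<phi> |m \<phi>. \<forall>n. \<phi> n \<in> tens n}"

definition laplace :: "('h \<Rightarrow> real) measure \<Rightarrow> 'h \<times> 'h \<Rightarrow> complex" where
  "laplace \<mu> \<theta> = (\<integral>x. exp (pair_real x \<theta>) \<partial>\<mu>)"

definition Ma :: "('h \<Rightarrow> real) measure set" where
  "Ma = {\<mu>. sets \<mu> = sets cylinder_algebra \<and>
            (\<exists>U. NC_open U \<and> 0 \<in> U \<and>
                 (\<forall>\<theta>\<in>U. integrable \<mu> (\<lambda>x. exp (pair_real x \<theta>))) \<and>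
                 NC_holomorphic_on (laplace \<mu>) U)}"

definition nondegenerate :: "('h \<Rightarrow> real) measure \<Rightarrow> bool" where
  "nondegenerate \<mu> \<longleftrightarrow> (\<forall>\<phi>\<in>polys. (AE x in \<mu>. \<phi> x = 0) \<longrightarrow> (\<forall>x\<in>N'. \<phi> x = 0))"

definition e_mu ::
  "('h \<Rightarrow> real) measure \<Rightarrow> 'h \<times> 'h \<Rightarrow> ('h \<Rightarrow> real) \<times> ('h \<Rightarrow> real) \<Rightarrow> complex" where
  "e_mu \<mu> \<theta> z = exp (pair_cplx z \<theta>) / laplace \<mu> \<theta>"

definition appell ::
  "('h \<Rightarrow> real) measure \<Rightarrow> ('h \<Rightarrow> real) \<times> ('h \<Rightarrow> real) \<Rightarrow>
     nat \<Rightarrow> (('h \<Rightarrow> real) list \<Rightarrow> complex) \<Rightarrow> complex" where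
  "appell \<mu> z = (THE P. (\<forall>n. P n \<in> tens_dual n) \<and>
     (\<exists>U. NC_open U \<and> 0 \<in> U \<and>
        (\<forall>\<theta>\<in>U. (\<lambda>n. P n (tpow \<theta> n) / fact n) sums e_mu \<mu> \<theta> z)))"

definition appell_poly ::
  "('h \<Rightarrow> real) measure \<Rightarrow> nat \<Rightarrow> (nat \<Rightarrow> ('h \<Rightarrow> real) list \<Rightarrow> complex) \<Rightarrow>
     ('h \<Rightarrow> real) \<Rightarrow> complex" where
  "appell_poly \<mu> m \<phi> = (\<lambda>x. if x \<in> N' then \<Sum>n\<le>m. appell \<mu> (x, \<lambda>_. 0) n (\<phi> n) else 0)"

text \<open>Continuity with respect to the topological direct sum: domination by one of the seminorms
  \<open>\<phi> \<mapsto> \<Sum>n. c\<^sub>n |\<phi>\<^sub>n|\<^bsub>p\<^sub>n\<^esub>\<close> that define its topology.\<close>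

definition polys_dual :: "((('h \<Rightarrow> real) \<Rightarrow> complex) \<Rightarrow> complex) set" where
  "polys_dual =
     {\<Phi>. (\<forall>f\<in>polys. \<forall>g\<in>polys. \<forall>c d. \<Phi> (\<lambda>x. c * f x + d * g x) = c * \<Phi> f + d * \<Phi> g) \<and>
         (\<exists>p c. \<forall>m \<phi>. (\<forall>n. \<phi> n \<in> tens n) \<longrightarrow>
            cmod (\<Phi> (poly_fun m \<phi>)) \<le> (\<Sum>n\<le>m. c n * tnorm (p n) n (\<phi> n))) \<and>
         (\<forall>f. f \<notin> polys \<longrightarrow> \<Phi> f = 0)}"

text \<open>\<open>Q_expansion \<mu> \<Phi> K\<close> states that \<open>\<Phi> = \<Sum>n. Q\<^sub>n (K n)\<close>.\<close>

definition Q_expansion ::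
  "('h \<Rightarrow> real) measure \<Rightarrow> ((('h \<Rightarrow> real) \<Rightarrow> complex) \<Rightarrow> complex) \<Rightarrow>
     (nat \<Rightarrow> (('h \<Rightarrow> real) list \<Rightarrow> complex) \<Rightarrow> complex) \<Rightarrow> bool" where
  "Q_expansion \<mu> \<Phi> K \<longleftrightarrow>
     (\<forall>n. K n \<in> tens_dual n) \<and>
     (\<forall>m \<phi>. (\<forall>n. \<phi> n \<in> tens n) \<longrightarrow>
        \<Phi> (appell_poly \<mu> m \<phi>) = (\<Sum>n\<le>m. fact n * K n (\<phi> n)))"

definition kernels ::
  "('h \<Rightarrow> real) measure \<Rightarrow> ((('h \<Rightarrow> real) \<Rightarrow> complex) \<Rightarrow> complex) \<Rightarrow>
     nat \<Rightarrow> (('h \<Rightarrow> real) list \<Rightarrow> complex) \<Rightarrow> complex" where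
  "kernels \<mu> \<Phi> = (THE K. Q_expansion \<mu> \<Phi> K)"

definition distributions_pq ::
  "('h \<Rightarrow> real) measure \<Rightarrow> nat \<Rightarrow> nat \<Rightarrow> ((('h \<Rightarrow> real) \<Rightarrow> complex) \<Rightarrow> complex) set" where
  "distributions_pq \<mu> p q =
     {\<Phi> \<in> polys_dual. \<exists>K. Q_expansion \<mu> \<Phi> K \<and> (\<forall>n. K n \<in> tens_neg p n) \<and>
        summable (\<lambda>n. (1 / 2) ^ (q * n) * (dnorm p n (K n))\<^sup>2)}"

definition distributions ::
  "('h \<Rightarrow> real) measure \<Rightarrow> ((('h \<Rightarrow> real) \<Rightarrow> complex) \<Rightarrow> complex) set" where
  "distributions \<mu> = (\<Union>p q. distributions_pq \<mu> p q)"

definition gen_expectation :: "((('h \<Rightarrow> real) \<Rightarrow> complex) \<Rightarrow> complex) \<Rightarrow> complex" where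
  "gen_expectation \<Phi> = \<Phi> (\<lambda>x. if x \<in> N' then 1 else 0)"

definition S_transform ::
  "('h \<Rightarrow> real) measure \<Rightarrow> ((('h \<Rightarrow> real) \<Rightarrow> complex) \<Rightarrow> complex) \<Rightarrow> 'h \<times> 'h \<Rightarrow> complex" where
  "S_transform \<mu> \<Phi> \<theta> = (\<Sum>n. kernels \<mu> \<Phi> n (tpow \<theta> n))"

end

text \<open>The remaining properties of \<open>N\<close> (complete, separable, nuclear) are consequences of its
  being the projective limit of such a chain.\<close>

locale nuclear_triple = hilbert_scale Hs ip
  for Hs :: "nat \<Rightarrow> 'h::{real_inner, complete_space, second_countable_topology} set"
    and ip :: "nat \<Rightarrow> 'h \<Rightarrow> 'h \<Rightarrow> real" +
  assumes hilbert: "\<And>p. hilbert_on (Hs p) (ip p)"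
    and norm_le: "\<And>p \<xi>. \<xi> \<in> Hs p \<Longrightarrow> norm \<xi> \<le> nrm p \<xi>"
    and decreasing: "\<And>p q. p < q \<Longrightarrow> Hs q \<subseteq> Hs p"
    and nrm_mono: "\<And>p q \<xi>. p < q \<Longrightarrow> \<xi> \<in> Hs q \<Longrightarrow> nrm p \<xi> \<le> nrm q \<xi>"
    and nuclear: "\<And>p. \<exists>p'>p. hilbert_schmidt_embedding p' p"
    and dense: "closure N = UNIV"

end

theory Submission
  imports Defs "HOL-Complex_Analysis.Complex_Analysis"
begin

text \<open>Kernels \<open>K = (K\<^sub>n)\<close>, with \<open>K\<^sub>n\<close> in the dual of the \<open>n\<close>-th symmetric tensor power of
  \<open>N\<close>, form an algebra under the convolution \<open>(K * L)\<^sub>n = \<Sum>k\<le>n. K\<^sub>k \<otimes> L\<^sub>n\<^sub>-\<^sub>k\<close>. Evaluation at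
  the powers \<open>\<theta>\<^sup>\<otimes>\<^sup>n\<close> sends \<open>K\<close> to the formal power series \<open>\<Sum>n. \<langle>K\<^sub>n, \<theta>\<^sup>\<otimes>\<^sup>n\<rangle> X\<^sup>n\<close>; it is
  multiplicative, and injective because the powers span a dense subspace. The Laplace transform of
  \<open>\<mu>\<close> is given by a kernel \<open>m\<close> (this uses nuclearity), the Appell polynomials by its convolution
  inverse, and a distribution with kernels \<open>K\<close> acts on an ordinary polynomial through \<open>K * m\<close>.
  Hence every kernel defines a functional on polynomials, and it remains to find the kernel of
  \<open>F(S \<Phi>)\<close>. It is the composition of the Taylor series of \<open>F\<close> at \<open>E(\<Phi>)\<close> with the kernel of
  \<open>\<Phi>\<close> stripped of its constant term: only finitely many convolution powers contribute in each
  degree, which gives a geometric bound on the kernels and thus membership in some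
  \<open>(H\<^sub>-\<^sub>p)\<^sub>-\<^sub>q\<close>. No convergence in the space of distributions is needed.\<close>

section \<open>Inner products on subspaces\<close>

text \<open>The definitions reach the kernels through definite descriptions (\<open>appell\<close>,
  \<open>kernels\<close>), so the transform of a distribution is accessible only after explicit
  families satisfying the descriptions have been found and shown to be the only ones. Convergence
  questions are moved to one complex variable: along the line t \<mapsto>
  \<open>cscale t \<theta>\<close> a kernel is an ordinary power series in t. The lines are
  considered on a disc of radius 2, so that t = 1 is an interior point and a function holomorphic on
  the disc equals its expansion there; this is how formal identities between symbols become
  identities between germs. Estimates are kept in the geometric form C R^n at one fixed index p.
  Such bounds pass through convolution and composition with explicit constants, and they return to a
  weighted square sum by enlarging q alone. The recentring at E(\<Phi>) is forced: a formal power
  series can be substituted into another one only if its constant term vanishes, and E(\<Phi>) is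
  the constant term of the symbol of \<Phi> at every \<theta>.\<close>

locale inner_product_on =
  fixes S :: "'a::real_vector set" and b :: "'a \<Rightarrow> 'a \<Rightarrow> real"
  assumes subspace_S: "subspace S"
    and sym: "x \<in> S \<Longrightarrow> y \<in> S \<Longrightarrow> b x y = b y x"
    and linear_left: "x \<in> S \<Longrightarrow> y \<in> S \<Longrightarrow> z \<in> S \<Longrightarrow> b (c *\<^sub>R x + d *\<^sub>R y) z = c * b x z + d * b y z"
    and pos: "x \<in> S \<Longrightarrow> x \<noteq> 0 \<Longrightarrow> 0 < b x x"
begin

abbreviation nm :: "'a \<Rightarrow> real" where "nm x \<equiv> sqrt (b x x)"

lemma S_closed [simp]:
  "0 \<in> S" "x \<in> S \<Longrightarrow> y \<in> S \<Longrightarrow> x + y \<in> S" "x \<in> S \<Longrightarrow> y \<in> S \<Longrightarrow> x - y \<in> S"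
  "x \<in> S \<Longrightarrow> c *\<^sub>R x \<in> S" "x \<in> S \<Longrightarrow> - x \<in> S"
  using subspace_S by (auto simp: subspace_add subspace_diff subspace_scale subspace_0 subspace_neg)

lemma S_sum [simp]: "(\<And>a. a \<in> A \<Longrightarrow> f a \<in> S) \<Longrightarrow> sum f A \<in> S"
  using subspace_S by (auto intro: subspace_sum)

lemma left_add: "x \<in> S \<Longrightarrow> y \<in> S \<Longrightarrow> z \<in> S \<Longrightarrow> b (x + y) z = b x z + b y z"
  using linear_left[of x y z 1 1] by simp

lemma left_diff: "x \<in> S \<Longrightarrow> y \<in> S \<Longrightarrow> z \<in> S \<Longrightarrow> b (x - y) z = b x z - b y z"
  using linear_left[of x y z 1 "-1"] by simp

lemma left_scale: "x \<in> S \<Longrightarrow> z \<in> S \<Longrightarrow> b (c *\<^sub>R x) z = c * b x z"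
  using linear_left[of x x z c 0] by simp

lemma right_add: "x \<in> S \<Longrightarrow> y \<in> S \<Longrightarrow> z \<in> S \<Longrightarrow> b z (x + y) = b z x + b z y"
  by (metis S_closed(2) left_add sym)

lemma right_diff: "x \<in> S \<Longrightarrow> y \<in> S \<Longrightarrow> z \<in> S \<Longrightarrow> b z (x - y) = b z x - b z y"
  by (metis S_closed(3) left_diff sym)

lemma right_scale: "x \<in> S \<Longrightarrow> z \<in> S \<Longrightarrow> b z (c *\<^sub>R x) = c * b z x"
  by (metis S_closed(4) left_scale sym)

lemma zero [simp]: "x \<in> S \<Longrightarrow> b 0 x = 0" "x \<in> S \<Longrightarrow> b x 0 = 0"
  using left_scale[of x x 0] right_scale[of x x 0] by simp_all

lemma left_sum: "(\<And>a. a \<in> A \<Longrightarrow> f a \<in> S) \<Longrightarrow> z \<in> S \<Longrightarrow> b (sum f A) z = (\<Sum>a\<in>A. b (f a) z)"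
  by (induction A rule: infinite_finite_induct) (simp_all add: left_add)

lemma right_sum: "(\<And>a. a \<in> A \<Longrightarrow> f a \<in> S) \<Longrightarrow> z \<in> S \<Longrightarrow> b z (sum f A) = (\<Sum>a\<in>A. b z (f a))"
  by (induction A rule: infinite_finite_induct) (simp_all add: right_add)

lemma nonneg [simp]: "x \<in> S \<Longrightarrow> 0 \<le> b x x"
  by (cases "x = 0") (auto dest: pos)

lemma nm_scale: "x \<in> S \<Longrightarrow> nm (c *\<^sub>R x) = \<bar>c\<bar> * nm x"
proof -
  assume x: "x \<in> S"
  have "b (c *\<^sub>R x) (c *\<^sub>R x) = c\<^sup>2 * b x x"
    using x by (simp add: left_scale right_scale power2_eq_square)
  then show ?thesis by (simp add: real_sqrt_mult)
qed

lemma cauchy_schwarz: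
  assumes x: "x \<in> S" and y: "y \<in> S"
  shows "\<bar>b x y\<bar> \<le> nm x * nm y"
proof (cases "y = 0")
  case True
  then show ?thesis using x by simp
next
  case False
  define c where "c = b x y / b y y"
  have p: "b y y > 0" using False y pos by blast
  have "0 \<le> b (x - c *\<^sub>R y) (x - c *\<^sub>R y)" using x y by (intro nonneg) simp
  also have "\<dots> = b x x - 2 * c * b x y + c\<^sup>2 * b y y"
    using x y by (simp add: left_diff right_diff left_scale right_scale sym[of y x] power2_eq_square
        algebra_simps)
  also have "\<dots> = b x x - (b x y)\<^sup>2 / b y y"
    using p by (simp add: c_def field_simps power2_eq_square)
  finally have "(b x y)\<^sup>2 \<le> b x x * b y y"
    using p by (simp add: field_simps)
  then have "sqrt ((b x y)\<^sup>2) \<le> sqrt (b x x * b y y)" by (rule real_sqrt_le_mono)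
  then show ?thesis by (simp add: real_sqrt_mult)
qed

lemma nm_triangle:
  assumes x: "x \<in> S" and y: "y \<in> S"
  shows "nm (x + y) \<le> nm x + nm y"
proof -
  have "b (x + y) (x + y) = b x x + 2 * b x y + b y y"
    using x y by (simp add: left_add right_add sym[of y x])
  also have "\<dots> \<le> (nm x)\<^sup>2 + 2 * (nm x * nm y) + (nm y)\<^sup>2"
    using cauchy_schwarz[OF x y] x y by simp
  also have "\<dots> = (nm x + nm y)\<^sup>2" by (simp add: power2_sum)
  finally show ?thesis using x y by (intro real_le_lsqrt) auto
qed

lemma nm_minus_commute: "x \<in> S \<Longrightarrow> y \<in> S \<Longrightarrow> nm (x - y) = nm (y - x)"
  using nm_scale[of "x - y" "-1"] by simp

lemma nm_triangle_diff:
  "x \<in> S \<Longrightarrow> y \<in> S \<Longrightarrow> z \<in> S \<Longrightarrow> nm (x - z) \<le> nm (x - y) + nm (y - z)"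
  using nm_triangle[of "x - y" "y - z"] by simp

section \<open>Finite orthonormal systems, projections and Gram-Schmidt\<close>

definition on :: "'a set \<Rightarrow> bool" where
  "on B \<longleftrightarrow> B \<subseteq> S \<and> (\<forall>e\<in>B. \<forall>f\<in>B. b e f = (if e = f then 1 else 0))"

lemma on_subset: "on B \<Longrightarrow> A \<subseteq> B \<Longrightarrow> on A"
  unfolding on_def by (meson subset_iff)

text \<open>For finite orthonormal B this is the orthogonal projection onto the span of B. Below,
  \<open>prj B x = x\<close> is used as the statement that x lies in that span.\<close>

definition prj :: "'a set \<Rightarrow> 'a \<Rightarrow> 'a" where
  "prj B x = (\<Sum>e\<in>B. b e x *\<^sub>R e)"

lemma on_coeff:
  assumes "on B" "finite B" "e \<in> B"
  shows "b e (\<Sum>f\<in>B. u f *\<^sub>R f) = u e"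
proof -
  have S: "f \<in> S" if "f \<in> B" for f using assms that by (auto simp: on_def)
  have "b e (\<Sum>f\<in>B. u f *\<^sub>R f) = (\<Sum>f\<in>B. u f * b e f)"
    using S assms(3) by (simp add: right_sum right_scale)
  also have "\<dots> = (\<Sum>f\<in>B. if f = e then u f else 0)"
    using assms by (intro sum.cong) (auto simp: on_def)
  finally show ?thesis using assms by simp
qed

lemma on_norm:
  assumes "on B" "finite B"
  shows "b (\<Sum>f\<in>B. u f *\<^sub>R f) (\<Sum>f\<in>B. u f *\<^sub>R f) = (\<Sum>f\<in>B. (u f)\<^sup>2)"
proof -
  have S: "f \<in> S" if "f \<in> B" for f using assms that by (auto simp: on_def)
  have "b (\<Sum>f\<in>B. u f *\<^sub>R f) (\<Sum>f\<in>B. u f *\<^sub>R f) = (\<Sum>e\<in>B. u e * b e (\<Sum>f\<in>B. u f *\<^sub>R f))"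
    using S by (subst left_sum) (simp_all add: left_scale)
  also have "\<dots> = (\<Sum>f\<in>B. (u f)\<^sup>2)"
    using assms by (intro sum.cong) (auto simp: on_coeff power2_eq_square)
  finally show ?thesis .
qed

lemma prj_in: "on B \<Longrightarrow> x \<in> S \<Longrightarrow> prj B x \<in> S"
  unfolding prj_def on_def by (intro S_sum S_closed(4)) auto

lemma prj_residual:
  assumes "on B" "finite B" "x \<in> S"
  shows "b (x - prj B x) (x - prj B x) = b x x - (\<Sum>e\<in>B. (b e x)\<^sup>2)"
proof -
  have S: "f \<in> S" if "f \<in> B" for f using assms that by (auto simp: on_def)
  have p: "prj B x \<in> S" using assms by (simp add: prj_in)
  have "b (prj B x) x = (\<Sum>e\<in>B. (b e x)\<^sup>2)"
    unfolding prj_def using S assms by (simp add: left_sum left_scale power2_eq_square)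
  moreover have "b (prj B x) (prj B x) = (\<Sum>e\<in>B. (b e x)\<^sup>2)"
    unfolding prj_def using assms on_norm[of B "\<lambda>e. b e x"] by blast
  ultimately show ?thesis
    using p assms by (simp add: left_diff right_diff sym[of x "prj B x"])
qed

lemma bessel: "on B \<Longrightarrow> finite B \<Longrightarrow> x \<in> S \<Longrightarrow> (\<Sum>e\<in>B. (b e x)\<^sup>2) \<le> b x x"
  using prj_residual[of B x] nonneg[of "x - prj B x"] by (simp add: prj_in)

lemma prj_diff: "on B \<Longrightarrow> x \<in> S \<Longrightarrow> y \<in> S \<Longrightarrow> prj B (x - y) = prj B x - prj B y"
  unfolding prj_def on_def
  by (subst sum_subtractf[symmetric], rule sum.cong) (auto simp: right_diff scaleR_diff_left)

lemma prj_eq_if_combination: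
  assumes "on B" "finite B"
  shows "prj B (\<Sum>f\<in>B. u f *\<^sub>R f) = (\<Sum>f\<in>B. u f *\<^sub>R f)"
  unfolding prj_def using assms by (intro sum.cong) (auto simp: on_coeff)

text \<open>The description of the new vector e as a multiple of the residual keeps the step inside
  any subspace containing B and x; this is what produces orthonormal systems inside N rather than
  merely inside S. In the second case x is already spanned by B.\<close>

lemma gram_schmidt_step:
  assumes "on B" "finite B" "x \<in> S"
  obtains e where "on (insert e B)" "prj (insert e B) x = x"
    "e \<in> B \<or> (\<exists>c. e = c *\<^sub>R (x - prj B x))" | "prj B x = x"
proof (cases "prj B x = x")
  case True
  then show ?thesis using that by blast
next
  case False
  define r where "r = x - prj B x"
  have rS: "r \<in> S" using assms by (simp add: r_def prj_in)
  have S: "f \<in> S" if "f \<in> B" for f using assms that by (auto simp: on_def)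
  have r0: "r \<noteq> 0" using False by (simp add: r_def)
  have np: "nm r > 0" using pos[OF rS r0] by simp
  define e where "e = (1 / nm r) *\<^sub>R r"
  have eS: "e \<in> S" using rS by (simp add: e_def)
  have orth_r: "b f r = 0" if "f \<in> B" for f
    using assms that S on_coeff[of B f "\<lambda>f. b f x"] unfolding r_def
    by (simp add: right_diff prj_in) (simp add: prj_def)
  have orth: "b f e = 0" "b e f = 0" if "f \<in> B" for f
    using orth_r[OF that] rS S[OF that] eS by (simp_all add: e_def right_scale left_scale sym[of r f])
  have "b e e = (1 / nm r)\<^sup>2 * b r r"
    unfolding e_def using rS by (simp add: left_scale right_scale power2_eq_square)
  also have "\<dots> = 1" using pos[OF rS r0] by (simp add: power_divide)
  finally have ee: "b e e = 1" .
  have on: "on (insert e B)"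
    unfolding on_def using eS S orth ee assms(1) by (auto simp: on_def)
  have enB: "e \<notin> B" using orth ee by force
  have "b e x = b e r"
  proof -
    have "b e (prj B x) = 0" unfolding prj_def using S eS orth by (simp add: right_sum right_scale)
    then show ?thesis unfolding r_def using eS assms by (simp add: right_diff prj_in)
  qed
  also have "\<dots> = nm r" unfolding e_def using rS np
    by (simp add: left_scale) (simp add: real_div_sqrt)
  finally have "b e x = nm r" .
  then have "prj (insert e B) x = nm r *\<^sub>R e + prj B x"
    unfolding prj_def using assms enB by simp
  also have "\<dots> = x" using np by (simp add: e_def r_def)
  finally show ?thesis using on that(1)[of e] unfolding e_def r_def by blast
qed

text \<open>Best approximation: since y lies in the span of B, x and x - y have the same residual,
  and a residual is never longer than its vector.\<close>

lemma prj_contract_residual: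
  assumes "on B" "finite B" "x \<in> S" "y \<in> S" "prj B y = y"
  shows "nm (x - prj B x) \<le> nm (x - y)"
proof -
  have "x - prj B x = (x - y) - prj B (x - y)" using assms by (simp add: prj_diff)
  moreover have "b ((x - y) - prj B (x - y)) ((x - y) - prj B (x - y)) \<le> b (x - y) (x - y)"
    using assms prj_residual[of B "x - y"] by (simp add: sum_nonneg)
  ultimately have "b (x - prj B x) (x - prj B x) \<le> b (x - y) (x - y)" by (simp only:)
  then show ?thesis by simp
qed

lemma prj_prj_mono:
  assumes "on C" "finite C" "B \<subseteq> C" "prj B y = y"
  shows "prj C y = y"
proof -
  have "prj B y = (\<Sum>f\<in>C. (if f \<in> B then b f y else 0) *\<^sub>R f)"
    unfolding prj_def using assms
    by (intro sum.mono_neutral_cong_left) auto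
  then show ?thesis using prj_eq_if_combination[OF assms(1,2), of "\<lambda>f. if f \<in> B then b f y else 0"] assms(4)
    by simp
qed

text \<open>Gives finitely many vectors finite orthonormal expansions, so that the Parseval identity
  for them is an equality of finite sums.\<close>

lemma finite_gram_schmidt:
  assumes "finite F" "F \<subseteq> S"
  obtains G where "on G" "finite G" "\<And>x. x \<in> F \<Longrightarrow> prj G x = x"
proof -
  have "\<exists>G. on G \<and> finite G \<and> (\<forall>x\<in>F. prj G x = x)" using assms
  proof (induction F rule: finite_induct)
    case empty
    then show ?case by (intro exI[of _ "{}"]) (simp add: on_def)
  next
    case (insert y F)
    then obtain G where G: "on G" "finite G" "\<forall>x\<in>F. prj G x = x" by auto
    have "y \<in> S" using insert by simp
    from gram_schmidt_step[OF G(1,2) this] show ?case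
    proof cases
      case (1 e)
      then show ?thesis using G prj_prj_mono[of "insert e G" G]
        by (intro exI[of _ "insert e G"]) auto
    next
      case 2
      then show ?thesis using G by blast
    qed
  qed
  then show ?thesis using that by blast
qed

text \<open>Gram-Schmidt along the dense sequence: from stage k + 1 on the span contains
  \<open>d k\<close>, so by best approximation the residual of x is at most its distance to
  \<open>d k\<close>. Only finite combinations are formed, hence the systems stay in T even if T is
  not closed.\<close>

lemma orthonormal_sequence_from_dense:
  assumes T: "subspace T" "T \<subseteq> S" and d: "\<And>k::nat. d k \<in> T"
    and dense: "\<And>x \<epsilon>. x \<in> T \<Longrightarrow> \<epsilon> > 0 \<Longrightarrow> \<exists>k. nm (x - d k) < \<epsilon>"
  obtains E :: "nat \<Rightarrow> 'a set" where "\<And>k. on (E k)" "\<And>k. finite (E k)" "\<And>k. E k \<subseteq> T"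
    "incseq E" "\<And>x. x \<in> T \<Longrightarrow> (\<lambda>k. nm (x - prj (E k) x)) \<longlonglongrightarrow> 0"
proof -
  define P where "P B \<longleftrightarrow> on B \<and> finite B \<and> B \<subseteq> T" for B
  have step: "\<exists>C. P C \<and> B \<subseteq> C \<and> prj C (d k) = d k" if "P B" for B k
  proof -
    have B: "on B" "finite B" "B \<subseteq> T" using that by (auto simp: P_def)
    have dS: "d k \<in> S" using d T by blast
    have pT: "d k - prj B (d k) \<in> T"
      unfolding prj_def using T d B
      by (intro subspace_diff subspace_sum subspace_scale) auto
    show ?thesis
      using gram_schmidt_step[OF B(1,2) dS]
    proof cases
      case (1 e)
      have "e \<in> T" using 1(3) B pT T by (auto simp: subspace_scale)
      then show ?thesis using 1 B by (intro exI[of _ "insert e B"]) (auto simp: P_def)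
    next
      case 2
      then show ?thesis using that by blast
    qed
  qed
  have "\<exists>E. \<forall>k. P (E k) \<and> E k \<subseteq> E (Suc k) \<and> prj (E (Suc k)) (d k) = d k"
  proof -
    have "\<exists>E. \<forall>k. P (E k) \<and> (E k \<subseteq> E (Suc k) \<and> prj (E (Suc k)) (d k) = d k)"
      by (rule dependent_nat_choice) (use step in \<open>auto simp: P_def on_def intro: exI[of _ "{}"]\<close>)
    then show ?thesis by blast
  qed
  then obtain E where E: "\<And>k. P (E k)" "\<And>k. E k \<subseteq> E (Suc k)" "\<And>k. prj (E (Suc k)) (d k) = d k"
    by blast
  have inc: "incseq E" using E(2) by (simp add: incseq_SucI)
  have lim: "(\<lambda>k. nm (x - prj (E k) x)) \<longlonglongrightarrow> 0" if x: "x \<in> T" for x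
  proof (rule LIMSEQ_I)
    fix \<epsilon> :: real assume "\<epsilon> > 0"
    then obtain k where k: "nm (x - d k) < \<epsilon>" using dense x by blast
    have xS: "x \<in> S" and dS: "d k \<in> S" using x d T by auto
    show "\<exists>M. \<forall>m\<ge>M. norm (nm (x - prj (E m) x) - 0) < \<epsilon>"
    proof (intro exI allI impI)
      fix m assume "Suc k \<le> m"
      then have "E (Suc k) \<subseteq> E m" using inc by (simp add: incseq_def)
      moreover have P: "on (E m)" "finite (E m)" using E(1)[of m] by (auto simp: P_def)
      ultimately have "prj (E m) (d k) = d k" using prj_prj_mono E(3) by blast
      then have "nm (x - prj (E m) x) \<le> nm (x - d k)"
        using prj_contract_residual[OF P xS dS] by simp
      moreover have "x - prj (E m) x \<in> S" using P xS by (simp add: prj_in)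
      ultimately show "norm (nm (x - prj (E m) x) - 0) < \<epsilon>"
        using k real_sqrt_ge_zero[OF nonneg[of "x - prj (E m) x"]] unfolding real_norm_def by linarith
    qed
  qed
  show ?thesis using that[of E] E(1) inc lim by (simp add: P_def)
qed

end

section \<open>Orthonormal series in complete spaces\<close>

locale complete_inner_product_on = inner_product_on +
  assumes complete: "(\<And>k. u k \<in> S) \<Longrightarrow>
      (\<And>\<epsilon>. \<epsilon> > 0 \<Longrightarrow> \<exists>M. \<forall>j\<ge>M. \<forall>k\<ge>M. nm (u j - u k) < \<epsilon>) \<Longrightarrow>
      \<exists>x\<in>S. (\<lambda>k. nm (u k - x)) \<longlonglongrightarrow> 0"
begin

text \<open>The Riesz-Fischer argument: the squared distance of two partial sums is the difference
  of the numbers \<open>q k\<close>, which increase and are bounded by C. The coefficients of the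
  limit are read off by continuity of the inner product.\<close>

lemma orthonormal_series_converges:
  assumes E: "\<And>k::nat. on (E k)" "\<And>k. finite (E k)" "incseq E"
    and bd: "\<And>k. (\<Sum>e\<in>E k. (u e)\<^sup>2) \<le> C"
  obtains x where "x \<in> S" "(\<lambda>k. nm ((\<Sum>e\<in>E k. u e *\<^sub>R e) - x)) \<longlonglongrightarrow> 0"
    "\<And>k e. e \<in> E k \<Longrightarrow> b e x = u e"
proof -
  define s where "s k = (\<Sum>e\<in>E k. u e *\<^sub>R e)" for k
  define q where "q k = (\<Sum>e\<in>E k. (u e)\<^sup>2)" for k
  have ES: "e \<in> S" if "e \<in> E k" for e k using E(1) that by (auto simp: on_def)
  have sS: "s k \<in> S" for k using ES by (simp add: s_def)
  have sub: "E j \<subseteq> E k" if "j \<le> k" for j k using E(3) that by (simp add: incseq_def)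
  have diff: "b (s k - s j) (s k - s j) = q k - q j" if "j \<le> k" for j k
  proof -
    have "s k - s j = (\<Sum>e\<in>E k - E j. u e *\<^sub>R e)"
      unfolding s_def using E(2) sub[OF that] by (simp add: sum_diff)
    then have "b (s k - s j) (s k - s j) = (\<Sum>e\<in>E k - E j. (u e)\<^sup>2)"
      using E on_subset[of "E k" "E k - E j"] on_norm[of "E k - E j" u] by auto
    then show ?thesis unfolding q_def using E(2) sub[OF that] by (simp add: sum_diff)
  qed
  have "incseq q" unfolding q_def
    by (intro incseq_SucI sum_mono2) (use E sub in auto)
  moreover have "q k \<le> C" for k using bd by (simp add: q_def)
  ultimately have "convergent q"
    by (meson incseq_convergent convergentI)
  then have "Cauchy q" by (rule convergent_Cauchy)
  have "\<exists>M. \<forall>j\<ge>M. \<forall>k\<ge>M. nm (s j - s k) < \<epsilon>" if "\<epsilon> > 0" for \<epsilon>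
  proof -
    have "\<epsilon>\<^sup>2 > 0" using that by simp
    then obtain M where M: "\<forall>j\<ge>M. \<forall>k\<ge>M. norm (q j - q k) < \<epsilon>\<^sup>2"
      using CauchyD[OF \<open>Cauchy q\<close>] by blast
    have "nm (s j - s k) < \<epsilon>" if "j \<ge> M" "k \<ge> M" "k \<le> j" for j k
    proof -
      have "b (s j - s k) (s j - s k) < \<epsilon>\<^sup>2"
        using M that diff[of k j] by fastforce
      then show ?thesis using \<open>\<epsilon> > 0\<close> by (simp add: real_sqrt_less_iff real_less_lsqrt)
    qed
    then show ?thesis using nm_minus_commute[OF sS sS] by (metis nle_le)
  qed
  then obtain x where x: "x \<in> S" "(\<lambda>k. nm (s k - x)) \<longlonglongrightarrow> 0"
    using complete[of s] sS by blast
  have "b e x = u e" if e: "e \<in> E k" for e k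
  proof -
    have "(\<lambda>j. b e (s j - x)) \<longlonglongrightarrow> 0"
    proof (rule Lim_null_comparison)
      show "\<forall>\<^sub>F j in sequentially. norm (b e (s j - x)) \<le> nm e * nm (s j - x)"
        using cauchy_schwarz[OF ES[OF e]] sS x by (intro always_eventually) auto
      show "(\<lambda>j. nm e * nm (s j - x)) \<longlonglongrightarrow> 0" using tendsto_mult_right_zero[OF x(2)] by auto
    qed
    moreover have "\<forall>\<^sub>F j in sequentially. b e (s j - x) = u e - b e x"
    proof (rule eventually_sequentiallyI)
      fix j assume "j \<ge> k"
      then have "e \<in> E j" using sub e by blast
      then have "b e (s j) = u e" unfolding s_def using E on_coeff by blast
      then show "b e (s j - x) = u e - b e x" using sS x ES[OF e] by (simp add: right_diff)
    qed
    ultimately have "(\<lambda>j. u e - b e x) \<longlonglongrightarrow> 0" by (simp cong: tendsto_cong)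
    then show ?thesis by (simp add: LIMSEQ_const_iff)
  qed
  then show ?thesis using that x unfolding s_def by blast
qed

text \<open>The Fourier sums of x converge to some y with the same coefficients; x - y is then
  orthogonal to the total system B and vanishes.\<close>

lemma countable_basis_expansion:
  assumes B: "on B" "countable B" and total: "\<And>y. y \<in> S \<Longrightarrow> (\<And>e. e \<in> B \<Longrightarrow> b y e = 0) \<Longrightarrow> y = 0"
    and x: "x \<in> S" and "\<epsilon> > 0"
  obtains F where "finite F" "F \<subseteq> B" "nm (x - prj F x) < \<epsilon>"
proof -
  define F where "F k = {e \<in> B. to_nat_on B e < k}" for k
  have fin: "finite (F k)" for k
  proof -
    have "inj_on (to_nat_on B) (F k)" 
      using inj_on_to_nat_on[OF B(2)] by (rule inj_on_subset) (auto simp: F_def)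
    moreover have "to_nat_on B ` F k \<subseteq> {..<k}" by (auto simp: F_def)
    ultimately show ?thesis by (meson finite_lessThan finite_subset finite_imageD)
  qed
  have on: "on (F k)" for k using B by (rule_tac on_subset) (auto simp: F_def)
  have inc: "incseq F" by (rule incseq_SucI) (auto simp: F_def)
  obtain y where y: "y \<in> S" "(\<lambda>k. nm ((\<Sum>e\<in>F k. b e x *\<^sub>R e) - y)) \<longlonglongrightarrow> 0"
    "\<And>k e. e \<in> F k \<Longrightarrow> b e y = b e x"
    using orthonormal_series_converges[OF on fin inc, of "\<lambda>e. b e x" "b x x"] bessel[OF on fin x]
    by blast
  have "x - y = 0"
  proof (rule total)
    show "x - y \<in> S" using x y by simp
    fix e assume e: "e \<in> B"
    then have "e \<in> F (Suc (to_nat_on B e))" by (simp add: F_def)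
    then have "b e y = b e x" by (rule y(3))
    moreover have "e \<in> S" using e B by (auto simp: on_def)
    ultimately show "b (x - y) e = 0" using x y(1) by (simp add: left_diff sym[of x e] sym[of y e])
  qed
  then have "(\<lambda>k. nm (prj (F k) x - x)) \<longlonglongrightarrow> 0" using y(2) by (simp add: prj_def)
  then obtain k where "norm (nm (prj (F k) x - x) - 0) < \<epsilon>"
    using LIMSEQ_D[OF _ \<open>\<epsilon> > 0\<close>] by blast
  then have "nm (x - prj (F k) x) < \<epsilon>"
    using nm_minus_commute[OF x prj_in[OF on x]] by simp
  then show ?thesis using that fin[of k] by (auto simp: F_def)
qed

end

context nuclear_triple
begin

section \<open>The chain of Hilbert spaces and its dual\<close>

lemma complete_inner_product: "complete_inner_product_on (Hs p) (ip p)"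
  using hilbert[of p] unfolding hilbert_on_def by unfold_locales blast+

sublocale H: complete_inner_product_on "Hs p" "ip p" for p
  by (rule complete_inner_product)

lemma nrm_eq: "nrm p \<xi> = H.nm p \<xi>"
  by (simp add: nrm_def)

lemma orthonormal_eq: "orthonormal p B = H.on p B"
  by (simp add: orthonormal_def H.on_def)

lemma N_subset: "N \<subseteq> Hs p"
  by (auto simp: N_def)

lemma N_Hs [simp]: "\<xi> \<in> N \<Longrightarrow> \<xi> \<in> Hs p"
  using N_subset by blast

lemma subspace_N: "subspace N"
  unfolding N_def by (rule subspace_Inter) (auto simp: H.subspace_S)

lemma N_closed [simp]:
  "0 \<in> N" "\<xi> \<in> N \<Longrightarrow> \<eta> \<in> N \<Longrightarrow> \<xi> + \<eta> \<in> N" "\<xi> \<in> N \<Longrightarrow> \<eta> \<in> N \<Longrightarrow> \<xi> - \<eta> \<in> N"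
  "\<xi> \<in> N \<Longrightarrow> c *\<^sub>R \<xi> \<in> N" "\<xi> \<in> N \<Longrightarrow> - \<xi> \<in> N"
  using subspace_N by (auto simp: subspace_add subspace_diff subspace_scale subspace_0 subspace_neg)

lemma N_sum [simp]: "(\<And>a. a \<in> A \<Longrightarrow> f a \<in> N) \<Longrightarrow> sum f A \<in> N"
  using subspace_N by (auto intro: subspace_sum)

lemma nrm_nonneg [simp]: "\<xi> \<in> Hs p \<Longrightarrow> 0 \<le> nrm p \<xi>"
  by (simp add: nrm_def)

lemma nrm_zero [simp]: "nrm p 0 = 0"
  by (simp add: nrm_def)

lemma nrm_eq_0: "\<xi> \<in> Hs p \<Longrightarrow> nrm p \<xi> = 0 \<longleftrightarrow> \<xi> = 0"
  using H.pos[of \<xi> p] by (force simp: nrm_def)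

lemma nrm_sq: "\<xi> \<in> Hs p \<Longrightarrow> (nrm p \<xi>)\<^sup>2 = ip p \<xi> \<xi>"
  by (simp add: nrm_def)

lemma nrm_scale: "\<xi> \<in> Hs p \<Longrightarrow> nrm p (c *\<^sub>R \<xi>) = \<bar>c\<bar> * nrm p \<xi>"
  by (simp only: nrm_eq H.nm_scale)

lemma nrm_le: "p \<le> q \<Longrightarrow> \<xi> \<in> Hs q \<Longrightarrow> nrm p \<xi> \<le> nrm q \<xi>"
  using nrm_mono[of p q \<xi>] by (cases "p = q") auto

text \<open>Nuclearity yields separability: the squared p-norms of an orthonormal basis of
  \<open>Hs p'\<close> are summable and nonzero, so the basis is countable and its rational
  combinations approximate N in the p-norm.\<close>

lemma countable_dense_N:
  obtains d :: "nat \<Rightarrow> 'h" where "\<And>k. d k \<in> N"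
    "\<And>\<xi> \<epsilon>. \<xi> \<in> N \<Longrightarrow> \<epsilon> > 0 \<Longrightarrow> \<exists>k. nrm p (\<xi> - d k) < \<epsilon>"
proof -
  obtain p' B where p': "p' > p" and sub: "Hs p' \<subseteq> Hs p" and B: "orthonormal_basis p' B"
    and sm: "(\<lambda>e. (nrm p e)\<^sup>2) summable_on B"
    using nuclear[of p] unfolding hilbert_schmidt_embedding_def by blast
  have on: "H.on p' B" and total: "\<And>y. y \<in> Hs p' \<Longrightarrow> (\<And>e. e \<in> B \<Longrightarrow> ip p' y e = 0) \<Longrightarrow> y = 0"
    using B unfolding orthonormal_basis_def orthonormal_eq by auto
  have BS: "e \<in> Hs p'" "e \<noteq> 0" if "e \<in> B" for e
    using on that unfolding H.on_def by force+
  have "countable {e \<in> B. (nrm p e)\<^sup>2 \<noteq> 0}"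
    using sm by (rule summable_countable_real)
  moreover have "{e \<in> B. (nrm p e)\<^sup>2 \<noteq> 0} = B"
    using BS sub nrm_eq_0[of _ p] by force
  ultimately have cB: "countable B" by simp
  define comb where "comb l = (\<Sum>(q, e)\<leftarrow>l. q *\<^sub>R e)" for l :: "(real \<times> 'h) list"
  define Q where "Q = comb ` lists (\<rat> \<times> B)"
  have "countable Q" unfolding Q_def using cB by (intro countable_image countable_lists countable_SIGMA) (auto simp: countable_rat)
  have approx: "\<exists>y\<in>Q. y \<in> Hs p' \<and> nrm p (\<xi> - y) < \<epsilon>" if \<xi>: "\<xi> \<in> N" and "\<epsilon> > 0" for \<xi> \<epsilon>
  proof -
    obtain F where F: "finite F" "F \<subseteq> B" "H.nm p' (\<xi> - H.prj p' F \<xi>) < \<epsilon> / 2"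
      using H.countable_basis_expansion[OF on cB total, of \<xi> "\<epsilon>/2"] \<xi> \<open>\<epsilon> > 0\<close> by auto
    have onF: "H.on p' F" using on F(2) H.on_subset by blast
    \<comment> \<open>Rounding the coefficients costs at most (1 + card F) \<delta> = \<epsilon> /
      2; the summand 1 allows for empty F.\<close>
    define \<delta> where "\<delta> = \<epsilon> / (2 * (1 + real (card F)))"
    have \<delta>: "\<delta> > 0" using \<open>\<epsilon> > 0\<close> by (simp add: \<delta>_def add_pos_nonneg)
    have "\<exists>q\<in>\<rat>. \<bar>t - q\<bar> < \<delta>" for t :: real
      proof -
      obtain q where "q \<in> \<rat>" "t - \<delta> < q" "q < t + \<delta>"
        using Rats_dense_in_real[of "t - \<delta>" "t + \<delta>"] \<delta> by auto
      then show ?thesis by (intro bexI[of _ q]) (auto simp: abs_if)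
    qed
    then obtain q where q: "\<And>t. q t \<in> \<rat>" "\<And>t. \<bar>t - q t\<bar> < \<delta>" by metis
    define y where "y = (\<Sum>e\<in>F. q (ip p' e \<xi>) *\<^sub>R e)"
    obtain es where es: "set es = F" "distinct es" using F(1) finite_distinct_list by blast
    have "y = comb (map (\<lambda>e. (q (ip p' e \<xi>), e)) es)"
      unfolding comb_def y_def using es by (simp add: comp_def sum_list_distinct_conv_sum_set)
    then have yQ: "y \<in> Q" unfolding Q_def using es F(2) q(1) by (auto intro!: imageI)
    have yS: "y \<in> Hs p'" unfolding y_def using F BS by (intro H.S_sum H.S_closed) auto
    have pS: "H.prj p' F \<xi> \<in> Hs p'" using onF \<xi> by (simp add: H.prj_in)
    have "H.prj p' F \<xi> - y = (\<Sum>e\<in>F. (ip p' e \<xi> - q (ip p' e \<xi>)) *\<^sub>R e)"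
      unfolding y_def H.prj_def by (simp add: sum_subtractf scaleR_diff_left)
    then have "ip p' (H.prj p' F \<xi> - y) (H.prj p' F \<xi> - y) = (\<Sum>e\<in>F. (ip p' e \<xi> - q (ip p' e \<xi>))\<^sup>2)"
      using H.on_norm[OF onF F(1)] by simp
    also have "\<dots> \<le> (\<Sum>e\<in>F. \<delta>\<^sup>2)"
      using q(2) \<delta> by (intro sum_mono) (simp add: abs_le_square_iff[symmetric] less_imp_le)
    also have "\<dots> = real (card F) * \<delta>\<^sup>2" by simp
    also have "\<dots> \<le> ((1 + real (card F)) * \<delta>)\<^sup>2"
      using \<delta> by (simp add: power_mult_distrib power2_eq_square algebra_simps)
    finally have "H.nm p' (H.prj p' F \<xi> - y) \<le> (1 + real (card F)) * \<delta>"
      using \<delta> by (intro real_le_lsqrt) auto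
    also have "\<dots> = \<epsilon> / 2" by (simp add: \<delta>_def field_simps)
    finally have "H.nm p' (\<xi> - y) < \<epsilon>"
      using H.nm_triangle_diff[of \<xi> p' "H.prj p' F \<xi>" y] F(3) \<xi> pS yS by simp
    moreover have "nrm p (\<xi> - y) \<le> nrm p' (\<xi> - y)"
      using p' \<xi> yS by (intro nrm_le) auto
    ultimately have "nrm p (\<xi> - y) < \<epsilon>" unfolding nrm_eq by (rule order_le_less_trans[rotated])
    then show ?thesis using yQ yS by blast
  qed
  \<comment> \<open>Members of Q lie in \<open>Hs p'\<close> but perhaps not in N. The map g
    replaces them by points of N at distance below 1 / (k + 1), if there are any; the default 0
    keeps its range in N.\<close>
  define g where "g = (\<lambda>(y, k::nat). if \<exists>\<eta>\<in>N. nrm p (\<eta> - y) < 1 / Suc k then SOME \<eta>. \<eta> \<in> N \<and> nrm p (\<eta> - y) < 1 / Suc k else 0)"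
  have gN: "g z \<in> N" for z unfolding g_def by (auto split: prod.split intro: someI2)
  have g: "nrm p (g (y, k) - y) < 1 / Suc k" if "\<exists>\<eta>\<in>N. nrm p (\<eta> - y) < 1 / Suc k" for y k
    using that someI_ex[of "\<lambda>\<eta>. \<eta> \<in> N \<and> nrm p (\<eta> - y) < 1 / Suc k"] unfolding g_def by auto
  define D where "D = insert 0 (g ` (Q \<times> UNIV))"
  have cD: "countable D" unfolding D_def using \<open>countable Q\<close> by auto
  have DN: "D \<subseteq> N" unfolding D_def using gN by auto
  have Ddense: "\<exists>d\<in>D. nrm p (\<xi> - d) < \<epsilon>" if \<xi>: "\<xi> \<in> N" and "\<epsilon> > 0" for \<xi> \<epsilon>
  proof -
    obtain k where k: "1 / Suc k < \<epsilon> / 2" using \<open>\<epsilon> > 0\<close> by (metis half_gt_zero nat_approx_posE)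
    obtain y where y: "y \<in> Q" "y \<in> Hs p'" "nrm p (\<xi> - y) < 1 / Suc k" using approx[OF \<xi>, of "1 / Suc k"] by auto
    have yS: "y \<in> Hs p" using y sub by auto
    have "nrm p (g (y, k) - y) < 1 / Suc k" using g y \<xi> by blast
    moreover have "nrm p (\<xi> - g (y, k)) \<le> nrm p (\<xi> - y) + nrm p (y - g (y, k))"
      using H.nm_triangle_diff[of \<xi> p y "g (y,k)"] \<xi> yS gN by (simp add: nrm_eq)
    moreover have "nrm p (y - g (y, k)) = nrm p (g (y, k) - y)"
      using H.nm_minus_commute[of y p "g (y,k)"] yS gN by (simp add: nrm_eq)
    ultimately have "nrm p (\<xi> - g (y, k)) < \<epsilon>" using y k by linarith
    then show ?thesis using y unfolding D_def by blast
  qed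
  have D0: "D \<noteq> {}" by (simp add: D_def)
  have 1: "from_nat_into D k \<in> N" for k using DN from_nat_into[OF D0, of k] by (rule subsetD)
  have 2: "\<exists>k. nrm p (\<xi> - from_nat_into D k) < \<epsilon>" if "\<xi> \<in> N" "\<epsilon> > 0" for \<xi> \<epsilon>
  proof -
    obtain e where e: "e \<in> D" "nrm p (\<xi> - e) < \<epsilon>" using Ddense[OF \<open>\<xi> \<in> N\<close> \<open>\<epsilon> > 0\<close>] by blast
    obtain k where "from_nat_into D k = e" using from_nat_into_surj[OF cD e(1)] by blast
    then show ?thesis using e(2) by blast
  qed
  show ?thesis by (rule that[OF 1 2])
qed

text \<open>\<open>N\<close> need not be dense in \<open>Hs p\<close>; all orthonormal expansions are therefore
  taken along a sequence of finite orthonormal sets inside \<open>N\<close> that exhausts \<open>N\<close> for the norm of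
  \<open>Hs p\<close>.\<close>

definition basis_seq :: "nat \<Rightarrow> (nat \<Rightarrow> 'h set) \<Rightarrow> bool" where
  "basis_seq p E \<longleftrightarrow> (\<forall>k. H.on p (E k)) \<and> (\<forall>k. finite (E k)) \<and> (\<forall>k. E k \<subseteq> N) \<and> incseq E \<and>
     (\<forall>\<xi>\<in>N. (\<lambda>k. nrm p (\<xi> - H.prj p (E k) \<xi>)) \<longlonglongrightarrow> 0)"

definition bas :: "nat \<Rightarrow> nat \<Rightarrow> 'h set" where
  "bas p = (SOME E. basis_seq p E)"

lemma basis_seq_bas: "basis_seq p (bas p)"
proof -
  obtain d :: "nat \<Rightarrow> 'h" where d: "\<And>k. d k \<in> N" "\<And>\<xi> \<epsilon>. \<xi> \<in> N \<Longrightarrow> \<epsilon> > 0 \<Longrightarrow> \<exists>k. nrm p (\<xi> - d k) < \<epsilon>"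
    using countable_dense_N[of p] by blast
  obtain E :: "nat \<Rightarrow> 'h set" where "\<And>k. H.on p (E k)" "\<And>k. finite (E k)" "\<And>k. E k \<subseteq> N"
    "incseq E" "\<And>x. x \<in> N \<Longrightarrow> (\<lambda>k. H.nm p (x - H.prj p (E k) x)) \<longlonglongrightarrow> 0"
    using H.orthonormal_sequence_from_dense[OF subspace_N N_subset, of d p] d unfolding nrm_eq by blast
  then have "basis_seq p E" unfolding basis_seq_def nrm_eq by blast
  then show ?thesis unfolding bas_def by (rule someI[of "basis_seq p"])
qed

lemma bas_on: "H.on p (bas p k)"
  and bas_finite [simp]: "finite (bas p k)"
  and bas_N: "bas p k \<subseteq> N"
  and bas_incseq: "incseq (bas p)"
  and bas_lim: "\<xi> \<in> N \<Longrightarrow> (\<lambda>k. nrm p (\<xi> - H.prj p (bas p k) \<xi>)) \<longlonglongrightarrow> 0"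
  using basis_seq_bas[of p] by (auto simp: basis_seq_def)

lemma bas_in_N [simp]: "e \<in> bas p k \<Longrightarrow> e \<in> N"
  using bas_N by blast

lemma bas_mono: "j \<le> k \<Longrightarrow> bas p j \<subseteq> bas p k"
  using bas_incseq[of p] by (simp add: incseq_def)

section \<open>Functionals on N and the union of the duals\<close>

lemma HnegD:
  assumes "x \<in> Hneg p"
  shows "\<xi> \<in> N \<Longrightarrow> \<eta> \<in> N \<Longrightarrow> x (c *\<^sub>R \<xi> + d *\<^sub>R \<eta>) = c * x \<xi> + d * x \<eta>"
    and "\<xi> \<notin> N \<Longrightarrow> x \<xi> = 0"
  using assms by (auto simp: Hneg_def)

lemma Hneg_bound:
  assumes "x \<in> Hneg p"
  obtains C where "C \<ge> 0" "\<And>\<xi>. \<xi> \<in> N \<Longrightarrow> \<bar>x \<xi>\<bar> \<le> C * nrm p \<xi>"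
proof -
  obtain C where C: "\<And>\<xi>. \<xi> \<in> N \<Longrightarrow> \<bar>x \<xi>\<bar> \<le> C * nrm p \<xi>" using assms unfolding Hneg_def by blast
  have "\<bar>x \<xi>\<bar> \<le> \<bar>C\<bar> * nrm p \<xi>" if "\<xi> \<in> N" for \<xi>
    using C[OF that] mult_right_mono[OF abs_ge_self[of C], of "nrm p \<xi>"] that by force
  then show ?thesis using that[of "\<bar>C\<bar>"] by auto
qed

lemma Hneg_mono: "p \<le> q \<Longrightarrow> Hneg p \<subseteq> Hneg q"
proof
  fix x assume pq: "p \<le> q" and x: "x \<in> Hneg p"
  obtain C where "C \<ge> 0" "\<And>\<xi>. \<xi> \<in> N \<Longrightarrow> \<bar>x \<xi>\<bar> \<le> C * nrm p \<xi>" using Hneg_bound[OF x] by blast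
  then have "\<bar>x \<xi>\<bar> \<le> C * nrm q \<xi>" if "\<xi> \<in> N" for \<xi>
    using that nrm_le[OF pq, of \<xi>] mult_left_mono[of "nrm p \<xi>" "nrm q \<xi>" C] by fastforce
  then show "x \<in> Hneg q" using x unfolding Hneg_def by blast
qed

lemma Hneg_N': "Hneg p \<subseteq> N'"
  by (auto simp: N'_def)

lemma Hneg_comb:
  assumes "x \<in> Hneg p" "y \<in> Hneg p"
  shows "(\<lambda>\<xi>. c * x \<xi> + d * y \<xi>) \<in> Hneg p"
proof -
  obtain C where C: "\<And>\<xi>. \<xi> \<in> N \<Longrightarrow> \<bar>x \<xi>\<bar> \<le> C * nrm p \<xi>" using Hneg_bound[OF assms(1)] by blast
  obtain D where D: "\<And>\<xi>. \<xi> \<in> N \<Longrightarrow> \<bar>y \<xi>\<bar> \<le> D * nrm p \<xi>" using Hneg_bound[OF assms(2)] by blast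
  have "\<bar>c * x \<xi> + d * y \<xi>\<bar> \<le> (\<bar>c\<bar> * C + \<bar>d\<bar> * D) * nrm p \<xi>" if "\<xi> \<in> N" for \<xi>
  proof -
    have "\<bar>c * x \<xi> + d * y \<xi>\<bar> \<le> \<bar>c\<bar> * \<bar>x \<xi>\<bar> + \<bar>d\<bar> * \<bar>y \<xi>\<bar>"
      by (metis abs_mult abs_triangle_ineq)
    also have "\<dots> \<le> \<bar>c\<bar> * (C * nrm p \<xi>) + \<bar>d\<bar> * (D * nrm p \<xi>)"
      using C[OF that] D[OF that] by (intro add_mono mult_left_mono) auto
    finally show ?thesis by (simp add: algebra_simps)
  qed
  moreover have "c * x (a *\<^sub>R \<xi> + a' *\<^sub>R \<eta>) + d * y (a *\<^sub>R \<xi> + a' *\<^sub>R \<eta>) =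
      a * (c * x \<xi> + d * y \<xi>) + a' * (c * x \<eta> + d * y \<eta>)" if "\<xi> \<in> N" "\<eta> \<in> N" for \<xi> \<eta> a a'
    unfolding HnegD(1)[OF assms(1) that] HnegD(1)[OF assms(2) that] by (simp add: algebra_simps)
  ultimately show ?thesis
    using HnegD(2)[OF assms(1)] HnegD(2)[OF assms(2)] unfolding Hneg_def by auto
qed

lemma Hneg_0 [simp]: "(\<lambda>_. 0) \<in> Hneg p"
  unfolding Hneg_def by (auto intro: exI[of _ 0])

lemma Hneg_scale: "x \<in> Hneg p \<Longrightarrow> (\<lambda>\<xi>. c * x \<xi>) \<in> Hneg p"
  using Hneg_comb[of x p x c 0] by simp

text \<open>The duals increase with p, so finitely many functionals have a common index. The lower
  bound q makes the index as large as wanted, which is the form that \<open>tensI\<close> asks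
  for.\<close>

lemma N'_obtain_Hneg:
  assumes "set xs \<subseteq> N'"
  obtains p where "q \<le> p" "set xs \<subseteq> Hneg p"
proof -
  have "\<exists>p\<ge>q. set xs \<subseteq> Hneg p" using assms
  proof (induction xs)
    case (Cons x xs)
    then obtain p where p: "q \<le> p" "set xs \<subseteq> Hneg p" by auto
    obtain p' where "x \<in> Hneg p'" using Cons by (auto simp: N'_def)
    then show ?case using p Hneg_mono[of p "max p p'"] Hneg_mono[of p' "max p p'"]
      by (intro exI[of _ "max p p'"]) auto
  qed auto
  then show ?thesis using that by blast
qed

lemma N'_comb: "x \<in> N' \<Longrightarrow> y \<in> N' \<Longrightarrow> (\<lambda>\<xi>. c * x \<xi> + d * y \<xi>) \<in> N'"
proof -
  assume "x \<in> N'" "y \<in> N'"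
  then obtain p where "x \<in> Hneg p" "y \<in> Hneg p" using N'_obtain_Hneg[of "[x, y]" 0] by auto
  then show ?thesis using Hneg_comb Hneg_N' by blast
qed

lemma N'_scale: "x \<in> N' \<Longrightarrow> (\<lambda>\<xi>. c * x \<xi>) \<in> N'"
  using N'_comb[of x x c 0] by simp

lemma N'_0 [simp]: "(\<lambda>_. 0) \<in> N'"
  using Hneg_0 Hneg_N' by blast

lemma N'_linear:
  assumes "x \<in> N'" "\<xi> \<in> N" "\<eta> \<in> N"
  shows "x (c *\<^sub>R \<xi> + d *\<^sub>R \<eta>) = c * x \<xi> + d * x \<eta>"
  using assms HnegD(1) by (auto simp: N'_def)

lemma N'_linear_simps:
  assumes "x \<in> N'" "\<xi> \<in> N" "\<eta> \<in> N"
  shows "x (\<xi> + \<eta>) = x \<xi> + x \<eta>" "x (\<xi> - \<eta>) = x \<xi> - x \<eta>" "x (c *\<^sub>R \<xi>) = c * x \<xi>"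
  using N'_linear[OF assms, of 1 1] N'_linear[OF assms, of 1 "-1"] N'_linear[OF assms(1,2,2), of c 0]
  by simp_all

lemma N'_at_scale: "x \<in> N' \<Longrightarrow> \<xi> \<in> N \<Longrightarrow> x (c *\<^sub>R \<xi>) = c * x \<xi>"
  by (rule N'_linear_simps(3))

lemma N'_at_0 [simp]: "x \<in> N' \<Longrightarrow> x 0 = 0"
  using N'_linear_simps(3)[of x 0 0 0] by simp

lemma N'_at_sum: "x \<in> N' \<Longrightarrow> (\<And>a. a \<in> A \<Longrightarrow> f a \<in> N) \<Longrightarrow> x (sum f A) = (\<Sum>a\<in>A. x (f a))"
  by (induction A rule: infinite_finite_induct) (simp_all add: N'_linear_simps)

section \<open>Riesz functionals and the representation theorem\<close>

lemma riesz_Hneg [simp]: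
  assumes "f \<in> Hs p"
  shows "riesz p f \<in> Hneg p"
proof -
  have "\<bar>ip p f \<xi>\<bar> \<le> nrm p f * nrm p \<xi>" if "\<xi> \<in> N" for \<xi>
    using H.cauchy_schwarz[of f p \<xi>] assms that by (simp add: nrm_def)
  then show ?thesis using assms unfolding Hneg_def riesz_def
    by (auto simp: H.right_add H.right_scale)
qed

lemma riesz_N' [simp]: "f \<in> Hs p \<Longrightarrow> riesz p f \<in> N'"
  using riesz_Hneg Hneg_N' by blast

lemma riesz_comb:
  assumes "f \<in> Hs p" "g \<in> Hs p"
  shows "riesz p (c *\<^sub>R f + d *\<^sub>R g) = (\<lambda>\<xi>. c * riesz p f \<xi> + d * riesz p g \<xi>)"
  using assms by (auto simp: riesz_def fun_eq_iff H.left_add H.left_scale)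

lemma riesz_sum:
  assumes "\<And>e. e \<in> A \<Longrightarrow> e \<in> Hs p"
  shows "riesz p (\<Sum>e\<in>A. u e *\<^sub>R e) = (\<lambda>\<xi>. \<Sum>e\<in>A. u e * riesz p e \<xi>)"
  using assms by (auto simp: riesz_def fun_eq_iff H.left_sum H.left_scale)

text \<open>Applying x to its own truncated expansion \<xi> gives s \<le> C sqrt s for the partial
  sum s of squares, hence s \<le> C^2.\<close>

lemma Hneg_coeff_bound:
  assumes "x \<in> Hneg p"
  shows "\<exists>C. \<forall>k. (\<Sum>e\<in>bas p k. (x e)\<^sup>2) \<le> C"
proof -
  obtain C where C: "C \<ge> 0" "\<And>\<xi>. \<xi> \<in> N \<Longrightarrow> \<bar>x \<xi>\<bar> \<le> C * nrm p \<xi>" using Hneg_bound[OF assms] by blast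
  have "(\<Sum>e\<in>bas p k. (x e)\<^sup>2) \<le> C\<^sup>2" for k
  proof -
    define s where "s = (\<Sum>e\<in>bas p k. (x e)\<^sup>2)"
    define \<xi> where "\<xi> = (\<Sum>e\<in>bas p k. x e *\<^sub>R e)"
    have \<xi>N: "\<xi> \<in> N" by (simp add: \<xi>_def)
    have xN: "x \<in> N'" using assms Hneg_N' by blast
    have "x \<xi> = s" unfolding \<xi>_def s_def using xN
      by (simp add: N'_at_sum N'_at_scale power2_eq_square)
    moreover have "nrm p \<xi> = sqrt s"
      unfolding nrm_def \<xi>_def s_def using H.on_norm[OF bas_on bas_finite] by simp
    moreover have s0: "s \<ge> 0" by (simp add: s_def sum_nonneg)
    ultimately have "s \<le> C * sqrt s" using C(2)[OF \<xi>N] by simp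
    then have "sqrt s * sqrt s \<le> C * sqrt s" using s0 by simp
    then have "sqrt s \<le> C"
      using C(1) s0 mult_right_le_imp_le[of "sqrt s" "sqrt s" C] by (cases "s = 0") auto
    then have "s \<le> C\<^sup>2" by (rule sqrt_le_D)
    then show ?thesis by (simp add: s_def)
  qed
  then show ?thesis by blast
qed

text \<open>The coefficients \<open>x e\<close> along \<open>bas p\<close> define f by
  Riesz-Fischer. The functional of f and x agree on the spans of the \<open>bas p k\<close> and are
  continuous for the p-norm, so they agree on N. The vector f is a limit of elements of N and may
  lie outside N; the third conclusion records the approximation.\<close>

lemma riesz_representation:
  assumes "x \<in> Hneg p"
  obtains f where "f \<in> Hs p" "riesz p f = x"
    "(\<lambda>k. nrm p ((\<Sum>e\<in>bas p k. x e *\<^sub>R e) - f)) \<longlonglongrightarrow> 0"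
proof -
  have xN: "x \<in> N'" using assms Hneg_N' by blast
  obtain C where C: "\<And>k. (\<Sum>e\<in>bas p k. (x e)\<^sup>2) \<le> C" using Hneg_coeff_bound[OF assms] by blast
  obtain f where f: "f \<in> Hs p" "(\<lambda>k. H.nm p ((\<Sum>e\<in>bas p k. x e *\<^sub>R e) - f)) \<longlonglongrightarrow> 0"
    "\<And>k e. e \<in> bas p k \<Longrightarrow> ip p e f = x e"
    using H.orthonormal_series_converges[OF bas_on bas_finite bas_incseq C] by blast
  obtain K where K: "K \<ge> 0" "\<And>\<xi>. \<xi> \<in> N \<Longrightarrow> \<bar>x \<xi>\<bar> \<le> K * nrm p \<xi>" using Hneg_bound[OF assms] by blast
  obtain K' where K': "K' \<ge> 0" "\<And>\<xi>. \<xi> \<in> N \<Longrightarrow> \<bar>riesz p f \<xi>\<bar> \<le> K' * nrm p \<xi>"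
    using Hneg_bound[OF riesz_Hneg[OF f(1)]] by blast
  have "riesz p f \<xi> = x \<xi>" for \<xi>
  proof (cases "\<xi> \<in> N")
    case True
    define P where "P k = H.prj p (bas p k) \<xi>" for k
    have PN: "P k \<in> N" for k using True by (simp add: P_def H.prj_def)
    have "riesz p f e = x e" if "e \<in> bas p k" for e k
      using f(1) f(3)[OF that] that by (simp add: riesz_def H.sym[of f p])
    then have eq: "riesz p f (P k) = x (P k)" for k
      unfolding P_def H.prj_def using xN riesz_N'[OF f(1)]
      by (simp add: N'_at_sum N'_at_scale)
    have "(\<lambda>k. riesz p f \<xi> - x \<xi>) \<longlonglongrightarrow> 0"
    proof (rule Lim_null_comparison)
      show "\<forall>\<^sub>F k in sequentially. norm (riesz p f \<xi> - x \<xi>) \<le> (K' + K) * nrm p (\<xi> - P k)"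
      proof (intro always_eventually allI)
        fix k
        have "riesz p f \<xi> - x \<xi> = riesz p f (\<xi> - P k) - x (\<xi> - P k)"
          using eq xN riesz_N'[OF f(1)] True PN by (simp add: N'_linear_simps)
        then show "norm (riesz p f \<xi> - x \<xi>) \<le> (K' + K) * nrm p (\<xi> - P k)"
          using K(2)[of "\<xi> - P k"] K'(2)[of "\<xi> - P k"] True PN by (simp add: distrib_right)
      qed
      show "(\<lambda>k. (K' + K) * nrm p (\<xi> - P k)) \<longlonglongrightarrow> 0"
        unfolding P_def using tendsto_mult_right_zero[OF bas_lim[OF True]] by blast
    qed
    then show ?thesis by (simp add: LIMSEQ_const_iff)
  next
    case False
    then show ?thesis using HnegD(2)[OF assms] by (simp add: riesz_def)
  qed
  then have "riesz p f = x" by (rule ext)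
  then show ?thesis by (rule that[OF f(1) _ f(2)[folded nrm_eq]])
qed

end

section \<open>Sums\<close>

abbreviation tuples :: "'a set \<Rightarrow> nat \<Rightarrow> 'a list set" where
  "tuples A n \<equiv> {es. set es \<subseteq> A \<and> length es = n}"

lemma finite_tuples [simp]: "finite A \<Longrightarrow> finite (tuples A n)"
  by (rule finite_lists_length_eq)

lemma tuples_0 [simp]: "tuples A 0 = {[]}" "{es. es = [] \<and> set es \<subseteq> A} = {[]}"
  by auto

lemma sum_tuples_Suc:
  "(\<Sum>es\<in>tuples A (Suc n). f es) = (\<Sum>e\<in>A. \<Sum>es\<in>tuples A n. f (e # es))"
proof -
  have eq: "tuples A (Suc n) = (\<lambda>(e, es). e # es) ` (A \<times> tuples A n)"
    by (auto simp: length_Suc_conv image_iff)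
  have inj: "inj_on (\<lambda>(e, es). e # es) (A \<times> tuples A n)"
    by (auto simp: inj_on_def)
  show ?thesis
    unfolding eq sum.reindex[OF inj] sum.cartesian_product by (simp add: comp_def case_prod_unfold)
qed

lemma sum_prod_list_tuples:
  fixes g :: "'a \<Rightarrow> 'b::comm_semiring_1"
  shows "(\<Sum>es\<in>tuples A n. prod_list (map g es)) = (\<Sum>e\<in>A. g e) ^ n"
proof (induction n)
  case (Suc n)
  have "(\<Sum>es\<in>tuples A (Suc n). prod_list (map g es)) =
      (\<Sum>e\<in>A. \<Sum>es\<in>tuples A n. g e * prod_list (map g es))"
    by (simp add: sum_tuples_Suc)
  also have "\<dots> = (\<Sum>e\<in>A. g e) * (\<Sum>e\<in>A. g e) ^ n"
    unfolding sum_distrib_left[symmetric] Suc by (simp add: sum_distrib_right)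
  finally show ?case by simp
qed simp

lemma has_sum_finite_sum:
  fixes f :: "'g \<Rightarrow> 'b \<Rightarrow> real"
  assumes "finite G" "\<And>g. g \<in> G \<Longrightarrow> (f g has_sum s g) B"
  shows "((\<lambda>b. \<Sum>g\<in>G. f g b) has_sum (\<Sum>g\<in>G. s g)) B"
  using assms by (induction G rule: finite_induct) (auto intro: has_sum_add)

lemma cauchy_schwarz_cmod_sum:
  fixes a z :: "'i \<Rightarrow> complex"
  shows "(cmod (\<Sum>i\<in>A. a i * z i))\<^sup>2 \<le> (\<Sum>i\<in>A. (cmod (a i))\<^sup>2) * (\<Sum>i\<in>A. (cmod (z i))\<^sup>2)"
proof -
  have "cmod (\<Sum>i\<in>A. a i * z i) \<le> (\<Sum>i\<in>A. cmod (a i) * cmod (z i))"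
    using norm_sum[of "\<lambda>i. a i * z i" A] by (simp add: norm_mult)
  then have "(cmod (\<Sum>i\<in>A. a i * z i))\<^sup>2 \<le> (\<Sum>i\<in>A. cmod (a i) * cmod (z i))\<^sup>2"
    by (simp add: power_mono)
  also have "\<dots> \<le> (\<Sum>i\<in>A. (cmod (a i))\<^sup>2) * (\<Sum>i\<in>A. (cmod (z i))\<^sup>2)"
    by (rule Cauchy_Schwarz_ineq_sum)
  finally show ?thesis .
qed

context nuclear_triple
begin

section \<open>Symmetric forms\<close>

lemma sf_perm: "symmetric_form n \<phi> \<Longrightarrow> mset xs = mset ys \<Longrightarrow> \<phi> xs = \<phi> ys"
  unfolding symmetric_form_def by blast

lemma sf_out: "symmetric_form n \<phi> \<Longrightarrow> \<not> (length xs = n \<and> set xs \<subseteq> N') \<Longrightarrow> \<phi> xs = 0"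
  unfolding symmetric_form_def by blast

text \<open>Outside the length and domain conditions of \<open>symmetric_form\<close> all terms are
  0, so linearity in the first slot extends to every tail.\<close>

lemma sf_lin:
  assumes "symmetric_form n \<phi>" "x \<in> N'" "y \<in> N'"
  shows "\<phi> ((\<lambda>\<xi>. c * x \<xi> + d * y \<xi>) # xs) = complex_of_real c * \<phi> (x # xs) + complex_of_real d * \<phi> (y # xs)"
proof (cases "set xs \<subseteq> N' \<and> Suc (length xs) = n")
  case True
  then show ?thesis using assms unfolding symmetric_form_def by blast
next
  case False
  then have "\<phi> (z # xs) = 0" for z by (intro sf_out[OF assms(1)]) auto
  then show ?thesis by simp
qed

lemma sf_scale: "symmetric_form n \<phi> \<Longrightarrow> x \<in> N' \<Longrightarrow> \<phi> ((\<lambda>\<xi>. c * x \<xi>) # xs) = complex_of_real c * \<phi> (x # xs)"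
  using sf_lin[of n \<phi> x x c 0] by simp

lemma sf_zero: "symmetric_form n \<phi> \<Longrightarrow> \<phi> ((\<lambda>\<xi>. 0) # xs) = 0"
  using sf_scale[of n \<phi> "\<lambda>_. 0" 0] by simp

lemma sf_zero_mem: "symmetric_form n \<phi> \<Longrightarrow> (\<lambda>\<xi>. 0) \<in> set xs \<Longrightarrow> \<phi> xs = 0"
proof -
  assume s: "symmetric_form n \<phi>" and "(\<lambda>\<xi>. 0) \<in> set xs"
  then obtain ys zs where "xs = ys @ (\<lambda>\<xi>. 0) # zs" by (meson split_list)
  then have "\<phi> xs = \<phi> ((\<lambda>\<xi>. 0) # ys @ zs)" by (intro sf_perm[OF s]) simp
  then show ?thesis using sf_zero[OF s] by simp
qed

lemma N'_sum: "finite A \<Longrightarrow> (\<And>a. a \<in> A \<Longrightarrow> v a \<in> N') \<Longrightarrow> (\<lambda>\<xi>. \<Sum>a\<in>A. c a * v a \<xi>) \<in> N'"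
proof (induction A rule: finite_induct)
  case (insert a A)
  then show ?case using N'_comb[of "v a" "\<lambda>\<xi>. \<Sum>a\<in>A. c a * v a \<xi>" "c a" 1] by simp
qed simp

lemma sf_sum:
  assumes s: "symmetric_form n \<phi>" and "finite A" "\<And>a. a \<in> A \<Longrightarrow> v a \<in> N'"
  shows "\<phi> ((\<lambda>\<xi>. \<Sum>a\<in>A. c a * v a \<xi>) # xs) = (\<Sum>a\<in>A. complex_of_real (c a) * \<phi> (v a # xs))"
  using assms(2,3)
proof (induction A rule: finite_induct)
  case empty
  then show ?case using sf_zero[OF s] by simp
next
  case (insert a A)
  then show ?case
    using sf_lin[OF s, of "v a" "\<lambda>\<xi>. \<Sum>a\<in>A. c a * v a \<xi>" "c a" 1 xs] N'_sum[of A v c] by simp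
qed

lemma sf_slices:
  assumes s: "symmetric_form (length xs + n) \<phi>" and xs: "set xs \<subseteq> N'"
  shows "symmetric_form n (\<lambda>ys. \<phi> (xs @ ys))"
  unfolding symmetric_form_def
proof (intro conjI allI ballI impI)
  fix ys zs :: "('h \<Rightarrow> real) list" assume "mset ys = mset zs"
  then show "\<phi> (xs @ ys) = \<phi> (xs @ zs)" by (intro sf_perm[OF s]) simp
next
  fix x y c d and ys :: "('h \<Rightarrow> real) list"
  assume "x \<in> N'" "y \<in> N'" "set ys \<subseteq> N' \<and> Suc (length ys) = n"
  have mv: "\<phi> (xs @ z # ys) = \<phi> (z # xs @ ys)" for z by (intro sf_perm[OF s]) simp
  show "\<phi> (xs @ (\<lambda>\<xi>. c * x \<xi> + d * y \<xi>) # ys) =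
      complex_of_real c * \<phi> (xs @ x # ys) + complex_of_real d * \<phi> (xs @ y # ys)"
    unfolding mv using sf_lin[OF s] \<open>x \<in> N'\<close> \<open>y \<in> N'\<close> by blast
next
  fix ys :: "('h \<Rightarrow> real) list" assume "\<not> (length ys = n \<and> set ys \<subseteq> N')"
  then show "\<phi> (xs @ ys) = 0" by (intro sf_out[OF s]) auto
qed

lemma sf_slice: "symmetric_form (Suc n) \<phi> \<Longrightarrow> x \<in> N' \<Longrightarrow> symmetric_form n (\<lambda>ys. \<phi> (x # ys))"
  using sf_slices[of "[x]" n \<phi>] by simp

lemma sf_comb:
  assumes "symmetric_form n \<phi>" "symmetric_form n \<psi>"
  shows "symmetric_form n (\<lambda>xs. c * \<phi> xs + d * \<psi> xs)"
  unfolding symmetric_form_def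
proof (intro conjI allI ballI impI)
  fix ys zs :: "('h \<Rightarrow> real) list" assume "mset ys = mset zs"
  then show "c * \<phi> ys + d * \<psi> ys = c * \<phi> zs + d * \<psi> zs"
    using sf_perm[OF assms(1)] sf_perm[OF assms(2)] by metis
next
  fix x y a b and ys :: "('h \<Rightarrow> real) list"
  assume "x \<in> N'" "y \<in> N'"
  then show "c * \<phi> ((\<lambda>\<xi>. a * x \<xi> + b * y \<xi>) # ys) + d * \<psi> ((\<lambda>\<xi>. a * x \<xi> + b * y \<xi>) # ys) =
      complex_of_real a * (c * \<phi> (x # ys) + d * \<psi> (x # ys)) + complex_of_real b * (c * \<phi> (y # ys) + d * \<psi> (y # ys))"
    using sf_lin[OF assms(1)] sf_lin[OF assms(2)] by (simp add: algebra_simps)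
next
  fix ys :: "('h \<Rightarrow> real) list" assume "\<not> (length ys = n \<and> set ys \<subseteq> N')"
  then show "c * \<phi> ys + d * \<psi> ys = 0" using sf_out[OF assms(1)] sf_out[OF assms(2)] by simp
qed

lemma sf_0 [simp]: "symmetric_form n (\<lambda>_. 0)"
  unfolding symmetric_form_def by simp

text \<open>Polarization by differentiation. Each of the m equal slots contributes b once to the
  derivative, and symmetry makes the m contributions equal. For m = 0 the truncated m - 1 is
  harmless because of the factor m.\<close>

lemma sf_diagonal_derivative:
  assumes s: "symmetric_form n \<phi>" and a: "a \<in> N'" and b: "b \<in> N'"
  shows "((\<lambda>t. \<phi> (replicate m (\<lambda>\<xi>. a \<xi> + t * b \<xi>) @ zs)) has_vector_derivative
      of_nat m * \<phi> (replicate (m - 1) a @ b # zs)) (at 0)"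
proof (induction m arbitrary: zs)
  case 0
  then show ?case by simp
next
  case (Suc m)
  let ?s = "\<lambda>t \<xi>. a \<xi> + t * b \<xi>"
  \<comment> \<open>One slot is expanded by linearity, giving a summand without t and one with the
    factor t; the product rule at t = 0 then leads from m to m + 1.\<close>
  have eq: "\<phi> (replicate (Suc m) (?s t) @ zs) =
      \<phi> (replicate m (?s t) @ a # zs) + t *\<^sub>R \<phi> (replicate m (?s t) @ b # zs)" for t
  proof -
    have "\<phi> (replicate (Suc m) (?s t) @ zs) = \<phi> (a # replicate m (?s t) @ zs) + t * \<phi> (b # replicate m (?s t) @ zs)"
      using sf_lin[OF s a b, of 1 t] by simp
    moreover have "\<phi> (c # replicate m (?s t) @ zs) = \<phi> (replicate m (?s t) @ c # zs)" for c
      by (intro sf_perm[OF s]) simp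
    ultimately show ?thesis by (simp add: scaleR_conv_of_real)
  qed
  have "((\<lambda>t. \<phi> (replicate m (?s t) @ a # zs) + t *\<^sub>R \<phi> (replicate m (?s t) @ b # zs)) has_vector_derivative
      of_nat m * \<phi> (replicate (m - 1) a @ b # a # zs) +
      (0 *\<^sub>R (of_nat m * \<phi> (replicate (m - 1) a @ b # b # zs)) + 1 *\<^sub>R \<phi> (replicate m (?s 0) @ b # zs))) (at 0)"
    by (intro has_vector_derivative_add Suc has_vector_derivative_scaleR)
      (auto intro!: derivative_eq_intros)
  moreover have eq2: "of_nat m * \<phi> (replicate (m - Suc 0) a @ b # a # zs) = of_nat m * \<phi> (replicate m a @ b # zs)"
  proof (cases m)
    case (Suc m')
    then show ?thesis by (intro arg_cong2[of _ _ _ _ "(*)"] refl sf_perm[OF s]) simp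
  qed simp
  ultimately show ?case unfolding eq by (simp add: eq2 algebra_simps)
qed

text \<open>Free arguments are introduced one at a time: if the form vanishes for all y in the
  remaining equal slots, it vanishes along y + t b, and the derivative at t = 0 frees one slot.
  Hence y must stay arbitrary in the induction.\<close>

lemma sf_zero_if_diagonal_zero:
  assumes s: "symmetric_form n \<phi>" and diag: "\<And>x. x \<in> N' \<Longrightarrow> \<phi> (replicate n x) = 0"
  shows "\<phi> xs = 0"
proof -
  have *: "\<phi> (replicate (n - length zs) y @ zs) = 0"
    if "set zs \<subseteq> N'" "length zs \<le> n" "y \<in> N'" for zs y
    using that
  proof (induction zs arbitrary: y)
    case Nil
    then show ?case using diag by simp
  next
    case (Cons b zs)
    let ?m = "n - length zs"
    have m: "?m > 0" using Cons by simp
    have b: "b \<in> N'" using Cons by simp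
    have "(\<lambda>t. \<phi> (replicate ?m (\<lambda>\<xi>. y \<xi> + t * b \<xi>) @ zs)) = (\<lambda>t. 0)"
    proof
      fix t
      have "(\<lambda>\<xi>. y \<xi> + t * b \<xi>) \<in> N'" using N'_comb[of y b 1 t] Cons by simp
      then show "\<phi> (replicate ?m (\<lambda>\<xi>. y \<xi> + t * b \<xi>) @ zs) = 0" using Cons by simp
    qed
    then have "((\<lambda>t::real. 0) has_vector_derivative of_nat ?m * \<phi> (replicate (?m - 1) y @ b # zs)) (at 0)"
      using sf_diagonal_derivative[OF s Cons.prems(3) b, of ?m zs] by simp
    then have "of_nat ?m * \<phi> (replicate (?m - 1) y @ b # zs) = 0"
      using vector_derivative_unique_at has_vector_derivative_const by blast
    then show ?case using m by simp
  qed
  show ?thesis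
  proof (cases "length xs = n \<and> set xs \<subseteq> N'")
    case True
    then show ?thesis using *[of xs "\<lambda>_. 0"] by simp
  next
    case False
    then show ?thesis by (rule sf_out[OF s])
  qed
qed

lemma sf_eq_if_diagonal_eq:
  assumes "symmetric_form n \<phi>" "symmetric_form n \<psi>"
    and "\<And>x. x \<in> N' \<Longrightarrow> \<phi> (replicate n x) = \<psi> (replicate n x)"
  shows "\<phi> = \<psi>"
proof
  fix xs
  show "\<phi> xs = \<psi> xs"
    using sf_zero_if_diagonal_zero[OF sf_comb[OF assms(1,2), of 1 "-1"], of xs] assms(3) by simp
qed

lemma sf_replicate_scale:
  assumes s: "symmetric_form n \<phi>" and x: "x \<in> N'"
  shows "\<phi> (replicate m (\<lambda>\<xi>. c * x \<xi>) @ zs) = complex_of_real c ^ m * \<phi> (replicate m x @ zs)"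
proof (induction m arbitrary: zs)
  case (Suc m)
  have mv: "\<phi> (y # replicate m z @ zs) = \<phi> (replicate m z @ y # zs)" for y z
    by (intro sf_perm[OF s]) simp
  show ?case using Suc[of "x # zs"] by (simp add: sf_scale[OF s x] mv)
qed simp

lemma sf_replicate_sum:
  assumes s: "symmetric_form n \<phi>" and A: "finite A" "\<And>a. a \<in> A \<Longrightarrow> v a \<in> N'"
  shows "\<phi> (replicate m (\<lambda>\<xi>. \<Sum>a\<in>A. c a * v a \<xi>) @ zs) =
    (\<Sum>as\<in>tuples A m. complex_of_real (prod_list (map c as)) * \<phi> (map v as @ zs))"
proof (induction m arbitrary: zs)
  case (Suc m)
  let ?y = "\<lambda>\<xi>. \<Sum>a\<in>A. c a * v a \<xi>"
  have mv: "\<phi> (y # ys @ zs) = \<phi> (ys @ y # zs)" for y ys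
    by (intro sf_perm[OF s]) simp
  have "\<phi> (replicate (Suc m) ?y @ zs) = (\<Sum>a\<in>A. complex_of_real (c a) * \<phi> (replicate m ?y @ v a # zs))"
    using sf_sum[OF s A, where c = c and xs = "replicate m ?y @ zs"] by (simp add: mv)
  also have "\<dots> = (\<Sum>a\<in>A. \<Sum>as\<in>tuples A m. complex_of_real (prod_list (map c (a # as))) * \<phi> (map v (a # as) @ zs))"
    unfolding Suc by (simp add: sum_distrib_left mv mult_ac)
  finally show ?case unfolding sum_tuples_Suc .
qed simp

section \<open>Hilbert-Schmidt norms\<close>

definition hsum :: "nat \<Rightarrow> nat \<Rightarrow> (('h \<Rightarrow> real) list \<Rightarrow> complex) \<Rightarrow> 'h set \<Rightarrow> real" where
  "hsum p n \<phi> B = (\<Sum>es\<in>tuples B n. (cmod (\<phi> (map (riesz p) es)))\<^sup>2)"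

lemma hs_sums_eq: "hs_sums p n \<phi> = {hsum p n \<phi> B |B. finite B \<and> H.on p B}"
  unfolding hs_sums_def hsum_def orthonormal_eq ..

lemma on_empty [simp]: "H.on p {}"
  by (simp add: H.on_def)

lemma hsum_nonneg: "0 \<le> hsum p n \<phi> B"
  unfolding hsum_def by (simp add: sum_nonneg)

lemma hs_sums_ne: "hs_sums p n \<phi> \<noteq> {}"
  unfolding hs_sums_eq using on_empty by blast

lemma tnorm_sq: "bdd_above (hs_sums p n \<phi>) \<Longrightarrow> (tnorm p n \<phi>)\<^sup>2 = Sup (hs_sums p n \<phi>)"
proof -
  assume b: "bdd_above (hs_sums p n \<phi>)"
  have "hsum p n \<phi> {} \<le> Sup (hs_sums p n \<phi>)"
    using b by (intro cSup_upper) (auto simp: hs_sums_eq)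
  then have "0 \<le> Sup (hs_sums p n \<phi>)" using hsum_nonneg[of p n \<phi> "{}"] by linarith
  then show ?thesis unfolding tnorm_def by simp
qed

lemma hsum_le_tnorm:
  "bdd_above (hs_sums p n \<phi>) \<Longrightarrow> finite B \<Longrightarrow> H.on p B \<Longrightarrow> hsum p n \<phi> B \<le> (tnorm p n \<phi>)\<^sup>2"
  unfolding tnorm_sq by (intro cSup_upper) (auto simp: hs_sums_eq)

lemma tnorm_nonneg: "bdd_above (hs_sums p n \<phi>) \<Longrightarrow> 0 \<le> tnorm p n \<phi>"
  using tnorm_sq[of p n \<phi>] unfolding tnorm_def
  by (metis real_sqrt_ge_0_iff zero_le_power2)

lemma hs_boundedI:
  assumes "\<And>B. finite B \<Longrightarrow> H.on p B \<Longrightarrow> hsum p n \<phi> B \<le> T"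
  shows "bdd_above (hs_sums p n \<phi>)" "(tnorm p n \<phi>)\<^sup>2 \<le> T"
proof -
  show b: "bdd_above (hs_sums p n \<phi>)"
    unfolding hs_sums_eq using assms by (intro bdd_aboveI[of _ T]) auto
  show "(tnorm p n \<phi>)\<^sup>2 \<le> T"
    unfolding tnorm_sq[OF b] using assms hs_sums_ne by (intro cSup_least) (auto simp: hs_sums_eq)
qed

text \<open>B is enlarged to an orthonormal C whose span contains f. Expanding f in C,
  Cauchy-Schwarz and Bessel bound the slice by the sum over tuples of C with one more entry.\<close>

lemma hsum_slice_le:
  assumes s: "symmetric_form (Suc n) \<phi>" and bd: "bdd_above (hs_sums r (Suc n) \<phi>)"
    and f: "f \<in> Hs r" and B: "finite B" "H.on r B"
  shows "hsum r n (\<lambda>ys. \<phi> (riesz r f # ys)) B \<le> (nrm r f)\<^sup>2 * (tnorm r (Suc n) \<phi>)\<^sup>2"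
proof -
  obtain C where C: "H.on r C" "finite C" "B \<subseteq> C" "H.prj r C f = f"
    using H.gram_schmidt_step[OF B(2,1) f] B by (metis finite_insert subset_insertI order_refl)
  have CS: "e \<in> Hs r" if "e \<in> C" for e using C that by (auto simp: H.on_def)
  have rf: "riesz r f = (\<lambda>\<xi>. \<Sum>e\<in>C. ip r e f * riesz r e \<xi>)"
    using riesz_sum[of C r "\<lambda>e. ip r e f"] CS C(4) unfolding H.prj_def by simp
  have "(cmod (\<phi> (riesz r f # ys)))\<^sup>2 \<le> (nrm r f)\<^sup>2 * (\<Sum>e\<in>C. (cmod (\<phi> (riesz r e # ys)))\<^sup>2)" for ys
  proof -
    have "\<phi> (riesz r f # ys) = (\<Sum>e\<in>C. complex_of_real (ip r e f) * \<phi> (riesz r e # ys))"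
      unfolding rf using sf_sum[OF s C(2), of "riesz r" "\<lambda>e. ip r e f" ys] CS by simp
    then have "(cmod (\<phi> (riesz r f # ys)))\<^sup>2 \<le> (\<Sum>e\<in>C. (cmod (complex_of_real (ip r e f)))\<^sup>2) * (\<Sum>e\<in>C. (cmod (\<phi> (riesz r e # ys)))\<^sup>2)"
      by (simp only: cauchy_schwarz_cmod_sum)
    also have "\<dots> \<le> (nrm r f)\<^sup>2 * (\<Sum>e\<in>C. (cmod (\<phi> (riesz r e # ys)))\<^sup>2)"
      using H.bessel[OF C(1,2) f] f by (intro mult_right_mono) (auto simp: nrm_sq sum_nonneg)
    finally show ?thesis .
  qed
  then have "hsum r n (\<lambda>ys. \<phi> (riesz r f # ys)) B \<le>
      (\<Sum>es\<in>tuples B n. (nrm r f)\<^sup>2 * (\<Sum>e\<in>C. (cmod (\<phi> (riesz r e # map (riesz r) es)))\<^sup>2))"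
    unfolding hsum_def by (intro sum_mono)
  also have "\<dots> \<le> (\<Sum>es\<in>tuples C n. (nrm r f)\<^sup>2 * (\<Sum>e\<in>C. (cmod (\<phi> (riesz r e # map (riesz r) es)))\<^sup>2))"
    using C B by (intro sum_mono2) (auto intro!: mult_nonneg_nonneg sum_nonneg)
  also have "\<dots> = (nrm r f)\<^sup>2 * hsum r (Suc n) \<phi> C"
    unfolding hsum_def sum_tuples_Suc sum_distrib_left[symmetric]
    by (subst sum.swap) simp
  also have "\<dots> \<le> (nrm r f)\<^sup>2 * (tnorm r (Suc n) \<phi>)\<^sup>2"
    using hsum_le_tnorm[OF bd C(2,1)] by (intro mult_left_mono) auto
  finally show ?thesis .
qed

lemma hs_slice_bounded:
  assumes s: "symmetric_form (Suc n) \<phi>" and bd: "bdd_above (hs_sums r (Suc n) \<phi>)"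
    and x: "x \<in> Hneg r"
  shows "bdd_above (hs_sums r n (\<lambda>ys. \<phi> (x # ys)))"
proof -
  obtain f where f: "f \<in> Hs r" "riesz r f = x" using riesz_representation[OF x] by blast
  show ?thesis using hsum_slice_le[OF s bd f(1)] unfolding f(2) by (rule hs_boundedI(1))
qed

lemma hs_slices_bounded:
  assumes "symmetric_form (length xs + n) \<phi>" "bdd_above (hs_sums r (length xs + n) \<phi>)" "set xs \<subseteq> Hneg r"
  shows "bdd_above (hs_sums r n (\<lambda>ys. \<phi> (xs @ ys)))"
  using assms
proof (induction xs arbitrary: \<phi>)
  case (Cons x xs)
  have x: "x \<in> Hneg r" "x \<in> N'" using Cons.prems subsetD[OF Hneg_N'[of r]] by auto
  show ?case
    using Cons.IH[of "\<lambda>ys. \<phi> (x # ys)"] Cons.prems x sf_slice[of "length xs + n" \<phi> x]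
      hs_slice_bounded[of "length xs + n" \<phi> r x] by simp
qed simp

text \<open>Fixing all arguments but one leaves a form of order one, whose Hilbert-Schmidt norm
  serves as C; \<open>hsum_slice_le\<close> leading to order 0, with the empty system, is exactly
  the estimate.\<close>

lemma sf_continuous:
  assumes s: "symmetric_form (Suc (length w)) \<phi>" and bd: "bdd_above (hs_sums r (Suc (length w)) \<phi>)"
    and w: "set w \<subseteq> Hneg r"
  obtains C where "C \<ge> 0" "\<And>f. f \<in> Hs r \<Longrightarrow> cmod (\<phi> (riesz r f # w)) \<le> C * nrm r f"
proof -
  have wN: "set w \<subseteq> N'" using w Hneg_N' by blast
  define \<psi> where "\<psi> = (\<lambda>ys. \<phi> (w @ ys))"
  have s1: "symmetric_form (Suc 0) \<psi>" unfolding \<psi>_def using sf_slices[of w "Suc 0" \<phi>] s wN by simp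
  have b1: "bdd_above (hs_sums r (Suc 0) \<psi>)" unfolding \<psi>_def using hs_slices_bounded[of w "Suc 0" \<phi> r] s bd w by simp
  show ?thesis
  proof (rule that)
    show "0 \<le> tnorm r (Suc 0) \<psi>" using tnorm_nonneg[OF b1] .
    fix f assume f: "f \<in> Hs r"
    have "hsum r 0 (\<lambda>ys. \<psi> (riesz r f # ys)) {} \<le> (nrm r f)\<^sup>2 * (tnorm r (Suc 0) \<psi>)\<^sup>2"
      by (rule hsum_slice_le[OF s1 b1 f]) auto
    then have "(cmod (\<psi> [riesz r f]))\<^sup>2 \<le> (tnorm r (Suc 0) \<psi> * nrm r f)\<^sup>2"
      by (simp add: hsum_def power_mult_distrib mult.commute)
    moreover have "\<psi> [riesz r f] = \<phi> (riesz r f # w)"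
      unfolding \<psi>_def by (intro sf_perm[OF s]) simp
    ultimately show "cmod (\<phi> (riesz r f # w)) \<le> tnorm r (Suc 0) \<psi> * nrm r f"
      using tnorm_nonneg[OF b1] f by (auto intro!: power2_le_imp_le mult_nonneg_nonneg)
  qed
qed

text \<open>The functional x is the limit of its truncated Riesz expansions and the form is
  continuous in one slot. Values at arbitrary functionals are thus recovered from the basis
  functionals.\<close>

lemma sf_expansion_limit:
  assumes s: "symmetric_form (Suc (length w)) \<phi>" and bd: "bdd_above (hs_sums r (Suc (length w)) \<phi>)"
    and w: "set w \<subseteq> Hneg r" and x: "x \<in> Hneg r"
  shows "(\<lambda>k. \<Sum>e\<in>bas r k. complex_of_real (x e) * \<phi> (riesz r e # w)) \<longlonglongrightarrow> \<phi> (x # w)"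
proof -
  obtain C where C: "C \<ge> 0" "\<And>f. f \<in> Hs r \<Longrightarrow> cmod (\<phi> (riesz r f # w)) \<le> C * nrm r f"
    using sf_continuous[OF s bd w] by blast
  obtain f where f: "f \<in> Hs r" "riesz r f = x" "(\<lambda>k. nrm r ((\<Sum>e\<in>bas r k. x e *\<^sub>R e) - f)) \<longlonglongrightarrow> 0"
    using riesz_representation[OF x] by blast
  let ?s = "\<lambda>k. \<Sum>e\<in>bas r k. x e *\<^sub>R e"
  have sS: "?s k \<in> Hs r" for k by simp
  have sk: "\<phi> (riesz r (?s k) # w) = (\<Sum>e\<in>bas r k. complex_of_real (x e) * \<phi> (riesz r e # w))" for k
    by (subst riesz_sum) (simp_all add: sf_sum[OF s])
  have d: "\<phi> (riesz r (?s k - f) # w) = \<phi> (riesz r (?s k) # w) - \<phi> (x # w)" for k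
    using riesz_comb[OF sS f(1), where c = 1 and d = "-1"] sf_lin[OF s, of "riesz r (?s k)" "riesz r f" 1 "-1" w] sS[of k] f(1,2)
      riesz_N'[OF f(1)] by simp
  have "(\<lambda>k. \<phi> (riesz r (?s k) # w) - \<phi> (x # w)) \<longlonglongrightarrow> 0"
  proof (rule Lim_null_comparison)
    show "\<forall>\<^sub>F k in sequentially. norm (\<phi> (riesz r (?s k) # w) - \<phi> (x # w)) \<le> C * nrm r (?s k - f)"
      unfolding d[symmetric] using C(2) sS f(1) by (intro always_eventually allI C(2)) simp
    show "(\<lambda>k. C * nrm r (?s k - f)) \<longlonglongrightarrow> 0" using tendsto_mult_right_zero[OF f(3)] by blast
  qed
  then show ?thesis unfolding sk by (simp add: LIM_zero_iff)
qed

text \<open>Orthonormal systems for a weaker norm and single functionals of dual norm at most one are both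
  sub-orthonormal. One estimate thus gives monotonicity of \<open>tnorm\<close>, its independence of the basis,
  and the continuity of evaluations.\<close>

definition sub_orthonormal :: "nat \<Rightarrow> 'i set \<Rightarrow> ('i \<Rightarrow> 'h \<Rightarrow> real) \<Rightarrow> bool" where
  "sub_orthonormal r B v \<longleftrightarrow> finite B \<and> (\<forall>b\<in>B. v b \<in> Hneg r) \<and>
     (\<forall>\<xi>\<in>N. (\<Sum>b\<in>B. (v b \<xi>)\<^sup>2) \<le> (nrm r \<xi>)\<^sup>2)"

text \<open>One slot is treated. For a truncated expansion of \<open>v b\<close>, the value is
  \<open>v b\<close> applied to the vector with coefficients \<open>z e\<close>, so
  sub-orthonormality bounds the sum over b by the squared norm of that vector, which is the sum over
  the basis. Real and imaginary parts are separated because \<open>v b\<close> is a real functional.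
  Then k tends to infinity.\<close>

lemma sub_orthonormal_step:
  assumes s: "symmetric_form (Suc n) \<phi>" and bd: "bdd_above (hs_sums r (Suc n) \<phi>)"
    and v: "sub_orthonormal r B v" and W: "finite W" "\<And>j. j \<in> W \<Longrightarrow> set (w j) \<subseteq> Hneg r \<and> length (w j) = n"
    and T: "\<And>k. (\<Sum>j\<in>W. \<Sum>e\<in>bas r k. (cmod (\<phi> (riesz r e # w j)))\<^sup>2) \<le> T"
  shows "(\<Sum>j\<in>W. \<Sum>b\<in>B. (cmod (\<phi> (v b # w j)))\<^sup>2) \<le> T"
proof -
  let ?h = "\<lambda>k j b. \<Sum>e\<in>bas r k. complex_of_real (v b e) * \<phi> (riesz r e # w j)"
  have vb: "v b \<in> Hneg r" "v b \<in> N'" if "b \<in> B" for b using v that Hneg_N' by (auto simp: sub_orthonormal_def)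
  have "(\<lambda>k. \<Sum>j\<in>W. \<Sum>b\<in>B. (cmod (?h k j b))\<^sup>2) \<longlonglongrightarrow> (\<Sum>j\<in>W. \<Sum>b\<in>B. (cmod (\<phi> (v b # w j)))\<^sup>2)"
    using W(2) vb s bd
    by (intro tendsto_sum tendsto_power tendsto_norm sf_expansion_limit) auto
  moreover have "(\<Sum>j\<in>W. \<Sum>b\<in>B. (cmod (?h k j b))\<^sup>2) \<le> T" for k
  proof -
    have "(\<Sum>b\<in>B. (cmod (?h k j b))\<^sup>2) \<le> (\<Sum>e\<in>bas r k. (cmod (\<phi> (riesz r e # w j)))\<^sup>2)" for j
    proof -
      define z where "z e = \<phi> (riesz r e # w j)" for e
      define \<xi> where "\<xi> = (\<Sum>e\<in>bas r k. Re (z e) *\<^sub>R e)"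
      define \<eta> where "\<eta> = (\<Sum>e\<in>bas r k. Im (z e) *\<^sub>R e)"
      have N: "\<xi> \<in> N" "\<eta> \<in> N" by (simp_all add: \<xi>_def \<eta>_def)
      have "(cmod (?h k j b))\<^sup>2 = (v b \<xi>)\<^sup>2 + (v b \<eta>)\<^sup>2" if "b \<in> B" for b
        unfolding cmod_power2 \<xi>_def \<eta>_def z_def using vb[OF that]
        by (simp add: N'_at_sum N'_at_scale mult.commute)
      then have "(\<Sum>b\<in>B. (cmod (?h k j b))\<^sup>2) = (\<Sum>b\<in>B. (v b \<xi>)\<^sup>2) + (\<Sum>b\<in>B. (v b \<eta>)\<^sup>2)"
        by (simp add: sum.distrib)
      also have "\<dots> \<le> (nrm r \<xi>)\<^sup>2 + (nrm r \<eta>)\<^sup>2"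
        using v N by (intro add_mono) (auto simp: sub_orthonormal_def)
      also have "\<dots> = (\<Sum>e\<in>bas r k. (Re (z e))\<^sup>2) + (\<Sum>e\<in>bas r k. (Im (z e))\<^sup>2)"
        using N by (simp add: nrm_sq) (simp add: \<xi>_def \<eta>_def H.on_norm[OF bas_on bas_finite])
      also have "\<dots> = (\<Sum>e\<in>bas r k. (cmod (z e))\<^sup>2)" by (simp add: cmod_power2 sum.distrib)
      finally show ?thesis by (simp add: z_def)
    qed
    then have "(\<Sum>j\<in>W. \<Sum>b\<in>B. (cmod (?h k j b))\<^sup>2) \<le> (\<Sum>j\<in>W. \<Sum>e\<in>bas r k. (cmod (\<phi> (riesz r e # w j)))\<^sup>2)"
      by (intro sum_mono)
    then show ?thesis using T[of k] by linarith
  qed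
  ultimately show ?thesis by (intro LIMSEQ_le_const2) auto
qed

text \<open>The basis functionals are replaced by \<open>v\<close> slot by slot. The truncation M of
  the remaining slots stays arbitrary in the induction, because the slot to be replaced is summed
  over \<open>bas r K\<close> and both sets are embedded into the common
  \<open>bas r (max K M)\<close>.\<close>

lemma sub_orthonormal_mixed:
  assumes s: "symmetric_form n \<phi>" and bd: "bdd_above (hs_sums r n \<phi>)"
    and v: "sub_orthonormal r B v"
    and T: "\<And>k. hsum r n \<phi> (bas r k) \<le> T"
    and "k + m = n"
  shows "(\<Sum>bs\<in>tuples B k. \<Sum>es\<in>tuples (bas r M) m. (cmod (\<phi> (map v bs @ map (riesz r) es)))\<^sup>2) \<le> T"
  using \<open>k + m = n\<close>
proof (induction k arbitrary: m M)
  case 0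
  then show ?case using T[of M] by (simp add: hsum_def)
next
  case (Suc k)
  define W where "W = tuples B k \<times> tuples (bas r M) m"
  define w where "w = (\<lambda>(bs, es). map v bs @ map (riesz r) es)"
  have fB: "finite B" using v by (simp add: sub_orthonormal_def)
  have nk: "n = Suc (k + m)" using Suc.prems by simp
  have Ww: "finite W" "\<And>j. j \<in> W \<Longrightarrow> set (w j) \<subseteq> Hneg r \<and> length (w j) = k + m"
  proof -
    show "finite W" using fB by (simp add: W_def)
    fix j assume "j \<in> W"
    then obtain bs es where j: "j = (bs, es)" "set bs \<subseteq> B" "length bs = k" "set es \<subseteq> bas r M" "length es = m"
      by (auto simp: W_def)
    then have "v b \<in> Hneg r" if "b \<in> set bs" for b using v that by (auto simp: sub_orthonormal_def)
    moreover have "e \<in> Hs r" if "e \<in> set es" for e using j that by (meson N_Hs bas_in_N subsetD)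
    ultimately show "set (w j) \<subseteq> Hneg r \<and> length (w j) = k + m" using j by (auto simp: w_def)
  qed
  have WT: "(\<Sum>j\<in>W. \<Sum>e\<in>bas r K. (cmod (\<phi> (riesz r e # w j)))\<^sup>2) \<le> T" for K
  proof -
    let ?L = "max K M"
    have "(\<Sum>j\<in>W. \<Sum>e\<in>bas r K. (cmod (\<phi> (riesz r e # w j)))\<^sup>2) \<le>
        (\<Sum>bs\<in>tuples B k. \<Sum>es\<in>tuples (bas r ?L) m. \<Sum>e\<in>bas r ?L. (cmod (\<phi> (map v bs @ map (riesz r) (e # es))))\<^sup>2)"
    proof -
      have "(\<Sum>e\<in>bas r K. (cmod (\<phi> (riesz r e # w (bs, es))))\<^sup>2) \<le>
          (\<Sum>e\<in>bas r ?L. (cmod (\<phi> (map v bs @ map (riesz r) (e # es))))\<^sup>2)" for bs es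
      proof -
        have "\<phi> (riesz r e # w (bs, es)) = \<phi> (map v bs @ map (riesz r) (e # es))" for e
          by (intro sf_perm[OF s]) (simp add: w_def)
        then show ?thesis using bas_mono[of K ?L r] by (simp only:) (intro sum_mono2, auto)
      qed
      then have "(\<Sum>j\<in>W. \<Sum>e\<in>bas r K. (cmod (\<phi> (riesz r e # w j)))\<^sup>2) \<le>
          (\<Sum>bs\<in>tuples B k. \<Sum>es\<in>tuples (bas r M) m. \<Sum>e\<in>bas r ?L. (cmod (\<phi> (map v bs @ map (riesz r) (e # es))))\<^sup>2)"
        unfolding W_def sum.cartesian_product' by (intro sum_mono) 
      also have "\<dots> \<le> (\<Sum>bs\<in>tuples B k. \<Sum>es\<in>tuples (bas r ?L) m. \<Sum>e\<in>bas r ?L. (cmod (\<phi> (map v bs @ map (riesz r) (e # es))))\<^sup>2)"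
        using bas_mono[of M ?L r] by (intro sum_mono sum_mono2) (auto intro!: sum_nonneg)
      finally show ?thesis .
    qed
    also have "\<dots> = (\<Sum>bs\<in>tuples B k. \<Sum>es\<in>tuples (bas r ?L) (Suc m). (cmod (\<phi> (map v bs @ map (riesz r) es)))\<^sup>2)"
      unfolding sum_tuples_Suc by (intro sum.cong refl sum.swap)
    also have "\<dots> \<le> T" using Suc.IH[of "Suc m" ?L] Suc.prems by simp
    finally show ?thesis .
  qed
  have "(\<Sum>j\<in>W. \<Sum>b\<in>B. (cmod (\<phi> (v b # w j)))\<^sup>2) \<le> T"
    by (rule sub_orthonormal_step[where w = w, OF s[unfolded nk] bd[unfolded nk] v Ww WT])
  also have "(\<Sum>j\<in>W. \<Sum>b\<in>B. (cmod (\<phi> (v b # w j)))\<^sup>2) =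
      (\<Sum>bs\<in>tuples B k. \<Sum>b\<in>B. \<Sum>es\<in>tuples (bas r M) m. (cmod (\<phi> (map v (b # bs) @ map (riesz r) es)))\<^sup>2)"
    unfolding W_def w_def sum.cartesian_product' by (simp) (intro sum.cong refl sum.swap)
  also have "\<dots> = (\<Sum>bs\<in>tuples B (Suc k). \<Sum>es\<in>tuples (bas r M) m. (cmod (\<phi> (map v bs @ map (riesz r) es)))\<^sup>2)"
    unfolding sum_tuples_Suc by (rule sum.swap)
  finally show ?case .
qed

lemma sub_orthonormal_bound:
  assumes "symmetric_form n \<phi>" "bdd_above (hs_sums r n \<phi>)" "sub_orthonormal r B v"
    and "\<And>k. hsum r n \<phi> (bas r k) \<le> T"
  shows "(\<Sum>bs\<in>tuples B n. (cmod (\<phi> (map v bs)))\<^sup>2) \<le> T"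
  using sub_orthonormal_mixed[OF assms, of n 0 0] by simp

text \<open>Bessel in the weaker space, followed by monotonicity of the norms.\<close>

lemma sub_orthonormal_riesz:
  assumes "p \<le> r" "finite B" "H.on p B"
  shows "sub_orthonormal r B (riesz p)"
proof -
  have BS: "e \<in> Hs p" if "e \<in> B" for e using assms that by (auto simp: H.on_def)
  have "(\<Sum>b\<in>B. (riesz p b \<xi>)\<^sup>2) \<le> (nrm r \<xi>)\<^sup>2" if "\<xi> \<in> N" for \<xi>
  proof -
    have "(\<Sum>b\<in>B. (riesz p b \<xi>)\<^sup>2) \<le> (nrm p \<xi>)\<^sup>2"
      using H.bessel[OF assms(3,2), of \<xi>] that by (simp add: riesz_def nrm_sq)
    also have "\<dots> \<le> (nrm r \<xi>)\<^sup>2" using nrm_le[OF assms(1), of \<xi>] that by (intro power_mono) auto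
    finally show ?thesis .
  qed
  then show ?thesis unfolding sub_orthonormal_def using assms BS riesz_Hneg Hneg_mono[OF assms(1)] by blast
qed

lemma hsum_bas_le_tnorm: "bdd_above (hs_sums r n \<phi>) \<Longrightarrow> hsum r n \<phi> (bas r k) \<le> (tnorm r n \<phi>)\<^sup>2"
  by (intro hsum_le_tnorm bas_on bas_finite)

lemma hs_bounded_mono:
  assumes "symmetric_form n \<phi>" "bdd_above (hs_sums r n \<phi>)" "p \<le> r"
  shows "bdd_above (hs_sums p n \<phi>)" "tnorm p n \<phi> \<le> tnorm r n \<phi>"
proof -
  have *: "hsum p n \<phi> B \<le> (tnorm r n \<phi>)\<^sup>2" if "finite B" "H.on p B" for B
    unfolding hsum_def
    using sub_orthonormal_bound[OF assms(1,2) sub_orthonormal_riesz[OF assms(3) that] hsum_bas_le_tnorm[OF assms(2)]] .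
  show "bdd_above (hs_sums p n \<phi>)" using * by (rule hs_boundedI(1))
  show "tnorm p n \<phi> \<le> tnorm r n \<phi>"
    using hs_boundedI(2)[OF *] tnorm_nonneg[OF assms(2)] by (rule power2_le_imp_le)
qed

lemma hsum_bas_incseq: "incseq (\<lambda>k. hsum r n \<phi> (bas r k))"
  unfolding hsum_def by (intro incseq_SucI sum_mono2) (use bas_mono[of k "Suc k" r for k] in auto)

text \<open>Orthonormal systems of \<open>Hs r\<close> may leave the closure of N, but a form sees
  them only as functionals on N. There they are sub-orthonormal, so no system exceeds the limit
  along \<open>bas r\<close>.\<close>

lemma hsum_bas_limit:
  assumes "symmetric_form n \<phi>" "bdd_above (hs_sums r n \<phi>)"
  shows "(\<lambda>k. hsum r n \<phi> (bas r k)) \<longlonglongrightarrow> (tnorm r n \<phi>)\<^sup>2"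
proof -
  obtain L where L: "(\<lambda>k. hsum r n \<phi> (bas r k)) \<longlonglongrightarrow> L" "\<And>k. hsum r n \<phi> (bas r k) \<le> L"
    using incseq_convergent[OF hsum_bas_incseq, of r n \<phi> "(tnorm r n \<phi>)\<^sup>2"] hsum_bas_le_tnorm[OF assms(2)] by metis
  have "L \<le> (tnorm r n \<phi>)\<^sup>2"
    using L(1) hsum_bas_le_tnorm[OF assms(2)] by (intro LIMSEQ_le_const2) auto
  moreover have "(tnorm r n \<phi>)\<^sup>2 \<le> L"
    using sub_orthonormal_bound[OF assms sub_orthonormal_riesz[OF order_refl] L(2)]
    by (intro hs_boundedI(2)) (simp add: hsum_def)
  ultimately show ?thesis using L(1) by simp
qed

lemma tnorm_sq_le_if_bas:
  assumes "symmetric_form n \<phi>" "bdd_above (hs_sums r n \<phi>)" "\<And>k. hsum r n \<phi> (bas r k) \<le> T"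
  shows "(tnorm r n \<phi>)\<^sup>2 \<le> T"
  using LIMSEQ_le_const2[OF hsum_bas_limit[OF assms(1,2)]] assms(3) by blast

end

section \<open>Finite differences\<close>

fun finite_difference :: "'a::comm_ring_1 list \<Rightarrow> ('a \<Rightarrow> 'a) \<Rightarrow> 'a \<Rightarrow> 'a" where
  "finite_difference [] f t = f t"
| "finite_difference (a # as) f t = finite_difference as f (t + a) - finite_difference as f t"

lemma finite_difference_sum:
  "finite_difference as (\<lambda>t. \<Sum>k\<in>A. c k * f k t) t = (\<Sum>k\<in>A. c k * finite_difference as (f k) t)"
  by (induction as arbitrary: t) (simp_all add: sum_subtractf algebra_simps)

lemma finite_difference_shift:
  "finite_difference as (\<lambda>t. f (t + a)) t = finite_difference as f (t + a)"
  by (induction as arbitrary: t) (simp_all add: algebra_simps)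

lemma finite_difference_diff:
  "finite_difference as (\<lambda>t. f t - g t) t = finite_difference as f t - finite_difference as g t"
  by (induction as arbitrary: t) (simp_all add: algebra_simps)

text \<open>A difference with step a turns t^n into a polynomial of degree n - 1 with leading
  coefficient n a; after n differences only the constant n! times the product of the steps is
  left.\<close>

lemma finite_difference_power:
  fixes t :: "'a::comm_ring_1"
  shows "(n < length as \<longrightarrow> finite_difference as (\<lambda>t. t ^ n) t = 0) \<and>
    (n = length as \<longrightarrow> finite_difference as (\<lambda>t. t ^ n) t = of_nat (fact n) * prod_list as)"
proof (induction as arbitrary: n t)
  case (Cons a as)
  have "finite_difference (a # as) (\<lambda>t. t ^ n) t = finite_difference as (\<lambda>t. (t + a) ^ n - t ^ n) t"
    unfolding finite_difference_diff finite_difference_shift[of as "\<lambda>t. t ^ n"] by simp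
  also have "(\<lambda>t. (t + a) ^ n - t ^ n) = (\<lambda>t. \<Sum>k<n. (of_nat (n choose k) * a ^ (n - k)) * t ^ k)"
  proof
    fix t :: 'a
    show "(t + a) ^ n - t ^ n = (\<Sum>k<n. (of_nat (n choose k) * a ^ (n - k)) * t ^ k)"
      unfolding binomial_ring lessThan_Suc_atMost[symmetric] by (simp add: mult_ac)
  qed
  finally have eq: "finite_difference (a # as) (\<lambda>t. t ^ n) t =
      (\<Sum>k<n. (of_nat (n choose k) * a ^ (n - k)) * finite_difference as (\<lambda>t. t ^ k) t)"
    unfolding finite_difference_sum .
  show ?case
  proof (intro conjI impI)
    assume "n < length (a # as)"
    then show "finite_difference (a # as) (\<lambda>t. t ^ n) t = 0"
      unfolding eq using Cons by (intro sum.neutral) auto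
  next
    assume n: "n = length (a # as)"
    define m where "m = length as"
    have nm: "n = Suc m" using n by (simp add: m_def)
    have "(\<Sum>k<m. (of_nat (n choose k) * a ^ (n - k)) * finite_difference as (\<lambda>t. t ^ k) t) = 0"
      using Cons by (intro sum.neutral) (auto simp: m_def)
    moreover have "finite_difference as (\<lambda>t. t ^ m) t = of_nat (fact m) * prod_list as"
      using Cons by (simp add: m_def)
    ultimately show "finite_difference (a # as) (\<lambda>t. t ^ n) t = of_nat (fact n) * prod_list (a # as)"
      unfolding eq unfolding nm by (simp add: algebra_simps)
  qed
qed simp

context nuclear_triple
begin

section \<open>Symmetric tensor powers and their duals\<close>

lemma tens_sf: "\<phi> \<in> tens n \<Longrightarrow> symmetric_form n \<phi>"
  and tens_bdd: "\<phi> \<in> tens n \<Longrightarrow> bdd_above (hs_sums p n \<phi>)"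
  by (auto simp: tens_def)

lemma tens_tnorm_nonneg [simp]: "\<phi> \<in> tens n \<Longrightarrow> 0 \<le> tnorm p n \<phi>"
  by (simp add: tens_bdd tnorm_nonneg)

text \<open>Boundedness for arbitrarily large indices suffices by \<open>hs_bounded_mono\<close>.
  Slices and contractions are controlled only from some index on, hence this form.\<close>

lemma tensI:
  assumes "symmetric_form n \<phi>" "\<And>q. \<exists>r\<ge>q. bdd_above (hs_sums r n \<phi>)"
  shows "\<phi> \<in> tens n"
proof -
  have "bdd_above (hs_sums p n \<phi>)" for p
  proof -
    obtain r where "p \<le> r" "bdd_above (hs_sums r n \<phi>)" using assms(2)[of p] by (elim exE conjE)
    then show ?thesis using hs_bounded_mono(1)[OF assms(1), of r p] by (simp only:)
  qed
  then show ?thesis using assms(1) by (simp add: tens_def)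
qed

lemma tens_tnorm_mono: "\<phi> \<in> tens n \<Longrightarrow> p \<le> q \<Longrightarrow> tnorm p n \<phi> \<le> tnorm q n \<phi>"
  by (rule hs_bounded_mono(2)[OF tens_sf tens_bdd])

lemma tens_comb:
  assumes \<phi>: "\<phi> \<in> tens n" and \<psi>: "\<psi> \<in> tens n"
  shows "(\<lambda>xs. c * \<phi> xs + d * \<psi> xs) \<in> tens n"
proof (rule tensI)
  show "symmetric_form n (\<lambda>xs. c * \<phi> xs + d * \<psi> xs)"
    using assms by (intro sf_comb tens_sf)
  fix q
  have "hsum q n (\<lambda>xs. c * \<phi> xs + d * \<psi> xs) B \<le>
      2 * (cmod c)\<^sup>2 * (tnorm q n \<phi>)\<^sup>2 + 2 * (cmod d)\<^sup>2 * (tnorm q n \<psi>)\<^sup>2" if B: "finite B" "H.on q B" for B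
  proof -
    have "(cmod (c * z + d * w))\<^sup>2 \<le> 2 * (cmod c)\<^sup>2 * (cmod z)\<^sup>2 + 2 * (cmod d)\<^sup>2 * (cmod w)\<^sup>2" for z w
    proof -
      have "(cmod (c * z + d * w))\<^sup>2 \<le> (cmod (c * z) + cmod (d * w))\<^sup>2"
        by (intro power_mono norm_triangle_ineq) auto
      also have "\<dots> \<le> 2 * (cmod (c * z))\<^sup>2 + 2 * (cmod (d * w))\<^sup>2"
        using sum_squares_bound[of "cmod (c * z)" "cmod (d * w)"] by (simp add: power2_sum)
      finally show ?thesis by (simp add: norm_mult power_mult_distrib)
    qed
    then have "hsum q n (\<lambda>xs. c * \<phi> xs + d * \<psi> xs) B \<le>
        2 * (cmod c)\<^sup>2 * hsum q n \<phi> B + 2 * (cmod d)\<^sup>2 * hsum q n \<psi> B"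
      unfolding hsum_def sum_distrib_left sum.distrib[symmetric] by (intro sum_mono)
    also have "\<dots> \<le> 2 * (cmod c)\<^sup>2 * (tnorm q n \<phi>)\<^sup>2 + 2 * (cmod d)\<^sup>2 * (tnorm q n \<psi>)\<^sup>2"
      using assms B by (intro add_mono mult_left_mono hsum_le_tnorm tens_bdd) auto
    finally show ?thesis .
  qed
  then have "bdd_above (hs_sums q n (\<lambda>xs. c * \<phi> xs + d * \<psi> xs))"
    by (rule hs_boundedI(1))
  then show "\<exists>r\<ge>q. bdd_above (hs_sums r n (\<lambda>xs. c * \<phi> xs + d * \<psi> xs))" by (intro exI[of _ q] conjI order_refl)
qed

lemma tens_0 [simp]: "(\<lambda>_. 0) \<in> tens n"
proof (rule tensI)
  fix q
  have "bdd_above (hs_sums q n (\<lambda>_. 0))" by (rule hs_boundedI(1)[of _ _ _ 0]) (simp add: hsum_def)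
  then show "\<exists>r\<ge>q. bdd_above (hs_sums r n (\<lambda>_. 0))" by (intro exI[of _ q] conjI order_refl)
qed simp

lemma tens_scale: "\<phi> \<in> tens n \<Longrightarrow> (\<lambda>xs. c * \<phi> xs) \<in> tens n"
  using tens_comb[of \<phi> n \<phi> c 0] by simp

lemma tens_diff: "\<phi> \<in> tens n \<Longrightarrow> \<psi> \<in> tens n \<Longrightarrow> (\<lambda>xs. \<phi> xs - \<psi> xs) \<in> tens n"
  using tens_comb[of \<phi> n \<psi> 1 "-1"] by simp

lemma tens_sum:
  "(\<And>i. i \<in> I \<Longrightarrow> \<phi> i \<in> tens n) \<Longrightarrow> (\<lambda>xs. \<Sum>i\<in>I. c i * \<phi> i xs) \<in> tens n"
proof (induction I rule: infinite_finite_induct)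
  case (insert i I)
  then show ?case using tens_comb[of "\<phi> i" n "\<lambda>xs. \<Sum>i\<in>I. c i * \<phi> i xs" "c i" 1] by simp
qed simp_all

lemma tnorm_scale_le:
  assumes "\<phi> \<in> tens n"
  shows "tnorm p n (\<lambda>xs. c * \<phi> xs) \<le> cmod c * tnorm p n \<phi>"
proof -
  have "hsum p n (\<lambda>xs. c * \<phi> xs) B \<le> (cmod c * tnorm p n \<phi>)\<^sup>2" if "finite B" "H.on p B" for B
  proof -
    have "hsum p n (\<lambda>xs. c * \<phi> xs) B = (cmod c)\<^sup>2 * hsum p n \<phi> B"
      unfolding hsum_def by (simp add: norm_mult power_mult_distrib sum_distrib_left)
    also have "\<dots> \<le> (cmod c)\<^sup>2 * (tnorm p n \<phi>)\<^sup>2"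
      using assms that by (intro mult_left_mono hsum_le_tnorm tens_bdd) auto
    finally show ?thesis by (simp add: power_mult_distrib)
  qed
  then have "(tnorm p n (\<lambda>xs. c * \<phi> xs))\<^sup>2 \<le> (cmod c * tnorm p n \<phi>)\<^sup>2"
    by (rule hs_boundedI(2))
  then show ?thesis using assms by (rule_tac power2_le_imp_le) auto
qed

lemma tens_slices:
  assumes "\<phi> \<in> tens (length xs + n)" "set xs \<subseteq> N'"
  shows "(\<lambda>ys. \<phi> (xs @ ys)) \<in> tens n"
proof (rule tensI)
  show "symmetric_form n (\<lambda>ys. \<phi> (xs @ ys))" using assms by (intro sf_slices tens_sf)
  fix q
  obtain r where "q \<le> r" "set xs \<subseteq> Hneg r" using N'_obtain_Hneg[OF assms(2)] by blast
  then show "\<exists>r\<ge>q. bdd_above (hs_sums r n (\<lambda>ys. \<phi> (xs @ ys)))"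
    using hs_slices_bounded[OF tens_sf[OF assms(1)] tens_bdd[OF assms(1)]] by (intro exI[of _ r] conjI)
qed

section \<open>Powers of elements of the complexified space\<close>

lemma NC_I: "\<xi> \<in> N \<Longrightarrow> \<eta> \<in> N \<Longrightarrow> (\<xi>, \<eta>) \<in> NC"
  by (simp add: NC_def)

lemma nrmC_nonneg [simp]: "0 \<le> nrmC p \<theta>"
  by (simp add: nrmC_def)

lemma nrmC_sq: "(nrmC p \<theta>)\<^sup>2 = (nrm p (fst \<theta>))\<^sup>2 + (nrm p (snd \<theta>))\<^sup>2"
  by (simp add: nrmC_def)

lemma pair_real_comb:
  "pair_real (\<lambda>\<xi>. c * x \<xi> + d * y \<xi>) \<theta> = complex_of_real c * pair_real x \<theta> + complex_of_real d * pair_real y \<theta>"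
  by (simp add: pair_real_def complex_eq_iff)

lemma tpow_sf: "symmetric_form n (tpow \<theta> n)"
  unfolding symmetric_form_def
proof (intro conjI allI ballI impI)
  fix xs ys :: "('h \<Rightarrow> real) list" assume m: "mset xs = mset ys"
  then have "prod_list (map (\<lambda>x. pair_real x \<theta>) xs) = prod_list (map (\<lambda>x. pair_real x \<theta>) ys)"
    by (metis mset_map prod_mset_prod_list)
  then show "tpow \<theta> n xs = tpow \<theta> n ys"
    unfolding tpow_def using mset_eq_length[OF m] mset_eq_setD[OF m] by simp
next
  fix x y c d and xs :: "('h \<Rightarrow> real) list"
  assume "x \<in> N'" "y \<in> N'" "set xs \<subseteq> N' \<and> Suc (length xs) = n"
  then show "tpow \<theta> n ((\<lambda>\<xi>. c * x \<xi> + d * y \<xi>) # xs) =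
      complex_of_real c * tpow \<theta> n (x # xs) + complex_of_real d * tpow \<theta> n (y # xs)"
    by (auto simp: tpow_def N'_comb pair_real_comb algebra_simps)
next
  fix xs :: "('h \<Rightarrow> real) list" assume "\<not> (length xs = n \<and> set xs \<subseteq> N')"
  then show "tpow \<theta> n xs = 0" by (auto simp: tpow_def)
qed

lemma cmod_prod_list_sq: "(cmod (prod_list zs))\<^sup>2 = prod_list (map (\<lambda>z. (cmod z)\<^sup>2) zs)"
  by (induction zs) (simp_all add: norm_mult power_mult_distrib)

text \<open>The sum over tuples factors into the n-th power of a sum over B, which Bessel bounds for
  the real and the imaginary part of \<theta>.\<close>

lemma hsum_tpow_le:
  assumes \<theta>: "\<theta> \<in> NC" and B: "finite B" "H.on p B"
  shows "hsum p n (tpow \<theta> n) B \<le> ((nrmC p \<theta>) ^ n)\<^sup>2"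
proof -
  have \<theta>N: "fst \<theta> \<in> N" "snd \<theta> \<in> N" using \<theta> by (auto simp: NC_def)
  have BS: "e \<in> Hs p" if "e \<in> B" for e using B that by (auto simp: H.on_def)
  have "hsum p n (tpow \<theta> n) B = (\<Sum>es\<in>tuples B n. prod_list (map (\<lambda>e. (cmod (pair_real (riesz p e) \<theta>))\<^sup>2) es))"
    unfolding hsum_def
  proof (intro sum.cong refl)
    fix es assume "es \<in> tuples B n"
    then have "set (map (riesz p) es) \<subseteq> N'" "length es = n" using BS by auto
    then show "(cmod (tpow \<theta> n (map (riesz p) es)))\<^sup>2 = prod_list (map (\<lambda>e. (cmod (pair_real (riesz p e) \<theta>))\<^sup>2) es)"
      by (simp add: tpow_def cmod_prod_list_sq comp_def)
  qed
  also have "\<dots> = (\<Sum>e\<in>B. (cmod (pair_real (riesz p e) \<theta>))\<^sup>2) ^ n"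
    by (rule sum_prod_list_tuples)
  also have "(\<Sum>e\<in>B. (cmod (pair_real (riesz p e) \<theta>))\<^sup>2) = (\<Sum>e\<in>B. (ip p e (fst \<theta>))\<^sup>2) + (\<Sum>e\<in>B. (ip p e (snd \<theta>))\<^sup>2)"
    unfolding cmod_power2 pair_real_def riesz_def using \<theta>N by (simp add: sum.distrib)
  also have "\<dots> ^ n \<le> ((nrmC p \<theta>)\<^sup>2) ^ n"
    using H.bessel[OF B(2,1), of "fst \<theta>"] H.bessel[OF B(2,1), of "snd \<theta>"] \<theta>N
    by (intro power_mono) (auto simp: nrmC_sq nrm_sq sum_nonneg)
  finally show ?thesis by (simp add: power_mult[symmetric] mult.commute)
qed

lemma tpow_tens [simp]: "\<theta> \<in> NC \<Longrightarrow> tpow \<theta> n \<in> tens n"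
proof (rule tensI[OF tpow_sf])
  fix q assume \<theta>: "\<theta> \<in> NC"
  have "bdd_above (hs_sums q n (tpow \<theta> n))" by (rule hs_boundedI(1)[OF hsum_tpow_le[OF \<theta>]])
  then show "\<exists>r\<ge>q. bdd_above (hs_sums r n (tpow \<theta> n))" by (intro exI[of _ q] conjI order_refl)
qed

lemma tnorm_tpow_le: "\<theta> \<in> NC \<Longrightarrow> tnorm p n (tpow \<theta> n) \<le> nrmC p \<theta> ^ n"
proof (rule power2_le_imp_le)
  assume \<theta>: "\<theta> \<in> NC"
  show "(tnorm p n (tpow \<theta> n))\<^sup>2 \<le> (nrmC p \<theta> ^ n)\<^sup>2" by (rule hs_boundedI(2)[OF hsum_tpow_le[OF \<theta>]])
qed simp

section \<open>Dual tensor powers and bounds of functionals\<close>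

lemma tens_negD:
  assumes "L \<in> tens_neg p n"
  shows "\<phi> \<in> tens n \<Longrightarrow> \<psi> \<in> tens n \<Longrightarrow> L (\<lambda>xs. c * \<phi> xs + d * \<psi> xs) = c * L \<phi> + d * L \<psi>"
    and "\<phi> \<notin> tens n \<Longrightarrow> L \<phi> = 0"
  using assms by (auto simp: tens_neg_def)

text \<open>An upper bound for the dual norm, in place of \<open>dnorm\<close> itself: constants can
  then be added, multiplied and enlarged without computing suprema.\<close>

definition bounded_by :: "nat \<Rightarrow> nat \<Rightarrow> ((('h \<Rightarrow> real) list \<Rightarrow> complex) \<Rightarrow> complex) \<Rightarrow> real \<Rightarrow> bool" where
  "bounded_by p n L C \<longleftrightarrow> C \<ge> 0 \<and> (\<forall>\<phi>\<in>tens n. cmod (L \<phi>) \<le> C * tnorm p n \<phi>)"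

lemma bounded_byD: "bounded_by p n L C \<Longrightarrow> \<phi> \<in> tens n \<Longrightarrow> cmod (L \<phi>) \<le> C * tnorm p n \<phi>"
  and bounded_by_nonneg: "bounded_by p n L C \<Longrightarrow> C \<ge> 0"
  by (auto simp: bounded_by_def)

lemma bounded_byI: "C \<ge> 0 \<Longrightarrow> (\<And>\<phi>. \<phi> \<in> tens n \<Longrightarrow> cmod (L \<phi>) \<le> C * tnorm p n \<phi>) \<Longrightarrow> bounded_by p n L C"
  by (auto simp: bounded_by_def)

lemma bounded_by_mono:
  assumes "bounded_by p n L C" "p \<le> q" "C \<le> D"
  shows "bounded_by q n L D"
proof (rule bounded_byI)
  show "D \<ge> 0" using bounded_by_nonneg[OF assms(1)] assms(3) by linarith
  fix \<phi> assume \<phi>: "\<phi> \<in> tens n"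
  have "cmod (L \<phi>) \<le> C * tnorm p n \<phi>" using bounded_byD[OF assms(1) \<phi>] .
  also have "\<dots> \<le> D * tnorm q n \<phi>"
    using tens_tnorm_mono[OF \<phi> assms(2)] \<phi> assms(3) bounded_by_nonneg[OF assms(1)] by (intro mult_mono) auto
  finally show "cmod (L \<phi>) \<le> D * tnorm q n \<phi>" .
qed

lemma tens_neg_bounded:
  assumes "L \<in> tens_neg p n"
  obtains C where "bounded_by p n L C"
proof -
  obtain C where C: "\<And>\<phi>. \<phi> \<in> tens n \<Longrightarrow> cmod (L \<phi>) \<le> C * tnorm p n \<phi>"
    using assms unfolding tens_neg_def by blast
  have "bounded_by p n L \<bar>C\<bar>"
  proof (rule bounded_byI)
    fix \<phi> assume "\<phi> \<in> tens n"
    then show "cmod (L \<phi>) \<le> \<bar>C\<bar> * tnorm p n \<phi>"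
      using C[of \<phi>] mult_right_mono[OF abs_ge_self[of C], of "tnorm p n \<phi>"] by force
  qed simp
  then show ?thesis using that by blast
qed

lemma tens_negI:
  assumes "\<And>\<phi> \<psi> c d. \<phi> \<in> tens n \<Longrightarrow> \<psi> \<in> tens n \<Longrightarrow> L (\<lambda>xs. c * \<phi> xs + d * \<psi> xs) = c * L \<phi> + d * L \<psi>"
    and "bounded_by p n L C" and "\<And>\<phi>. \<phi> \<notin> tens n \<Longrightarrow> L \<phi> = 0"
  shows "L \<in> tens_neg p n"
  using assms unfolding tens_neg_def bounded_by_def by blast

lemma tens_neg_mono: "p \<le> q \<Longrightarrow> tens_neg p n \<subseteq> tens_neg q n"
proof
  fix L assume pq: "p \<le> q" and L: "L \<in> tens_neg p n"
  obtain C where "bounded_by p n L C" using tens_neg_bounded[OF L] .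
  then have "bounded_by q n L C" using bounded_by_mono pq by blast
  then show "L \<in> tens_neg q n" using tens_negD[OF L] by (intro tens_negI)
qed

lemma tens_neg_dual: "tens_neg p n \<subseteq> tens_dual n"
  by (auto simp: tens_dual_def)

text \<open>The index p of a functional may grow with its degree. A common index is available for
  finitely many degrees at a time, which is all that convolution in a given degree involves.\<close>

lemma tens_dual_obtain:
  assumes "\<And>i::nat. i \<le> m \<Longrightarrow> K i \<in> tens_dual (d i)"
  obtains p where "\<And>i. i \<le> m \<Longrightarrow> K i \<in> tens_neg p (d i)"
proof -
  have "\<forall>i\<le>m. \<exists>p. K i \<in> tens_neg p (d i)" using assms by (auto simp: tens_dual_def)
  then obtain P where P: "\<And>i. i \<le> m \<Longrightarrow> K i \<in> tens_neg (P i) (d i)" by metis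
  show ?thesis
  proof (rule that[of "Max (P ` {..m})"])
    fix i assume "i \<le> m"
    then show "K i \<in> tens_neg (Max (P ` {..m})) (d i)"
      using P[of i] tens_neg_mono[of "P i" "Max (P ` {..m})" "d i"] by auto
  qed
qed

lemma tens_neg_sum_arg:
  assumes L: "L \<in> tens_neg p n" and "finite I" "\<And>i. i \<in> I \<Longrightarrow> \<phi> i \<in> tens n"
  shows "L (\<lambda>xs. \<Sum>i\<in>I. c i * \<phi> i xs) = (\<Sum>i\<in>I. c i * L (\<phi> i))"
  using assms(2,3)
proof (induction I rule: finite_induct)
  case empty
  then show ?case using tens_negD(1)[OF L tens_0 tens_0, of 0 0] by simp
next
  case (insert i I)
  then show ?case
    using tens_negD(1)[OF L, of "\<phi> i" "\<lambda>xs. \<Sum>i\<in>I. c i * \<phi> i xs" "c i" 1] tens_sum[of I \<phi> n c] by simp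
qed

lemma tens_neg_at_0: "L \<in> tens_neg p n \<Longrightarrow> L (\<lambda>_. 0) = 0"
  using tens_negD(1)[of L p n "\<lambda>_. 0" "\<lambda>_. 0" 0 0] by simp

lemma tens_neg_scale_arg: "L \<in> tens_neg p n \<Longrightarrow> \<phi> \<in> tens n \<Longrightarrow> L (\<lambda>xs. c * \<phi> xs) = c * L \<phi>"
  using tens_negD(1)[of L p n \<phi> \<phi> c 0] by simp

lemma tens_neg_diff_arg: "L \<in> tens_neg p n \<Longrightarrow> \<phi> \<in> tens n \<Longrightarrow> \<psi> \<in> tens n \<Longrightarrow> L (\<lambda>xs. \<phi> xs - \<psi> xs) = L \<phi> - L \<psi>"
  using tens_negD(1)[of L p n \<phi> \<psi> 1 "-1"] by simp

lemma bounded_by_sum: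
  assumes "finite I" "\<And>i. i \<in> I \<Longrightarrow> bounded_by p n (L i) (C i)"
  shows "bounded_by p n (\<lambda>\<phi>. \<Sum>i\<in>I. a i * L i \<phi>) (\<Sum>i\<in>I. cmod (a i) * C i)"
proof (rule bounded_byI)
  show "0 \<le> (\<Sum>i\<in>I. cmod (a i) * C i)"
    using bounded_by_nonneg[OF assms(2)] by (intro sum_nonneg mult_nonneg_nonneg) auto
  fix \<phi> assume \<phi>: "\<phi> \<in> tens n"
  have "cmod (\<Sum>i\<in>I. a i * L i \<phi>) \<le> (\<Sum>i\<in>I. cmod (a i * L i \<phi>))" by (rule norm_sum)
  also have "\<dots> \<le> (\<Sum>i\<in>I. cmod (a i) * (C i * tnorm p n \<phi>))"
    unfolding norm_mult using bounded_byD[OF assms(2) \<phi>] by (intro sum_mono mult_left_mono) auto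
  finally show "cmod (\<Sum>i\<in>I. a i * L i \<phi>) \<le> (\<Sum>i\<in>I. cmod (a i) * C i) * tnorm p n \<phi>"
    by (simp add: sum_distrib_right mult.assoc)
qed

lemma tens_neg_sum:
  assumes "finite I" "\<And>i. i \<in> I \<Longrightarrow> L i \<in> tens_neg p n"
  shows "(\<lambda>\<phi>. \<Sum>i\<in>I. a i * L i \<phi>) \<in> tens_neg p n"
proof -
  have "\<forall>i\<in>I. \<exists>C. bounded_by p n (L i) C" using assms(2) tens_neg_bounded by metis
  then obtain C where C: "\<And>i. i \<in> I \<Longrightarrow> bounded_by p n (L i) (C i)" by metis
  show ?thesis
    using bounded_by_sum[OF assms(1) C] tens_negD[OF assms(2)]
    by (intro tens_negI) (auto simp: sum.distrib sum_distrib_left algebra_simps intro!: sum.neutral)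
qed

lemma tens_neg_scale: "L \<in> tens_neg p n \<Longrightarrow> (\<lambda>\<phi>. a * L \<phi>) \<in> tens_neg p n"
  using tens_neg_sum[of "{()}" "\<lambda>_. L" p n "\<lambda>_. a"] by simp

lemma tens_neg_0 [simp]: "(\<lambda>_. 0) \<in> tens_neg p n"
  by (rule tens_negI[of _ _ _ 0]) (auto intro: bounded_byI)

lemma bounded_by_dnorm:
  assumes L: "L \<in> tens_neg p n"
  shows "bounded_by p n L (dnorm p n L)"
proof -
  let ?S = "{cmod (L \<phi>) |\<phi>. \<phi> \<in> tens n \<and> tnorm p n \<phi> \<le> 1}"
  obtain C where C: "bounded_by p n L C" using tens_neg_bounded[OF L] .
  have bdd: "bdd_above ?S"
  proof (rule bdd_aboveI[of _ C])
    fix z assume "z \<in> ?S"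
    then obtain \<phi> where "z = cmod (L \<phi>)" "\<phi> \<in> tens n" "tnorm p n \<phi> \<le> 1" by blast
    then show "z \<le> C"
      using bounded_byD[OF C, of \<phi>] mult_left_mono[of "tnorm p n \<phi>" 1 C] bounded_by_nonneg[OF C] by simp
  qed
  have up: "cmod (L \<phi>) \<le> dnorm p n L" if "\<phi> \<in> tens n" "tnorm p n \<phi> \<le> 1" for \<phi>
    unfolding dnorm_def by (rule cSup_upper[OF _ bdd]) (use that in blast)
  have t0: "tnorm p n (\<lambda>_. 0) \<le> 0" using tnorm_scale_le[OF tens_0, of p n 0] by simp
  have d0: "0 \<le> dnorm p n L" using up[OF tens_0] t0 tens_neg_at_0[OF L] by simp
  show ?thesis
  proof (rule bounded_byI[OF d0])
    fix \<phi> assume \<phi>: "\<phi> \<in> tens n"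
    let ?t = "tnorm p n \<phi>"
    show "cmod (L \<phi>) \<le> dnorm p n L * ?t"
    proof (cases "?t = 0")
      \<comment> \<open>Normalising is impossible if the seminorm vanishes; the bound C then gives L
        \<phi> = 0.\<close>
      case True
      then show ?thesis using bounded_byD[OF C \<phi>] by simp
    next
      case False
      then have t: "?t > 0" using \<phi> tens_tnorm_nonneg[OF \<phi>, of p] by linarith
      have "cmod (L (\<lambda>xs. (1 / ?t) * \<phi> xs)) \<le> dnorm p n L"
      proof (rule up)
        show "(\<lambda>xs. complex_of_real (1 / ?t) * \<phi> xs) \<in> tens n" by (rule tens_scale[OF \<phi>])
        show "tnorm p n (\<lambda>xs. complex_of_real (1 / ?t) * \<phi> xs) \<le> 1"
          using tnorm_scale_le[OF \<phi>, of p "complex_of_real (1 / ?t)"] t by (simp add: norm_divide)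
      qed
      then show ?thesis unfolding tens_neg_scale_arg[OF L \<phi>]
        using t by (simp add: norm_mult norm_divide field_simps)
    qed
  qed
qed

lemma dnorm_le:
  assumes "bounded_by p n L C"
  shows "dnorm p n L \<le> C"
  unfolding dnorm_def
proof (rule cSup_least)
  have "tnorm p n (\<lambda>_. 0) \<le> 1" using tnorm_scale_le[OF tens_0, of p n 0] by simp
  then show "{cmod (L \<phi>) |\<phi>. \<phi> \<in> tens n \<and> tnorm p n \<phi> \<le> 1} \<noteq> {}" using tens_0 by blast
  fix z assume "z \<in> {cmod (L \<phi>) |\<phi>. \<phi> \<in> tens n \<and> tnorm p n \<phi> \<le> 1}"
  then obtain \<phi> where "z = cmod (L \<phi>)" "\<phi> \<in> tens n" "tnorm p n \<phi> \<le> 1" by blast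
  then show "z \<le> C"
    using bounded_byD[OF assms, of \<phi>] mult_left_mono[of "tnorm p n \<phi>" 1 C] bounded_by_nonneg[OF assms] by simp
qed

section \<open>Powers span a dense subspace\<close>

text \<open>The \<open>n\<close>-th iterated difference of \<open>\<xi> \<mapsto> \<xi>\<^sup>\<otimes>\<^sup>n\<close> along \<open>e\<^sub>1, \<dots>, e\<^sub>n\<close> is \<open>n!\<close> times the
  symmetrized product of the \<open>e\<^sub>i\<close>, which therefore lies in the span of the powers.\<close>

primrec tpow_difference :: "nat \<Rightarrow> 'h list \<Rightarrow> 'h \<Rightarrow> ('h \<Rightarrow> real) list \<Rightarrow> complex" where
  "tpow_difference n [] \<xi> = tpow (\<xi>, 0) n"
| "tpow_difference n (e # es) \<xi> = (\<lambda>xs. tpow_difference n es (\<xi> + e) xs - tpow_difference n es \<xi> xs)"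

lemma tpow_difference_tens:
  "set es \<subseteq> N \<Longrightarrow> \<xi> \<in> N \<Longrightarrow> tpow_difference n es \<xi> \<in> tens n"
  by (induction es arbitrary: \<xi>) (auto simp: NC_I intro: tens_diff)

lemma tpow_difference_kernel:
  assumes L: "L \<in> tens_neg p n" and z: "\<And>\<theta>. \<theta> \<in> NC \<Longrightarrow> L (tpow \<theta> n) = 0"
  shows "set es \<subseteq> N \<Longrightarrow> \<xi> \<in> N \<Longrightarrow> L (tpow_difference n es \<xi>) = 0"
proof (induction es arbitrary: \<xi>)
  case Nil
  then show ?case using z by (simp add: NC_I)
next
  case (Cons e es)
  then show ?case using tens_neg_diff_arg[OF L, of "tpow_difference n es (\<xi> + e)" "tpow_difference n es \<xi>"]
      tpow_difference_tens by simp
qed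

lemma tpow_difference_diagonal:
  assumes x: "x \<in> N'"
  shows "set es \<subseteq> N \<Longrightarrow> \<xi> \<in> N \<Longrightarrow> tpow_difference n es \<xi> (replicate n x) =
    finite_difference (map (\<lambda>e. complex_of_real (x e)) es) (\<lambda>t. t ^ n) (complex_of_real (x \<xi>))"
proof (induction es arbitrary: \<xi>)
  case Nil
  have "pair_real x (\<xi>, 0) = complex_of_real (x \<xi>)" using x by (simp add: pair_real_def complex_eq_iff)
  then show ?case using x by (simp add: tpow_def set_replicate_conv_if)
next
  case (Cons e es)
  then show ?case using x by (simp add: N'_linear_simps)
qed

lemma prod_list_of_real: "prod_list (map (\<lambda>e. complex_of_real (c e)) es) = complex_of_real (prod_list (map c es))"
  by (induction es) simp_all

text \<open>\<open>\<psi> k\<close> is \<phi> with every argument projected to the span of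
  \<open>bas p k\<close>. On tuples of basis functionals it agrees with \<phi> if all entries come
  from \<open>bas p k\<close> and is 0 otherwise, so the squared norm of the error is the tail of
  the defining sum. Its definition exhibits it as a combination of powers.\<close>

lemma finite_rank_approximation:
  fixes p :: nat
  assumes \<phi>: "\<phi> \<in> tens n"
  defines "\<psi> \<equiv> \<lambda>k xs. \<Sum>es\<in>tuples (bas p k) n. \<phi> (map (riesz p) es) / fact n * tpow_difference n es 0 xs"
  shows "\<psi> k \<in> tens n" "(tnorm p n (\<lambda>xs. \<phi> xs - \<psi> k xs))\<^sup>2 \<le> (tnorm p n \<phi>)\<^sup>2 - hsum p n \<phi> (bas p k)"
proof -
  have s: "symmetric_form n \<phi>" using \<phi> by (rule tens_sf)
  have td: "tpow_difference n es 0 \<in> tens n" if "es \<in> tuples (bas p k) n" for es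
    using that by (intro tpow_difference_tens) auto
  show \<psi>T: "\<psi> k \<in> tens n" unfolding \<psi>_def using td by (intro tens_sum) auto
  \<comment> \<open>P x is x composed with the projection onto the span of \<open>bas p k\<close>,
    written through basis functionals so that it is again an element of \<open>N'\<close>.\<close>
  define P where "P x = (\<lambda>\<xi>. \<Sum>e\<in>bas p k. x e * riesz p e \<xi>)" for x :: "'h \<Rightarrow> real"
  have PN: "P x \<in> N'" for x unfolding P_def by (intro N'_sum) auto
  define \<omega> where "\<omega> = (\<lambda>xs. if length xs = n \<and> set xs \<subseteq> N' then \<phi> (map P xs) else 0)"
  have "symmetric_form n \<omega>"
    unfolding symmetric_form_def
  proof (intro conjI allI ballI impI)
    fix xs ys :: "('h \<Rightarrow> real) list" assume m: "mset xs = mset ys"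
    then have "\<phi> (map P xs) = \<phi> (map P ys)" by (intro sf_perm[OF s]) (simp)
    then show "\<omega> xs = \<omega> ys"
      unfolding \<omega>_def using mset_eq_length[OF m] mset_eq_setD[OF m] by simp
  next
    fix x y c d and xs :: "('h \<Rightarrow> real) list"
    assume "x \<in> N'" "y \<in> N'" "set xs \<subseteq> N' \<and> Suc (length xs) = n"
    moreover have "P (\<lambda>\<xi>. c * x \<xi> + d * y \<xi>) = (\<lambda>\<xi>. c * P x \<xi> + d * P y \<xi>)"
      unfolding P_def by (simp add: sum.distrib sum_distrib_left algebra_simps)
    ultimately show "\<omega> ((\<lambda>\<xi>. c * x \<xi> + d * y \<xi>) # xs) = complex_of_real c * \<omega> (x # xs) + complex_of_real d * \<omega> (y # xs)"
      using sf_lin[OF s PN PN] by (auto simp: \<omega>_def N'_comb)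
  qed (auto simp: \<omega>_def)
  \<comment> \<open>Symmetric forms are determined on the diagonal. There the n-fold difference is
    n! times the product of the values x e, and the factor 1 / n! in \<psi> cancels the n!.\<close>
  then have \<psi>\<omega>: "\<psi> k = \<omega>"
  proof (intro sf_eq_if_diagonal_eq[OF tens_sf[OF \<psi>T]])
    fix x assume x: "x \<in> N'"
    have "\<psi> k (replicate n x) = (\<Sum>es\<in>tuples (bas p k) n. complex_of_real (prod_list (map x es)) * \<phi> (map (riesz p) es))"
      unfolding \<psi>_def
    proof (intro sum.cong refl)
      fix es assume es: "es \<in> tuples (bas p k) n"
      then have "set es \<subseteq> N" by auto
      then have "tpow_difference n es 0 (replicate n x) = fact n * complex_of_real (prod_list (map x es))"
        using tpow_difference_diagonal[OF x, of es 0 n] es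
          finite_difference_power[of n "map (\<lambda>e. complex_of_real (x e)) es" "complex_of_real (x 0)"]
        by (simp add: prod_list_of_real)
      then show "\<phi> (map (riesz p) es) / fact n * tpow_difference n es 0 (replicate n x) =
          complex_of_real (prod_list (map x es)) * \<phi> (map (riesz p) es)" by simp
    qed
    also have "\<dots> = \<phi> (replicate n (P x))"
      unfolding P_def using sf_replicate_sum[OF s bas_finite, where v = "riesz p" and c = x and m = n and zs = "[]"] by simp
    also have "\<dots> = \<omega> (replicate n x)" using x by (simp add: \<omega>_def map_replicate set_replicate_conv_if)
    finally show "\<psi> k (replicate n x) = \<omega> (replicate n x)" .
  qed
  have dT: "(\<lambda>xs. \<phi> xs - \<psi> k xs) \<in> tens n" using \<phi> \<psi>T by (rule tens_diff)
  have Pb: "P (riesz p f) = (if f \<in> bas p k then riesz p f else (\<lambda>_. 0))" if "f \<in> bas p m" for f m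
  proof -
    let ?L = "max k m"
    have f: "f \<in> bas p ?L" using that bas_mono[of m ?L p] by auto
    have ipf: "riesz p f e = (if e = f then 1 else 0)" if "e \<in> bas p k" for e
    proof -
      have "e \<in> bas p ?L" using that bas_mono[of k ?L p] by auto
      then show ?thesis using bas_on[of p ?L] f by (auto simp: H.on_def riesz_def)
    qed
    have "P (riesz p f) \<xi> = (\<Sum>e\<in>bas p k. if e = f then riesz p e \<xi> else 0)" for \<xi>
      unfolding P_def using ipf by (intro sum.cong) auto
    then show ?thesis by (auto simp: fun_eq_iff)
  qed
  show "(tnorm p n (\<lambda>xs. \<phi> xs - \<psi> k xs))\<^sup>2 \<le> (tnorm p n \<phi>)\<^sup>2 - hsum p n \<phi> (bas p k)"
  proof (rule tnorm_sq_le_if_bas[OF tens_sf[OF dT] tens_bdd[OF dT]])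
    fix m
    let ?L = "max k m"
    have val: "\<phi> (map (riesz p) es) - \<psi> k (map (riesz p) es) =
        (if es \<in> tuples (bas p k) n then 0 else \<phi> (map (riesz p) es))" if es: "es \<in> tuples (bas p m) n" for es
    proof -
      have esN: "set (map (riesz p) es) \<subseteq> N'" "length es = n" using es by auto
      show ?thesis
      proof (cases "set es \<subseteq> bas p k")
        case True
        then have "map P (map (riesz p) es) = map (riesz p) es" using Pb es by (auto simp: map_idI)
        then show ?thesis using True esN by (simp add: \<psi>\<omega> \<omega>_def del: map_map)
      next
        case False
        then have "(\<lambda>_. 0) \<in> set (map P (map (riesz p) es))" using Pb es by (force simp: image_iff)
        then have "\<phi> (map P (map (riesz p) es)) = 0" by (rule sf_zero_mem[OF s])
        then show ?thesis using False by (simp add: \<psi>\<omega> \<omega>_def)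
      qed
    qed
    have "hsum p n (\<lambda>xs. \<phi> xs - \<psi> k xs) (bas p m) =
        (\<Sum>es\<in>tuples (bas p m) n. if es \<in> tuples (bas p k) n then 0 else (cmod (\<phi> (map (riesz p) es)))\<^sup>2)"
      unfolding hsum_def using val by (intro sum.cong refl) (simp split: if_splits)
    also have "\<dots> \<le> (\<Sum>es\<in>tuples (bas p ?L) n. if es \<in> tuples (bas p k) n then 0 else (cmod (\<phi> (map (riesz p) es)))\<^sup>2)"
      using bas_mono[of m ?L p] by (intro sum_mono2) auto
    also have "\<dots> = (\<Sum>es\<in>tuples (bas p ?L) n - tuples (bas p k) n. (cmod (\<phi> (map (riesz p) es)))\<^sup>2)"
      by (intro sum.mono_neutral_cong_right) auto
    also have "\<dots> = hsum p n \<phi> (bas p ?L) - hsum p n \<phi> (bas p k)"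
      unfolding hsum_def using bas_mono[of k ?L p] by (intro sum_diff) auto
    also have "\<dots> \<le> (tnorm p n \<phi>)\<^sup>2 - hsum p n \<phi> (bas p k)"
      using hsum_bas_le_tnorm[OF tens_bdd[OF \<phi>]] by simp
    finally show "hsum p n (\<lambda>xs. \<phi> xs - \<psi> k xs) (bas p m) \<le> (tnorm p n \<phi>)\<^sup>2 - hsum p n \<phi> (bas p k)" .
  qed
qed

text \<open>L vanishes on the finite rank approximations, which are combinations of powers, and |L
  \<phi>| is at most C times the norm of the error, which tends to 0 by
  \<open>hsum_bas_limit\<close>.\<close>

lemma tens_neg_zero_if_powers_zero:
  assumes L: "L \<in> tens_neg p n" and z: "\<And>\<theta>. \<theta> \<in> NC \<Longrightarrow> L (tpow \<theta> n) = 0"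
  shows "L \<phi> = 0"
proof (cases "\<phi> \<in> tens n")
  case \<phi>: True
  obtain C where C: "bounded_by p n L C" using tens_neg_bounded[OF L] .
  define \<psi> where "\<psi> k xs = (\<Sum>es\<in>tuples (bas p k) n. \<phi> (map (riesz p) es) / fact n * tpow_difference n es 0 xs)" for k xs
  have \<psi>T: "\<psi> k \<in> tens n" and \<psi>n: "(tnorm p n (\<lambda>xs. \<phi> xs - \<psi> k xs))\<^sup>2 \<le> (tnorm p n \<phi>)\<^sup>2 - hsum p n \<phi> (bas p k)" for k
    unfolding \<psi>_def using finite_rank_approximation[OF \<phi>, of p k] by simp_all
  have L\<psi>: "L (\<psi> k) = 0" for k
  proof -
    have "L (\<psi> k) = (\<Sum>es\<in>tuples (bas p k) n. \<phi> (map (riesz p) es) / fact n * L (tpow_difference n es 0))"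
      unfolding \<psi>_def by (intro tens_neg_sum_arg[OF L] tpow_difference_tens) auto
    also have "\<dots> = 0" using tpow_difference_kernel[OF L z] bas_N[of p k] by (intro sum.neutral) auto
    finally show ?thesis .
  qed
  have "(\<lambda>k. cmod (L \<phi>)) \<longlonglongrightarrow> 0"
  proof (rule Lim_null_comparison)
    show "\<forall>\<^sub>F k in sequentially. norm (cmod (L \<phi>)) \<le> C * sqrt ((tnorm p n \<phi>)\<^sup>2 - hsum p n \<phi> (bas p k))"
    proof (intro always_eventually allI)
      fix k
      have dT: "(\<lambda>xs. \<phi> xs - \<psi> k xs) \<in> tens n" using \<phi> \<psi>T by (rule tens_diff)
      have "L \<phi> = L (\<lambda>xs. \<phi> xs - \<psi> k xs)" using tens_neg_diff_arg[OF L \<phi> \<psi>T] L\<psi> by simp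
      then have "cmod (L \<phi>) \<le> C * tnorm p n (\<lambda>xs. \<phi> xs - \<psi> k xs)" using bounded_byD[OF C dT] by simp
      also have "\<dots> \<le> C * sqrt ((tnorm p n \<phi>)\<^sup>2 - hsum p n \<phi> (bas p k))"
        using \<psi>n bounded_by_nonneg[OF C] by (intro mult_left_mono real_le_rsqrt) auto
      finally show "norm (cmod (L \<phi>)) \<le> C * sqrt ((tnorm p n \<phi>)\<^sup>2 - hsum p n \<phi> (bas p k))" by simp
    qed
    have "(\<lambda>k. C * sqrt ((tnorm p n \<phi>)\<^sup>2 - hsum p n \<phi> (bas p k))) \<longlonglongrightarrow> C * sqrt ((tnorm p n \<phi>)\<^sup>2 - (tnorm p n \<phi>)\<^sup>2)"
      by (intro tendsto_intros hsum_bas_limit tens_sf tens_bdd \<phi>)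
    then show "(\<lambda>k. C * sqrt ((tnorm p n \<phi>)\<^sup>2 - hsum p n \<phi> (bas p k))) \<longlonglongrightarrow> 0" by simp
  qed
  then show ?thesis by (simp add: LIMSEQ_const_iff)
next
  case False
  then show ?thesis using tens_negD(2)[OF L] by blast
qed

lemma tens_dual_eqI:
  assumes "K \<in> tens_dual n" "L \<in> tens_dual n" "\<And>\<theta>. \<theta> \<in> NC \<Longrightarrow> K (tpow \<theta> n) = L (tpow \<theta> n)"
  shows "K = L"
proof
  fix \<phi>
  obtain p q where "K \<in> tens_neg p n" "L \<in> tens_neg q n" using assms by (auto simp: tens_dual_def)
  then have KL: "K \<in> tens_neg (max p q) n" "L \<in> tens_neg (max p q) n"
    using tens_neg_mono[of p "max p q" n] tens_neg_mono[of q "max p q" n] by auto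
  \<comment> \<open>The difference K - L is written as a sum over two indices to be an instance of
    \<open>tens_neg_sum\<close>.\<close>
  have "(\<lambda>\<phi>. \<Sum>b\<in>(UNIV::bool set). (if b then 1 else -1) * (if b then K else L) \<phi>) \<in> tens_neg (max p q) n"
    using KL by (intro tens_neg_sum) auto
  then have "(\<lambda>\<phi>. K \<phi> - L \<phi>) \<in> tens_neg (max p q) n" by (simp add: UNIV_bool)
  then have "K \<phi> - L \<phi> = 0" by (rule tens_neg_zero_if_powers_zero) (simp add: assms(3))
  then show "K \<phi> = L \<phi>" by simp
qed

section \<open>The convolution algebra of kernels\<close>

text \<open>Contraction of the last arguments with L, that is, (id \<otimes> L) \<phi>. The result
  is again a form, so a tensor product of functionals becomes a composition of two
  evaluations.\<close>

definition contr ::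
  "nat \<Rightarrow> ((('h \<Rightarrow> real) list \<Rightarrow> complex) \<Rightarrow> complex) \<Rightarrow> (('h \<Rightarrow> real) list \<Rightarrow> complex) \<Rightarrow> ('h \<Rightarrow> real) list \<Rightarrow> complex" where
  "contr k L \<phi> = (\<lambda>xs. if length xs = k \<and> set xs \<subseteq> N' then L (\<lambda>ys. \<phi> (xs @ ys)) else 0)"

lemma contr_sf:
  assumes L: "L \<in> tens_neg p j" and \<phi>: "\<phi> \<in> tens (k + j)"
  shows "symmetric_form k (contr k L \<phi>)"
  unfolding symmetric_form_def
proof (intro conjI allI ballI impI)
  fix xs ys :: "('h \<Rightarrow> real) list" assume m: "mset xs = mset ys"
  have "\<phi> (xs @ zs) = \<phi> (ys @ zs)" for zs using m by (intro sf_perm[OF tens_sf[OF \<phi>]]) simp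
  then show "contr k L \<phi> xs = contr k L \<phi> ys"
    unfolding contr_def using mset_eq_length[OF m] mset_eq_setD[OF m] by simp
next
  fix x y c d and xs :: "('h \<Rightarrow> real) list"
  assume x: "x \<in> N'" and y: "y \<in> N'" and xs: "set xs \<subseteq> N' \<and> Suc (length xs) = k"
  have T: "(\<lambda>ys. \<phi> ((z # xs) @ ys)) \<in> tens j" if "z \<in> N'" for z
    using tens_slices[of \<phi> "z # xs" j] that xs \<phi> by auto
  have "L (\<lambda>ys. \<phi> (((\<lambda>\<xi>. c * x \<xi> + d * y \<xi>) # xs) @ ys)) =
      complex_of_real c * L (\<lambda>ys. \<phi> ((x # xs) @ ys)) + complex_of_real d * L (\<lambda>ys. \<phi> ((y # xs) @ ys))"
    using tens_negD(1)[OF L T[OF x] T[OF y], of c d] sf_lin[OF tens_sf[OF \<phi>] x y] by simp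
  then show "contr k L \<phi> ((\<lambda>\<xi>. c * x \<xi> + d * y \<xi>) # xs) =
      complex_of_real c * contr k L \<phi> (x # xs) + complex_of_real d * contr k L \<phi> (y # xs)"
    using x y xs N'_comb[OF x y] by (simp add: contr_def)
qed (auto simp: contr_def)

text \<open>For each tuple the value is at most C times the norm of a slice, and the squared norms
  of all slices together are bounded by that of \<phi>: this is \<open>sub_orthonormal_mixed\<close>
  with the system B in the first k slots and the basis in the others.\<close>

lemma hsum_contr_le:
  assumes L: "bounded_by p j L C" and \<phi>: "\<phi> \<in> tens (k + j)" and B: "finite B" "H.on p B"
  shows "hsum p k (contr k L \<phi>) B \<le> (C * tnorm p (k + j) \<phi>)\<^sup>2"
proof -
  have BS: "e \<in> Hs p" if "e \<in> B" for e using B that by (auto simp: H.on_def)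
  have T: "(\<lambda>ys. \<phi> (map (riesz p) bs @ ys)) \<in> tens j" if "bs \<in> tuples B k" for bs
  proof (rule tens_slices)
    show "\<phi> \<in> tens (length (map (riesz p) bs) + j)" using that \<phi> by simp
    show "set (map (riesz p) bs) \<subseteq> N'" using that BS by auto
  qed
  have "hsum p k (contr k L \<phi>) B \<le> (\<Sum>bs\<in>tuples B k. C\<^sup>2 * (tnorm p j (\<lambda>ys. \<phi> (map (riesz p) bs @ ys)))\<^sup>2)"
    unfolding hsum_def
  proof (rule sum_mono)
    fix bs assume bs: "bs \<in> tuples B k"
    have "set (map (riesz p) bs) \<subseteq> N'" using bs BS by auto
    then have "cmod (contr k L \<phi> (map (riesz p) bs)) \<le> C * tnorm p j (\<lambda>ys. \<phi> (map (riesz p) bs @ ys))"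
      using bs bounded_byD[OF L T[OF bs]] by (simp add: contr_def)
    then show "(cmod (contr k L \<phi> (map (riesz p) bs)))\<^sup>2 \<le> C\<^sup>2 * (tnorm p j (\<lambda>ys. \<phi> (map (riesz p) bs @ ys)))\<^sup>2"
      by (simp add: power_mult_distrib[symmetric] power_mono)
  qed
  also have "\<dots> \<le> C\<^sup>2 * (tnorm p (k + j) \<phi>)\<^sup>2"
  proof -
    let ?s = "\<lambda>M. \<Sum>bs\<in>tuples B k. hsum p j (\<lambda>ys. \<phi> (map (riesz p) bs @ ys)) (bas p M)"
    have "?s \<longlonglongrightarrow> (\<Sum>bs\<in>tuples B k. (tnorm p j (\<lambda>ys. \<phi> (map (riesz p) bs @ ys)))\<^sup>2)"
      using T by (intro tendsto_sum hsum_bas_limit tens_sf tens_bdd)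
    moreover have "?s M \<le> (tnorm p (k + j) \<phi>)\<^sup>2" for M
      unfolding hsum_def
      by (rule sub_orthonormal_mixed[OF tens_sf[OF \<phi>] tens_bdd[OF \<phi>] sub_orthonormal_riesz[OF order_refl B]
            hsum_bas_le_tnorm[OF tens_bdd[OF \<phi>]] refl])
    ultimately have "(\<Sum>bs\<in>tuples B k. (tnorm p j (\<lambda>ys. \<phi> (map (riesz p) bs @ ys)))\<^sup>2) \<le> (tnorm p (k + j) \<phi>)\<^sup>2"
      by (intro LIMSEQ_le_const2) auto
    then show ?thesis unfolding sum_distrib_left[symmetric] by (intro mult_left_mono) auto
  qed
  finally show ?thesis by (simp add: power_mult_distrib)
qed

lemma contr_tens:
  assumes L: "L \<in> tens_neg p j" and \<phi>: "\<phi> \<in> tens (k + j)"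
  shows "contr k L \<phi> \<in> tens k"
proof (rule tensI[OF contr_sf[OF L \<phi>]])
  fix q
  obtain C where "bounded_by p j L C" using tens_neg_bounded[OF L] .
  then have "bounded_by (max p q) j L C" by (rule bounded_by_mono) auto
  from hs_boundedI(1)[OF hsum_contr_le[OF this \<phi>]]
  show "\<exists>r\<ge>q. bdd_above (hs_sums r k (contr k L \<phi>))" by (intro exI[of _ "max p q"] conjI) simp_all
qed

lemma tnorm_contr_le:
  assumes "bounded_by p j L C" "\<phi> \<in> tens (k + j)"
  shows "tnorm p k (contr k L \<phi>) \<le> C * tnorm p (k + j) \<phi>"
  using hs_boundedI(2)[OF hsum_contr_le[OF assms]] assms bounded_by_nonneg[OF assms(1)]
  by (rule_tac power2_le_imp_le) (auto intro!: mult_nonneg_nonneg)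

lemma contr_comb:
  assumes L: "L \<in> tens_neg p j" and \<phi>: "\<phi> \<in> tens (k + j)" and \<psi>: "\<psi> \<in> tens (k + j)"
  shows "contr k L (\<lambda>xs. c * \<phi> xs + d * \<psi> xs) = (\<lambda>xs. c * contr k L \<phi> xs + d * contr k L \<psi> xs)"
proof
  fix xs
  show "contr k L (\<lambda>xs. c * \<phi> xs + d * \<psi> xs) xs = c * contr k L \<phi> xs + d * contr k L \<psi> xs"
    using tens_negD(1)[OF L tens_slices tens_slices, of \<phi> xs \<psi> xs c d] \<phi> \<psi> by (auto simp: contr_def)
qed

text \<open>The functional K \<otimes> L. Symmetrization would be invisible, since the arguments are
  symmetric forms.\<close>

definition tprod ::
  "nat \<Rightarrow> nat \<Rightarrow> ((('h \<Rightarrow> real) list \<Rightarrow> complex) \<Rightarrow> complex) \<Rightarrow> ((('h \<Rightarrow> real) list \<Rightarrow> complex) \<Rightarrow> complex) \<Rightarrow>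
     (('h \<Rightarrow> real) list \<Rightarrow> complex) \<Rightarrow> complex" where
  "tprod k j K L \<phi> = (if \<phi> \<in> tens (k + j) then K (contr k L \<phi>) else 0)"

lemma bounded_by_tprod:
  assumes K: "bounded_by p k K C" and L: "bounded_by p j L D" "L \<in> tens_neg p j"
  shows "bounded_by p (k + j) (tprod k j K L) (C * D)"
proof (rule bounded_byI)
  show "0 \<le> C * D" using bounded_by_nonneg[OF K] bounded_by_nonneg[OF L(1)] by simp
  fix \<phi> assume \<phi>: "\<phi> \<in> tens (k + j)"
  have "cmod (K (contr k L \<phi>)) \<le> C * tnorm p k (contr k L \<phi>)"
    using bounded_byD[OF K contr_tens[OF L(2) \<phi>]] .
  also have "\<dots> \<le> C * (D * tnorm p (k + j) \<phi>)"
    using tnorm_contr_le[OF L(1) \<phi>] bounded_by_nonneg[OF K] by (intro mult_left_mono)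
  finally show "cmod (tprod k j K L \<phi>) \<le> C * D * tnorm p (k + j) \<phi>"
    using \<phi> by (simp add: tprod_def mult.assoc)
qed

lemma tprod_tens_neg:
  assumes K: "K \<in> tens_neg p k" and L: "L \<in> tens_neg p j"
  shows "tprod k j K L \<in> tens_neg p (k + j)"
proof -
  obtain C where C: "bounded_by p k K C" using tens_neg_bounded[OF K] .
  obtain D where D: "bounded_by p j L D" using tens_neg_bounded[OF L] .
  show ?thesis
  proof (rule tens_negI)
    show "bounded_by p (k + j) (tprod k j K L) (C * D)" using bounded_by_tprod[OF C D L] .
    fix \<phi> \<psi> c d assume "\<phi> \<in> tens (k + j)" "\<psi> \<in> tens (k + j)"
    then show "tprod k j K L (\<lambda>xs. c * \<phi> xs + d * \<psi> xs) = c * tprod k j K L \<phi> + d * tprod k j K L \<psi>"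
      using tens_negD(1)[OF K contr_tens[OF L] contr_tens[OF L]]
      by (simp add: tprod_def tens_comb contr_comb[OF L])
  qed (simp add: tprod_def)
qed

lemma tprod_tpow:
  assumes K: "K \<in> tens_neg p k" and L: "L \<in> tens_neg p j" and \<theta>: "\<theta> \<in> NC"
  shows "tprod k j K L (tpow \<theta> (k + j)) = K (tpow \<theta> k) * L (tpow \<theta> j)"
proof -
  have "contr k L (tpow \<theta> (k + j)) = (\<lambda>xs. L (tpow \<theta> j) * tpow \<theta> k xs)"
  proof
    fix xs
    show "contr k L (tpow \<theta> (k + j)) xs = L (tpow \<theta> j) * tpow \<theta> k xs"
    proof (cases "length xs = k \<and> set xs \<subseteq> N'")
      case True
      then have "(\<lambda>ys. tpow \<theta> (k + j) (xs @ ys)) = (\<lambda>ys. tpow \<theta> k xs * tpow \<theta> j ys)"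
        by (auto simp: tpow_def fun_eq_iff)
      then show ?thesis using True tens_neg_scale_arg[OF L, of "tpow \<theta> j"] \<theta> by (simp add: contr_def)
    next
      case False
      then show ?thesis by (auto simp: contr_def tpow_def)
    qed
  qed
  then show ?thesis using \<theta> tens_neg_scale_arg[OF K, of "tpow \<theta> k"] by (simp add: tprod_def)
qed

definition conv ::
  "(nat \<Rightarrow> (('h \<Rightarrow> real) list \<Rightarrow> complex) \<Rightarrow> complex) \<Rightarrow> (nat \<Rightarrow> (('h \<Rightarrow> real) list \<Rightarrow> complex) \<Rightarrow> complex) \<Rightarrow>
     nat \<Rightarrow> (('h \<Rightarrow> real) list \<Rightarrow> complex) \<Rightarrow> complex" where
  "conv K L n \<phi> = (\<Sum>k\<le>n. tprod k (n - k) (K k) (L (n - k)) \<phi>)"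

lemma conv_tens_neg:
  assumes "\<And>k. k \<le> n \<Longrightarrow> K k \<in> tens_neg p k" "\<And>k. k \<le> n \<Longrightarrow> L k \<in> tens_neg p k"
  shows "conv K L n \<in> tens_neg p n"
proof -
  have "(\<lambda>\<phi>. \<Sum>k\<le>n. 1 * tprod k (n - k) (K k) (L (n - k)) \<phi>) \<in> tens_neg p n"
  proof (intro tens_neg_sum)
    fix k assume "k \<in> {..n}"
    then show "tprod k (n - k) (K k) (L (n - k)) \<in> tens_neg p n"
      using tprod_tens_neg[of "K k" p k "L (n - k)" "n - k"] assms by simp
  qed simp
  then show ?thesis by (simp add: conv_def[abs_def])
qed

lemma tens_dual_common:
  assumes "\<And>k. K k \<in> tens_dual k" "\<And>k. L k \<in> tens_dual k"
  obtains p where "\<And>k. k \<le> n \<Longrightarrow> K k \<in> tens_neg p k" "\<And>k. k \<le> n \<Longrightarrow> L k \<in> tens_neg p k"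
proof -
  obtain p where p: "\<And>k. k \<le> n \<Longrightarrow> K k \<in> tens_neg p k" using tens_dual_obtain[of n K "\<lambda>k. k"] assms by blast
  obtain q where q: "\<And>k. k \<le> n \<Longrightarrow> L k \<in> tens_neg q k" using tens_dual_obtain[of n L "\<lambda>k. k"] assms by blast
  show ?thesis
  proof (rule that[of "max p q"])
    fix k assume k: "k \<le> n"
    show "K k \<in> tens_neg (max p q) k" using p[OF k] tens_neg_mono[of p "max p q" k] by auto
    show "L k \<in> tens_neg (max p q) k" using q[OF k] tens_neg_mono[of q "max p q" k] by auto
  qed
qed

lemma conv_dual:
  assumes "\<And>k. K k \<in> tens_dual k" "\<And>k. L k \<in> tens_dual k"
  shows "conv K L n \<in> tens_dual n"
proof -
  obtain p where "\<And>k. k \<le> n \<Longrightarrow> K k \<in> tens_neg p k" "\<And>k. k \<le> n \<Longrightarrow> L k \<in> tens_neg p k"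
    using tens_dual_common[OF assms] by blast
  then show ?thesis using conv_tens_neg tens_neg_dual by blast
qed

section \<open>Symbols, the unit and convolution inverses\<close>

definition symbol :: "(nat \<Rightarrow> (('h \<Rightarrow> real) list \<Rightarrow> complex) \<Rightarrow> complex) \<Rightarrow> 'h \<times> 'h \<Rightarrow> complex fps" where
  "symbol K \<theta> = Abs_fps (\<lambda>n. K n (tpow \<theta> n))"

lemma symbol_nth [simp]: "fps_nth (symbol K \<theta>) n = K n (tpow \<theta> n)"
  by (simp add: symbol_def)

lemma symbol_conv:
  assumes "\<And>k. K k \<in> tens_dual k" "\<And>k. L k \<in> tens_dual k" and \<theta>: "\<theta> \<in> NC"
  shows "symbol (conv K L) \<theta> = symbol K \<theta> * symbol L \<theta>"
proof (rule fps_ext)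
  fix n
  obtain p where p: "\<And>k. k \<le> n \<Longrightarrow> K k \<in> tens_neg p k" "\<And>k. k \<le> n \<Longrightarrow> L k \<in> tens_neg p k"
    using tens_dual_common[OF assms(1,2)] by blast
  have "conv K L n (tpow \<theta> n) = (\<Sum>k\<le>n. K k (tpow \<theta> k) * L (n - k) (tpow \<theta> (n - k)))"
    unfolding conv_def
  proof (intro sum.cong refl)
    fix k assume k: "k \<in> {..n}"
    show "tprod k (n - k) (K k) (L (n - k)) (tpow \<theta> n) = K k (tpow \<theta> k) * L (n - k) (tpow \<theta> (n - k))"
      using tprod_tpow[OF p(1) p(2) \<theta>, of k "n - k"] k by simp
  qed
  then show "fps_nth (symbol (conv K L) \<theta>) n = fps_nth (symbol K \<theta> * symbol L \<theta>) n"
    by (simp add: fps_mult_nth atMost_atLeast0)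
qed

lemma kernel_eqI:
  assumes "\<And>k. K k \<in> tens_dual k" "\<And>k. L k \<in> tens_dual k"
    and "\<And>\<theta>. \<theta> \<in> NC \<Longrightarrow> symbol K \<theta> = symbol L \<theta>"
  shows "K = L"
proof
  fix n
  show "K n = L n"
    using assms(1,2) by (rule tens_dual_eqI) (metis assms(3) symbol_nth)
qed

definition unit_kernel :: "nat \<Rightarrow> (('h \<Rightarrow> real) list \<Rightarrow> complex) \<Rightarrow> complex" where
  "unit_kernel n \<phi> = (if n = 0 \<and> \<phi> \<in> tens 0 then \<phi> [] else 0)"

lemma unit_kernel_bounded: "bounded_by p n (unit_kernel n) (if n = 0 then 1 else 0)"
proof (rule bounded_byI)
  fix \<phi> assume \<phi>: "\<phi> \<in> tens n"
  show "cmod (unit_kernel n \<phi>) \<le> (if n = 0 then 1 else 0) * tnorm p n \<phi>"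
  proof (cases "n = 0")
    case True
    have "hsum p 0 \<phi> {} \<le> (tnorm p 0 \<phi>)\<^sup>2" using \<phi> True by (intro hsum_le_tnorm tens_bdd) auto
    then have "(cmod (\<phi> []))\<^sup>2 \<le> (tnorm p 0 \<phi>)\<^sup>2" by (simp add: hsum_def)
    then have "cmod (\<phi> []) \<le> tnorm p 0 \<phi>" using \<phi> True by (rule_tac power2_le_imp_le) auto
    then show ?thesis using True \<phi> by (simp add: unit_kernel_def)
  qed (simp add: unit_kernel_def)
qed simp

lemma unit_kernel_tens_neg: "unit_kernel n \<in> tens_neg p n"
  by (rule tens_negI[OF _ unit_kernel_bounded]) (auto simp: unit_kernel_def tens_comb)

lemma unit_kernel_dual: "unit_kernel n \<in> tens_dual n"
  using unit_kernel_tens_neg tens_neg_dual by blast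

lemma symbol_unit: "\<theta> \<in> NC \<Longrightarrow> symbol unit_kernel \<theta> = 1"
proof (rule fps_ext)
  fix n assume "\<theta> \<in> NC"
  then have "tpow \<theta> 0 \<in> tens 0" by simp
  moreover have "tpow \<theta> 0 [] = 1" by (simp add: tpow_def)
  ultimately show "fps_nth (symbol unit_kernel \<theta>) n = fps_nth 1 n" by (simp add: unit_kernel_def)
qed

text \<open>The inverse is built by the recursion for the coefficients of a reciprocal power series.\<close>

fun inv_kernel ::
  "(nat \<Rightarrow> (('h \<Rightarrow> real) list \<Rightarrow> complex) \<Rightarrow> complex) \<Rightarrow> nat \<Rightarrow> (('h \<Rightarrow> real) list \<Rightarrow> complex) \<Rightarrow> complex" where
  "inv_kernel M n = (if n = 0 then unit_kernel 0
     else (\<lambda>\<phi>. \<Sum>k<n. (- 1) * tprod k (n - k) (inv_kernel M k) (M (n - k)) \<phi>))"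

declare inv_kernel.simps [simp del]

lemma inv_kernel_dual:
  assumes "\<And>k. M k \<in> tens_dual k"
  shows "inv_kernel M n \<in> tens_dual n"
proof (induction n rule: less_induct)
  case (less n)
  show ?case
  proof (cases "n = 0")
    case True
    then show ?thesis using unit_kernel_dual by (simp add: inv_kernel.simps[of M 0])
  next
    case False
    define K where "K k = (if k < n then inv_kernel M k else (\<lambda>_. 0))" for k
    have "K k \<in> tens_dual k" for k
      unfolding K_def using less subsetD[OF tens_neg_dual tens_neg_0] by auto
    then obtain p where p: "\<And>k. k \<le> n \<Longrightarrow> K k \<in> tens_neg p k" "\<And>k. k \<le> n \<Longrightarrow> M k \<in> tens_neg p k"
      using tens_dual_common[of K M n] assms by blast
    have "(\<lambda>\<phi>. \<Sum>k<n. (- 1) * tprod k (n - k) (inv_kernel M k) (M (n - k)) \<phi>) \<in> tens_neg p n"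
    proof (intro tens_neg_sum)
      fix k assume "k \<in> {..<n}"
      then show "tprod k (n - k) (inv_kernel M k) (M (n - k)) \<in> tens_neg p n"
        using tprod_tens_neg[of "inv_kernel M k" p k "M (n - k)" "n - k"] p(1)[of k] p(2)[of "n - k"]
        by (simp add: K_def)
    qed simp
    then show ?thesis using False tens_neg_dual inv_kernel.simps[of M n] by auto
  qed
qed

lemma symbol_inv_kernel:
  assumes M: "\<And>k. M k \<in> tens_dual k" and M0: "M 0 = unit_kernel 0" and \<theta>: "\<theta> \<in> NC"
  shows "symbol (inv_kernel M) \<theta> * symbol M \<theta> = 1"
proof (rule fps_ext)
  fix n
  have u: "unit_kernel 0 (tpow \<theta> 0) = 1" using symbol_unit[OF \<theta>] by (metis fps_one_nth symbol_nth)
  show "fps_nth (symbol (inv_kernel M) \<theta> * symbol M \<theta>) n = fps_nth 1 n"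
  proof (cases "n = 0")
    case True
    then show ?thesis using u by (simp add: M0 inv_kernel.simps[of M 0])
  next
    case False
    obtain p where p: "\<And>k. k \<le> n \<Longrightarrow> inv_kernel M k \<in> tens_neg p k" "\<And>k. k \<le> n \<Longrightarrow> M k \<in> tens_neg p k"
      using tens_dual_common[OF inv_kernel_dual[OF M] M] by blast
    have "inv_kernel M n (tpow \<theta> n) = (\<Sum>k<n. - (inv_kernel M k (tpow \<theta> k) * M (n - k) (tpow \<theta> (n - k))))"
    proof -
      have "inv_kernel M n (tpow \<theta> n) = (\<Sum>k<n. - tprod k (n - k) (inv_kernel M k) (M (n - k)) (tpow \<theta> n))"
        using False by (subst inv_kernel.simps) simp
      moreover have "tprod k (n - k) (inv_kernel M k) (M (n - k)) (tpow \<theta> n) = inv_kernel M k (tpow \<theta> k) * M (n - k) (tpow \<theta> (n - k))"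
        if "k < n" for k
        using tprod_tpow[OF p(1) p(2) \<theta>, of k "n - k"] that by simp
      ultimately show ?thesis by simp
    qed
    moreover have "fps_nth (symbol (inv_kernel M) \<theta> * symbol M \<theta>) n =
        (\<Sum>k<n. inv_kernel M k (tpow \<theta> k) * M (n - k) (tpow \<theta> (n - k))) + inv_kernel M n (tpow \<theta> n)"
      using u by (simp add: fps_mult_nth atLeast0AtMost lessThan_Suc_atMost[symmetric] M0)
    ultimately show ?thesis using False by (simp add: sum_negf)
  qed
qed

text \<open>The pairing \<open>\<Sum>n. n! \<langle>A\<^sub>n, \<phi>\<^sub>n\<rangle>\<close>, for which multiplication by a kernel \<open>a\<close> is
  adjoint to \<open>transfer a\<close>.\<close>

definition pairing ::
  "nat \<Rightarrow> (nat \<Rightarrow> (('h \<Rightarrow> real) list \<Rightarrow> complex) \<Rightarrow> complex) \<Rightarrow> (nat \<Rightarrow> ('h \<Rightarrow> real) list \<Rightarrow> complex) \<Rightarrow> complex" where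
  "pairing m A \<phi> = (\<Sum>n\<le>m. fact n * A n (\<phi> n))"

definition transfer ::
  "(nat \<Rightarrow> (('h \<Rightarrow> real) list \<Rightarrow> complex) \<Rightarrow> complex) \<Rightarrow> nat \<Rightarrow> (nat \<Rightarrow> ('h \<Rightarrow> real) list \<Rightarrow> complex) \<Rightarrow>
     nat \<Rightarrow> ('h \<Rightarrow> real) list \<Rightarrow> complex" where
  "transfer a m \<phi> k = (\<lambda>xs. \<Sum>n\<in>{k..m}. (fact n / fact k) * contr k (a (n - k)) (\<phi> n) xs)"

lemma transfer_tens:
  assumes "\<And>k. a k \<in> tens_dual k" "\<And>k. \<phi> k \<in> tens k"
  shows "transfer a m \<phi> k \<in> tens k"
  unfolding transfer_def
proof (rule tens_sum)
  fix n assume "n \<in> {k..m}"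
  then show "contr k (a (n - k)) (\<phi> n) \<in> tens k"
    using contr_tens[of "a (n - k)" _ "n - k" "\<phi> n" k] assms(1)[of "n - k"] assms(2)[of n]
    by (auto simp: tens_dual_def)
qed

text \<open>The weight n! / k! in \<open>transfer\<close> replaces the k! of the pairing by n!.
  Exchanging the sums over k \<le> n \<le> m then puts the convolution inside.\<close>

lemma pairing_transfer:
  assumes A: "\<And>k. A k \<in> tens_dual k" and a: "\<And>k. a k \<in> tens_dual k" and \<phi>: "\<And>k. \<phi> k \<in> tens k"
  shows "pairing m A (transfer a m \<phi>) = pairing m (conv A a) \<phi>"
proof -
  have C: "contr k (a (n - k)) (\<phi> n) \<in> tens k" if "k \<le> n" for k n
    using contr_tens[of "a (n - k)" _ "n - k" "\<phi> n" k] a[of "n - k"] \<phi>[of n] that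
    by (auto simp: tens_dual_def)
  have "pairing m A (transfer a m \<phi>) = (\<Sum>k\<le>m. \<Sum>n\<in>{k..m}. fact n * A k (contr k (a (n - k)) (\<phi> n)))"
    unfolding pairing_def
  proof (intro sum.cong refl)
    fix k
    obtain p where "A k \<in> tens_neg p k" using A[of k] by (auto simp: tens_dual_def)
    then have "A k (transfer a m \<phi> k) = (\<Sum>n\<in>{k..m}. (fact n / fact k) * A k (contr k (a (n - k)) (\<phi> n)))"
      unfolding transfer_def using C by (intro tens_neg_sum_arg) auto
    then show "fact k * A k (transfer a m \<phi> k) = (\<Sum>n\<in>{k..m}. fact n * A k (contr k (a (n - k)) (\<phi> n)))"
      by (simp add: sum_distrib_left)
  qed
  also have "\<dots> = (\<Sum>n\<le>m. \<Sum>k\<le>n. fact n * A k (contr k (a (n - k)) (\<phi> n)))"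
    unfolding sum.Sigma[OF finite_atMost ballI[OF finite_atLeastAtMost]] sum.Sigma[OF finite_atMost ballI[OF finite_atMost]]
    by (rule sum.reindex_bij_witness[where i = "\<lambda>(n, k). (k, n)" and j = "\<lambda>(k, n). (n, k)"]) auto
  also have "\<dots> = pairing m (conv A a) \<phi>"
    unfolding pairing_def conv_def tprod_def sum_distrib_left using \<phi> by (intro sum.cong refl) auto
  finally show ?thesis .
qed

section \<open>The kernel theorem\<close>

text \<open>Independence of the Hilbert-Schmidt norm from the basis, for one vector g at a time. The
  numbers in question are the coefficients of the adjoint of the embedding at g. Instead of the
  adjoint the vector w is used, for which Q is both the squared norm in \<open>Hs p'\<close> and the
  inner product with g in \<open>Hs p\<close>; expanding w in B bounds the latter by sqrt Q sqrt
  t.\<close>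

lemma hilbert_schmidt_coefficients_le:
  assumes B: "H.on p' B" "countable B" "\<And>y. y \<in> Hs p' \<Longrightarrow> (\<And>e. e \<in> B \<Longrightarrow> ip p' y e = 0) \<Longrightarrow> y = 0"
    and pp: "p \<le> p'" and sub: "Hs p' \<subseteq> Hs p" and g: "g \<in> Hs p"
    and A: "H.on p' A" "finite A" "A \<subseteq> N"
    and t: "t \<ge> 0" "\<And>F. finite F \<Longrightarrow> F \<subseteq> B \<Longrightarrow> (\<Sum>b\<in>F. (ip p b g)\<^sup>2) \<le> t"
  shows "(\<Sum>e\<in>A. (ip p e g)\<^sup>2) \<le> t"
proof -
  define Q where "Q = (\<Sum>e\<in>A. (ip p e g)\<^sup>2)"
  define w where "w = (\<Sum>e\<in>A. ip p e g *\<^sub>R e)"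
  have Q0: "Q \<ge> 0" by (simp add: Q_def sum_nonneg)
  have AN: "e \<in> N" if "e \<in> A" for e using A that by auto
  have w: "w \<in> N" unfolding w_def using AN by simp
  have Qw: "ip p' w w = Q" unfolding w_def Q_def by (rule H.on_norm[OF A(1,2)])
  have Qg: "ip p w g = Q" unfolding w_def Q_def using AN g
    by (simp add: H.left_sum H.left_scale power2_eq_square)
  have "Q \<le> sqrt Q * sqrt t + \<epsilon>" if "\<epsilon> > 0" for \<epsilon>
  proof -
    \<comment> \<open>The truncation error is paired with g, so \<delta> times 1 +
      \<open>nrm p g\<close> has to be \<epsilon>; the 1 avoids division by 0.\<close>
    define \<delta> where "\<delta> = \<epsilon> / (1 + nrm p g)"
    have ng: "nrm p g \<ge> 0" using g by simp
    then have \<delta>: "\<delta> > 0" using that by (simp add: \<delta>_def)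
    obtain F where F: "finite F" "F \<subseteq> B" "H.nm p' (w - H.prj p' F w) < \<delta>"
      using H.countable_basis_expansion[OF B N_Hs[OF w] \<delta>] by blast
    have onF: "H.on p' F" using B(1) F(2) H.on_subset by blast
    have FS: "b \<in> Hs p'" "b \<in> Hs p" if "b \<in> F" for b using onF that sub by (auto simp: H.on_def)
    have pS: "H.prj p' F w \<in> Hs p'" using onF w by (simp add: H.prj_in)
    have "ip p (H.prj p' F w) g = (\<Sum>b\<in>F. ip p' b w * ip p b g)"
      unfolding H.prj_def using FS g by (simp add: H.left_sum H.left_scale)
    also have "\<dots> \<le> \<bar>\<Sum>b\<in>F. ip p' b w * ip p b g\<bar>" by simp
    also have "\<dots> \<le> sqrt ((\<Sum>b\<in>F. (ip p' b w)\<^sup>2) * (\<Sum>b\<in>F. (ip p b g)\<^sup>2))"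
      by (intro real_le_rsqrt) (simp add: Cauchy_Schwarz_ineq_sum)
    also have "\<dots> \<le> sqrt (Q * t)"
      using H.bessel[OF onF F(1) N_Hs[OF w]] t(2)[OF F(1,2)] Q0
      by (intro real_sqrt_le_mono mult_mono) (auto simp: Qw sum_nonneg)
    finally have 1: "ip p (H.prj p' F w) g \<le> sqrt Q * sqrt t" by (simp add: real_sqrt_mult)
    have dS: "w - H.prj p' F w \<in> Hs p'" using pS w by simp
    have "ip p (w - H.prj p' F w) g \<le> nrm p (w - H.prj p' F w) * nrm p g"
      using H.cauchy_schwarz[of "w - H.prj p' F w" p g] dS sub g unfolding nrm_eq by fastforce
    also have "\<dots> \<le> \<delta> * (1 + nrm p g)"
      using nrm_le[OF pp dS] F(3) ng \<delta> unfolding nrm_eq[symmetric] by (intro mult_mono) auto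
    also have "\<dots> = \<epsilon>" using ng by (simp add: \<delta>_def)
    finally have 2: "ip p (w - H.prj p' F w) g \<le> \<epsilon>" .
    have "ip p w g = ip p (H.prj p' F w) g + ip p (w - H.prj p' F w) g"
      using pS sub w g by (simp add: H.left_diff subsetD)
    then show ?thesis using 1 2 Qg by linarith
  qed
  then have "Q \<le> sqrt Q * sqrt t" by (rule field_le_epsilon)
  then have "sqrt Q * sqrt Q \<le> sqrt Q * sqrt t" using Q0 by simp
  then have "sqrt Q \<le> sqrt t"
    using Q0 t(1) mult_left_le_imp_le[of "sqrt Q" "sqrt Q" "sqrt t"] by (cases "Q = 0") auto
  then show ?thesis by (simp add: Q_def)
qed

text \<open>The Hilbert-Schmidt bound is given for some basis B of \<open>Hs p'\<close> and is
  needed for \<open>bas p'\<close>, whose vectors lie in N. The finitely many vectors of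
  \<open>bas p' M\<close> are expanded in a finite orthonormal G of \<open>Hs p\<close>; the double
  sum is compared with B for each g in G, and Bessel for each b in B returns the total c.\<close>

lemma hilbert_schmidt_bas_bounded:
  assumes hs: "hilbert_schmidt_embedding p' p" and pp: "p \<le> p'"
  obtains c where "c \<ge> 0" "\<And>M. (\<Sum>e\<in>bas p' M. (nrm p e)\<^sup>2) \<le> c"
proof -
  obtain B where sub: "Hs p' \<subseteq> Hs p" and B: "orthonormal_basis p' B"
    and sm: "(\<lambda>e. (nrm p e)\<^sup>2) summable_on B"
    using hs unfolding hilbert_schmidt_embedding_def by blast
  have on: "H.on p' B" and total: "\<And>y. y \<in> Hs p' \<Longrightarrow> (\<And>e. e \<in> B \<Longrightarrow> ip p' y e = 0) \<Longrightarrow> y = 0"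
    using B unfolding orthonormal_basis_def orthonormal_eq by auto
  have BS: "e \<in> Hs p'" "e \<in> Hs p" "e \<noteq> 0" if "e \<in> B" for e
    using on that sub unfolding H.on_def by force+
  have "countable {e \<in> B. (nrm p e)\<^sup>2 \<noteq> 0}"
    using sm by (rule summable_countable_real)
  moreover have "{e \<in> B. (nrm p e)\<^sup>2 \<noteq> 0} = B"
    using BS nrm_eq_0[of _ p] by force
  ultimately have cB: "countable B" by simp
  define c where "c = (\<Sum>\<^sub>\<infinity>b\<in>B. (nrm p b)\<^sup>2)"
  show ?thesis
  proof (rule that)
    show "c \<ge> 0" unfolding c_def by (rule infsum_nonneg) simp
    fix M
    have AS: "bas p' M \<subseteq> Hs p" by auto
    obtain G where G: "H.on p G" "finite G" "\<And>x. x \<in> bas p' M \<Longrightarrow> H.prj p G x = x"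
      using H.finite_gram_schmidt[OF bas_finite AS] by blast
    have GS: "g \<in> Hs p" if "g \<in> G" for g using G(1) that by (auto simp: H.on_def)
    have bes: "(\<Sum>g\<in>G. (ip p b g)\<^sup>2) \<le> (nrm p b)\<^sup>2" if "b \<in> Hs p" for b
    proof -
      have "(\<Sum>g\<in>G. (ip p b g)\<^sup>2) = (\<Sum>g\<in>G. (ip p g b)\<^sup>2)"
        using that GS by (intro sum.cong) (auto simp: H.sym[of b p])
      then show ?thesis using H.bessel[OF G(1,2) that] by (simp add: nrm_sq[OF that])
    qed
    have smg: "(\<lambda>b. (ip p b g)\<^sup>2) summable_on B" if g: "g \<in> G" for g
    proof (rule summable_on_comparison_test[OF sm])
      fix b assume b: "b \<in> B"
      have "(ip p b g)\<^sup>2 \<le> (\<Sum>g\<in>G. (ip p b g)\<^sup>2)" by (rule member_le_sum[OF g]) (use G in auto)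
      then show "(ip p b g)\<^sup>2 \<le> (nrm p b)\<^sup>2" using bes[OF BS(2)[OF b]] by linarith
    qed simp
    have "(nrm p e)\<^sup>2 = (\<Sum>g\<in>G. (ip p e g)\<^sup>2)" if e: "e \<in> bas p' M" for e
    proof -
      have eS: "e \<in> Hs p" using e by simp
      have "ip p (e - H.prj p G e) (e - H.prj p G e) = 0" using G(3)[OF e] by simp
      then have "ip p e e = (\<Sum>g\<in>G. (ip p g e)\<^sup>2)" using H.prj_residual[OF G(1,2) eS] by simp
      also have "\<dots> = (\<Sum>g\<in>G. (ip p e g)\<^sup>2)"
        using eS GS by (intro sum.cong) (auto simp: H.sym[of e p])
      finally show ?thesis using eS by (simp add: nrm_sq)
    qed
    then have "(\<Sum>e\<in>bas p' M. (nrm p e)\<^sup>2) = (\<Sum>g\<in>G. \<Sum>e\<in>bas p' M. (ip p e g)\<^sup>2)"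
      by (simp add: sum.swap[of _ G])
    also have "\<dots> \<le> (\<Sum>g\<in>G. \<Sum>\<^sub>\<infinity>b\<in>B. (ip p b g)\<^sup>2)"
    proof (rule sum_mono)
      fix g assume g: "g \<in> G"
      show "(\<Sum>e\<in>bas p' M. (ip p e g)\<^sup>2) \<le> (\<Sum>\<^sub>\<infinity>b\<in>B. (ip p b g)\<^sup>2)"
      proof (rule hilbert_schmidt_coefficients_le[OF on cB total pp sub GS[OF g] bas_on bas_finite bas_N])
        show "0 \<le> (\<Sum>\<^sub>\<infinity>b\<in>B. (ip p b g)\<^sup>2)" by (rule infsum_nonneg) simp
        fix F assume "finite F" "F \<subseteq> B"
        then show "(\<Sum>b\<in>F. (ip p b g)\<^sup>2) \<le> (\<Sum>\<^sub>\<infinity>b\<in>B. (ip p b g)\<^sup>2)"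
          using smg[OF g] by (intro finite_sum_le_infsum) auto
      qed
    qed
    also have "\<dots> \<le> c"
      unfolding c_def using smg bes BS
      by (intro has_sum_mono[OF has_sum_finite_sum[OF G(2) has_sum_infsum] has_sum_infsum[OF sm]]) auto
    finally show "(\<Sum>e\<in>bas p' M. (nrm p e)\<^sup>2) \<le> c" .
  qed
qed

section \<open>Functionals with square summable coefficients\<close>

definition basis :: "nat \<Rightarrow> 'h set" where
  "basis p = (\<Union>k. bas p k)"

lemma bas_basis: "bas p k \<subseteq> basis p"
  by (auto simp: basis_def)

lemma tuples_basis_finite:
  assumes "finite F" "F \<subseteq> tuples (basis p) n"
  obtains k where "F \<subseteq> tuples (bas p k) n"
proof -
  have *: "\<exists>k. A \<subseteq> bas p k" if "finite A" "A \<subseteq> basis p" for A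
    using that
  proof (induction A rule: finite_induct)
    case (insert a A)
    then obtain k where k: "A \<subseteq> bas p k" by auto
    obtain l where l: "a \<in> bas p l" using insert by (auto simp: basis_def)
    show ?case using k l bas_mono[of k "max k l" p] bas_mono[of l "max k l" p]
      by (intro exI[of _ "max k l"]) auto
  qed auto
  have "finite (\<Union>(set ` F))" "\<Union>(set ` F) \<subseteq> basis p" using assms by auto
  then obtain k where "\<Union>(set ` F) \<subseteq> bas p k" using * by blast
  then have "F \<subseteq> tuples (bas p k) n" using assms(2) by auto
  then show ?thesis by (rule that)
qed

text \<open>The functional with coefficients m in the basis, given as an unordered sum. For square
  summable m it converges absolutely by Cauchy-Schwarz.\<close>

definition series_functional ::
  "nat \<Rightarrow> nat \<Rightarrow> ('h list \<Rightarrow> complex) \<Rightarrow> (('h \<Rightarrow> real) list \<Rightarrow> complex) \<Rightarrow> complex" where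
  "series_functional p n m \<phi> =
     (if \<phi> \<in> tens n then \<Sum>\<^sub>\<infinity>es\<in>tuples (basis p) n. m es * \<phi> (map (riesz p) es) else 0)"

context
  fixes p n :: nat and m :: "'h list \<Rightarrow> complex" and T :: real
  assumes T0: "T \<ge> 0" and T: "\<And>k. (\<Sum>es\<in>tuples (bas p k) n. (cmod (m es))\<^sup>2) \<le> T\<^sup>2"
begin

lemma series_partial_bound:
  assumes \<phi>: "\<phi> \<in> tens n"
  shows "(\<Sum>es\<in>tuples (bas p k) n. cmod (m es * \<phi> (map (riesz p) es))) \<le> T * tnorm p n \<phi>"
proof (rule power2_le_imp_le)
  have "(\<Sum>es\<in>tuples (bas p k) n. cmod (m es * \<phi> (map (riesz p) es)))\<^sup>2 \<le>
      (\<Sum>es\<in>tuples (bas p k) n. (cmod (m es))\<^sup>2) * hsum p n \<phi> (bas p k)"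
    unfolding hsum_def norm_mult by (rule Cauchy_Schwarz_ineq_sum)
  also have "\<dots> \<le> T\<^sup>2 * (tnorm p n \<phi>)\<^sup>2"
    using T hsum_bas_le_tnorm[OF tens_bdd[OF \<phi>]] by (intro mult_mono) (auto simp: hsum_nonneg)
  finally show "(\<Sum>es\<in>tuples (bas p k) n. cmod (m es * \<phi> (map (riesz p) es)))\<^sup>2 \<le> (T * tnorm p n \<phi>)\<^sup>2"
    by (simp add: power_mult_distrib)
  show "0 \<le> T * tnorm p n \<phi>" using T0 \<phi> by simp
qed

lemma series_limit:
  assumes \<phi>: "\<phi> \<in> tens n"
  shows "(\<lambda>k. \<Sum>es\<in>tuples (bas p k) n. m es * \<phi> (map (riesz p) es)) \<longlonglongrightarrow> series_functional p n m \<phi>"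
proof -
  let ?f = "\<lambda>es. m es * \<phi> (map (riesz p) es)"
  have "(\<lambda>es. cmod (?f es)) summable_on tuples (basis p) n"
  proof (rule nonneg_bdd_above_summable_on)
    show "bdd_above (sum (\<lambda>es. cmod (?f es)) ` {F. F \<subseteq> tuples (basis p) n \<and> finite F})"
    proof (rule bdd_aboveI2)
      fix F assume "F \<in> {F. F \<subseteq> tuples (basis p) n \<and> finite F}"
      then obtain k where k: "F \<subseteq> tuples (bas p k) n" using tuples_basis_finite[of F p n] by auto
      have "sum (\<lambda>es. cmod (?f es)) F \<le> (\<Sum>es\<in>tuples (bas p k) n. cmod (?f es))"
        using k by (intro sum_mono2) auto
      then show "sum (\<lambda>es. cmod (?f es)) F \<le> T * tnorm p n \<phi>" using series_partial_bound[OF \<phi>, of k] by linarith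
    qed
  qed simp
  then have "((\<lambda>F. sum ?f F) \<longlongrightarrow> series_functional p n m \<phi>) (finite_subsets_at_top (tuples (basis p) n))"
    unfolding series_functional_def using \<phi> by (simp add: infsum_tendsto abs_summable_summable)
  \<comment> \<open>The tuples over \<open>bas p k\<close> are cofinal among the finite sets of
    tuples, so the unordered sum may be computed along this sequence.\<close>
  moreover have "filterlim (\<lambda>k. tuples (bas p k) n) (finite_subsets_at_top (tuples (basis p) n)) sequentially"
    unfolding filterlim_finite_subsets_at_top
  proof (intro allI impI)
    fix X assume "finite X \<and> X \<subseteq> tuples (basis p) n"
    then obtain k where k: "X \<subseteq> tuples (bas p k) n" using tuples_basis_finite[of X p n] by auto
    show "\<forall>\<^sub>F l in sequentially. finite (tuples (bas p l) n) \<and> X \<subseteq> tuples (bas p l) n \<and> tuples (bas p l) n \<subseteq> tuples (basis p) n"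
    proof (rule eventually_sequentiallyI)
      fix l assume "k \<le> l"
      then have "tuples (bas p k) n \<subseteq> tuples (bas p l) n" using bas_mono[of k l p] by auto
      moreover have "tuples (bas p l) n \<subseteq> tuples (basis p) n" using bas_basis[of p l] by auto
      ultimately show "finite (tuples (bas p l) n) \<and> X \<subseteq> tuples (bas p l) n \<and> tuples (bas p l) n \<subseteq> tuples (basis p) n"
        using k by (intro conjI finite_tuples bas_finite) (rule order_trans)
    qed
  qed
  ultimately show ?thesis by (rule filterlim_compose)
qed

lemma series_functional_tens_neg: "series_functional p n m \<in> tens_neg p n"
proof (rule tens_negI)
  show "bounded_by p n (series_functional p n m) T"
  proof (rule bounded_byI[OF T0])
    fix \<phi> assume \<phi>: "\<phi> \<in> tens n"
    have "cmod (\<Sum>es\<in>tuples (bas p k) n. m es * \<phi> (map (riesz p) es)) \<le> T * tnorm p n \<phi>" for k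
      using norm_sum[of "\<lambda>es. m es * \<phi> (map (riesz p) es)" "tuples (bas p k) n"] series_partial_bound[OF \<phi>, of k]
      by linarith
    then show "cmod (series_functional p n m \<phi>) \<le> T * tnorm p n \<phi>"
      using tendsto_norm[OF series_limit[OF \<phi>]] by (intro LIMSEQ_le_const2) auto
  qed
  fix \<phi> \<psi> c d assume \<phi>: "\<phi> \<in> tens n" and \<psi>: "\<psi> \<in> tens n"
  have "(\<lambda>k. c * (\<Sum>es\<in>tuples (bas p k) n. m es * \<phi> (map (riesz p) es)) +
      d * (\<Sum>es\<in>tuples (bas p k) n. m es * \<psi> (map (riesz p) es))) \<longlonglongrightarrow>
      c * series_functional p n m \<phi> + d * series_functional p n m \<psi>"
    by (intro tendsto_intros series_limit \<phi> \<psi>)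
  moreover have "c * (\<Sum>es\<in>tuples (bas p k) n. m es * \<phi> (map (riesz p) es)) +
      d * (\<Sum>es\<in>tuples (bas p k) n. m es * \<psi> (map (riesz p) es)) =
      (\<Sum>es\<in>tuples (bas p k) n. m es * (c * \<phi> (map (riesz p) es) + d * \<psi> (map (riesz p) es)))" for k
    by (simp add: sum_distrib_left sum.distrib algebra_simps)
  ultimately show "series_functional p n m (\<lambda>xs. c * \<phi> xs + d * \<psi> xs) = c * series_functional p n m \<phi> + d * series_functional p n m \<psi>"
    using series_limit[OF tens_comb[OF \<phi> \<psi>, of c d]] LIMSEQ_unique by simp
qed (simp add: series_functional_def)

end

text \<open>The core of the kernel theorem: a bound by the product of the weaker norms becomes a
  square sum over a basis of the stronger space, because the sum over tuples factors into n equal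
  sums, each at most c.\<close>

lemma kernel_square_sum_le:
  assumes K: "\<And>k es. es \<in> tuples (bas p' k) n \<Longrightarrow> cmod (m es) \<le> K * prod_list (map (nrm p) es)"
    and c: "\<And>M. (\<Sum>e\<in>bas p' M. (nrm p e)\<^sup>2) \<le> c"
  shows "(\<Sum>es\<in>tuples (bas p' k) n. (cmod (m es))\<^sup>2) \<le> K\<^sup>2 * c ^ n"
proof -
  have sq: "(prod_list (map f es))\<^sup>2 = prod_list (map (\<lambda>e. (f e)\<^sup>2) es)" for f :: "'h \<Rightarrow> real" and es
    by (induction es) (simp_all add: power_mult_distrib)
  have "(\<Sum>es\<in>tuples (bas p' k) n. (cmod (m es))\<^sup>2) \<le> (\<Sum>es\<in>tuples (bas p' k) n. (K * prod_list (map (nrm p) es))\<^sup>2)"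
    using K by (intro sum_mono power_mono) auto
  also have "\<dots> = K\<^sup>2 * (\<Sum>e\<in>bas p' k. (nrm p e)\<^sup>2) ^ n"
    unfolding power_mult_distrib sq sum_distrib_left[symmetric] sum_prod_list_tuples ..
  also have "\<dots> \<le> K\<^sup>2 * c ^ n"
    using c[of k] by (intro mult_left_mono power_mono) (auto simp: sum_nonneg)
  finally show ?thesis .
qed

text \<open>Evaluation at the n-th tensor power of x, divided by n!: the Taylor coefficients of
  \<open>\<theta> \<mapsto> exp \<langle>x, \<theta>\<rangle>\<close>.\<close>

definition power_kernel :: "('h \<Rightarrow> real) \<Rightarrow> nat \<Rightarrow> (('h \<Rightarrow> real) list \<Rightarrow> complex) \<Rightarrow> complex" where
  "power_kernel x n \<phi> = (if \<phi> \<in> tens n then \<phi> (replicate n x) / fact n else 0)"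

lemma power_kernel_dual:
  assumes x: "x \<in> N'"
  shows "power_kernel x n \<in> tens_dual n"
proof -
  obtain p where xp: "x \<in> Hneg p" using x by (auto simp: N'_def)
  obtain C0 where C0: "C0 \<ge> 0" "\<And>\<xi>. \<xi> \<in> N \<Longrightarrow> \<bar>x \<xi>\<bar> \<le> C0 * nrm p \<xi>" using Hneg_bound[OF xp] by blast
  \<comment> \<open>The added 1 makes C positive, so that x / C is a one-element sub-orthonormal
    system.\<close>
  define C where "C = C0 + 1"
  have C: "C > 0" using C0 by (simp add: C_def)
  define v where "v = (\<lambda>_::unit. \<lambda>\<xi>. (1 / C) * x \<xi>)"
  have so: "sub_orthonormal p {()} v"
  proof -
    have "((1 / C) * x \<xi>)\<^sup>2 \<le> (nrm p \<xi>)\<^sup>2" if "\<xi> \<in> N" for \<xi>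
    proof -
      have "\<bar>x \<xi>\<bar> \<le> C * nrm p \<xi>" using C0(2)[OF that] that by (simp add: C_def distrib_right add_increasing2)
      then have "\<bar>(1 / C) * x \<xi>\<bar> \<le> nrm p \<xi>" using C by (simp add: abs_mult field_simps)
      then show ?thesis using that by (simp add: abs_le_square_iff[symmetric])
    qed
    then show ?thesis unfolding sub_orthonormal_def v_def using Hneg_scale[OF xp, of "1 / C"] by simp
  qed
  have "bounded_by p n (power_kernel x n) (C ^ n / fact n)"
  proof (rule bounded_byI)
    show "0 \<le> C ^ n / fact n" using C by simp
    fix \<phi> assume \<phi>: "\<phi> \<in> tens n"
    have "(\<Sum>bs\<in>tuples {()} n. (cmod (\<phi> (map v bs)))\<^sup>2) \<le> (tnorm p n \<phi>)\<^sup>2"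
      by (rule sub_orthonormal_bound[OF tens_sf[OF \<phi>] tens_bdd[OF \<phi>] so hsum_bas_le_tnorm[OF tens_bdd[OF \<phi>]]])
    moreover have "(cmod (\<phi> (map v (replicate n ()))))\<^sup>2 \<le> (\<Sum>bs\<in>tuples {()} n. (cmod (\<phi> (map v bs)))\<^sup>2)"
      by (rule member_le_sum) auto
    ultimately have "(cmod (\<phi> (replicate n (v ()))))\<^sup>2 \<le> (tnorm p n \<phi>)\<^sup>2" by (simp add: map_replicate)
    then have 1: "cmod (\<phi> (replicate n (v ()))) \<le> tnorm p n \<phi>" using \<phi> by (rule_tac power2_le_imp_le) auto
    have "\<phi> (replicate n (v ())) = complex_of_real (1 / C) ^ n * \<phi> (replicate n x)"
      unfolding v_def using sf_replicate_scale[OF tens_sf[OF \<phi>] x, of n "1 / C" "[]"] by simp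
    then have "cmod (\<phi> (replicate n (v ()))) = (1 / C) ^ n * cmod (\<phi> (replicate n x))"
      using C by (simp add: norm_mult norm_power norm_divide)
    then have "cmod (\<phi> (replicate n x)) = C ^ n * cmod (\<phi> (replicate n (v ())))"
      using C by (simp add: power_divide)
    then have "cmod (\<phi> (replicate n x)) \<le> C ^ n * tnorm p n \<phi>"
      using 1 C by (simp add: mult_left_mono)
    then show "cmod (power_kernel x n \<phi>) \<le> C ^ n / fact n * tnorm p n \<phi>"
      using \<phi> by (simp add: power_kernel_def norm_divide divide_right_mono)
  qed
  then have "power_kernel x n \<in> tens_neg p n"
    by (rule tens_negI[rotated]) (auto simp: power_kernel_def tens_comb add_divide_distrib)
  then show ?thesis using tens_neg_dual by blast
qed

lemma symbol_power_kernel: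
  assumes x: "x \<in> N'" and \<theta>: "\<theta> \<in> NC"
  shows "symbol (power_kernel x) \<theta> = fps_exp (pair_real x \<theta>)"
proof (rule fps_ext)
  fix n
  have "tpow \<theta> n (replicate n x) = pair_real x \<theta> ^ n"
    using x by (simp add: tpow_def set_replicate_conv_if)
  then show "fps_nth (symbol (power_kernel x) \<theta>) n = fps_nth (fps_exp (pair_real x \<theta>)) n"
    using \<theta> by (simp add: power_kernel_def)
qed

end

section \<open>Moments of an analytic measure\<close>

lemma dominated_integral:
  fixes f :: "'a \<Rightarrow> 'b::{banach, second_countable_topology}" and g :: "'a \<Rightarrow> real"
  assumes g: "integrable M g" and f: "f \<in> borel_measurable M" and le: "\<And>x. x \<in> space M \<Longrightarrow> norm (f x) \<le> g x"
  shows "integrable M f" "norm (integral\<^sup>L M f) \<le> integral\<^sup>L M g"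
proof -
  show i: "integrable M f"
    by (rule Bochner_Integration.integrable_bound[OF g f]) (use le in \<open>force intro!: AE_I2\<close>)
  have "norm (integral\<^sup>L M f) \<le> (\<integral>x. norm (f x) \<partial>M)" by (rule integral_norm_bound)
  also have "\<dots> \<le> integral\<^sup>L M g" using i g le by (intro integral_mono) auto
  finally show "norm (integral\<^sup>L M f) \<le> integral\<^sup>L M g" .
qed

lemma power_div_fact_le_exp:
  fixes a :: real
  assumes "a \<ge> 0"
  shows "a ^ n / fact n \<le> exp a" "(\<Sum>i<n. a ^ i / fact i) \<le> exp a"
proof -
  have s: "(\<lambda>i. a ^ i / fact i) sums exp a" using exp_converges[of a] by (simp add: field_simps)
  have *: "(\<Sum>i\<in>I. a ^ i / fact i) \<le> exp a" if "finite I" for I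
    using sum_le_suminf[OF sums_summable[OF s] that] assms sums_unique[OF s] by simp
  show "(\<Sum>i<n. a ^ i / fact i) \<le> exp a" by (rule *) simp
  show "a ^ n / fact n \<le> exp a" using *[of "{n}"] by simp
qed

text \<open>The product is at most the n-th power of the largest entry. This crude substitute for
  the Hoelder inequality reduces mixed moments to moments of single functionals.\<close>

lemma prod_list_le_sum_power:
  fixes as :: "real list"
  assumes "\<And>a. a \<in> set as \<Longrightarrow> 0 \<le> a" "as \<noteq> []"
  shows "prod_list as \<le> (\<Sum>a\<leftarrow>as. a ^ length as)"
proof -
  define s where "s = Max (set as)"
  have s: "s \<in> set as" "\<And>a. a \<in> set as \<Longrightarrow> a \<le> s" using assms(2) by (auto simp: s_def)
  have "prod_list bs \<le> s ^ length bs \<and> 0 \<le> prod_list bs" if "set bs \<subseteq> set as" for bs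
    using that
  proof (induction bs)
    case (Cons b bs)
    then show ?case using s assms(1) by (auto intro!: mult_mono)
  qed simp
  then have "prod_list as \<le> s ^ length as" by simp
  also have "\<dots> \<le> (\<Sum>a\<leftarrow>as. a ^ length as)"
    using s(1) assms(1) by (intro member_le_sum_list) auto
  finally show ?thesis .
qed

text \<open>Telescoping bounds the difference by n |b - a| (|a| + |b|)^(n-1). Writing |b - a| = t y
  and using t \<le> 1, the factor t is split off and the rest is bounded by powers of |a| and y.
  With t the norm of a difference of vectors, y is the modulus of a pairing with a unit vector, so
  its moments have a bound independent of t.\<close>

lemma cmod_power_diff_le:
  fixes a b :: complex
  assumes t: "0 < t" "t \<le> 1"
  shows "cmod (b ^ n - a ^ n) \<le> n * t * 2 ^ n * (2 ^ n * cmod a ^ n + (cmod (b - a) / t) ^ n)"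
proof (cases n)
  case (Suc m)
  define R where "R = cmod a + cmod b"
  define y where "y = cmod (b - a) / t"
  have y0: "y \<ge> 0" using t by (simp add: y_def)
  have d: "cmod (b ^ Suc m - a ^ Suc m) \<le> Suc m * cmod (b - a) * R ^ m"
  proof (induction m)
    case (Suc m)
    have "b ^ Suc (Suc m) - a ^ Suc (Suc m) = b * (b ^ Suc m - a ^ Suc m) + (b - a) * a ^ Suc m"
      by (simp add: algebra_simps)
    then have "cmod (b ^ Suc (Suc m) - a ^ Suc (Suc m)) \<le> cmod b * cmod (b ^ Suc m - a ^ Suc m) + cmod (b - a) * cmod a ^ Suc m"
      by (metis norm_mult norm_power norm_triangle_ineq)
    also have "\<dots> \<le> R * (Suc m * cmod (b - a) * R ^ m) + cmod (b - a) * R ^ Suc m"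
      using Suc by (intro add_mono mult_mono power_mono) (auto simp: R_def)
    also have "\<dots> = Suc (Suc m) * cmod (b - a) * R ^ Suc m" by (simp add: algebra_simps)
    finally show ?case .
  qed simp
  have ty: "cmod (b - a) = t * y" using t by (simp add: y_def)
  have "R \<le> 2 * cmod a + y"
  proof -
    have "cmod b \<le> cmod a + cmod (b - a)" by (metis add.commute diff_add_cancel norm_triangle_ineq)
    moreover have "t * y \<le> y" using t y0 by (simp add: mult_left_le_one_le)
    ultimately show ?thesis by (simp add: R_def ty)
  qed
  then have "y * R ^ m \<le> (2 * cmod a + y) * (2 * cmod a + y) ^ m"
    using y0 by (intro mult_mono power_mono) (auto simp: R_def)
  also have "\<dots> = (2 * cmod a + y) ^ n" by (simp add: Suc)
  also have "\<dots> \<le> (2 * max (2 * cmod a) y) ^ n" using y0 by (intro power_mono) auto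
  also have "\<dots> = 2 ^ n * (max (2 * cmod a) y) ^ n" by (simp add: power_mult_distrib)
  also have "\<dots> \<le> 2 ^ n * ((2 * cmod a) ^ n + y ^ n)"
    using y0 by (intro mult_left_mono) (auto simp: max_def)
  finally have yR: "y * R ^ m \<le> 2 ^ n * (2 ^ n * cmod a ^ n + y ^ n)" by (simp add: power_mult_distrib)
  have "cmod (b ^ n - a ^ n) \<le> (n * t) * (y * R ^ m)" using d unfolding ty Suc by (simp add: mult_ac)
  also have "\<dots> \<le> (n * t) * (2 ^ n * (2 ^ n * cmod a ^ n + y ^ n))"
    using yR t by (intro mult_left_mono) auto
  finally show ?thesis by (simp add: y_def mult_ac)
qed simp

context nuclear_triple
begin

lemma nrmC_mono: "p \<le> q \<Longrightarrow> \<theta> \<in> NC \<Longrightarrow> nrmC p \<theta> \<le> nrmC q \<theta>"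
  unfolding nrmC_def NC_def by (intro real_sqrt_le_mono add_mono power_mono nrm_le) auto

lemma NC_closed [simp]:
  "0 \<in> NC" "\<theta> \<in> NC \<Longrightarrow> \<eta> \<in> NC \<Longrightarrow> \<theta> + \<eta> \<in> NC" "\<theta> \<in> NC \<Longrightarrow> \<eta> \<in> NC \<Longrightarrow> \<theta> - \<eta> \<in> NC" "\<theta> \<in> NC \<Longrightarrow> c *\<^sub>R \<theta> \<in> NC"
  by (auto simp: NC_def zero_prod_def)

lemma nrmC_scale: "\<theta> \<in> NC \<Longrightarrow> nrmC p (c *\<^sub>R \<theta>) = \<bar>c\<bar> * nrmC p \<theta>"
  unfolding nrmC_def NC_def
  by (auto simp: nrm_scale power_mult_distrib distrib_left[symmetric] real_sqrt_mult)

lemma nrmC_eq_0: "\<theta> \<in> NC \<Longrightarrow> nrmC p \<theta> = 0 \<longleftrightarrow> \<theta> = 0"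
  unfolding nrmC_def NC_def using nrm_eq_0[of _ p]
  by (auto simp: add_nonneg_eq_0_iff zero_prod_def prod_eq_iff)

lemma nrmC_real: "\<xi> \<in> N \<Longrightarrow> nrmC p (\<xi>, 0) = nrm p \<xi>"
  unfolding nrmC_def by simp

lemma nrm_le_nrmC: "\<theta> \<in> NC \<Longrightarrow> nrm p (fst \<theta>) \<le> nrmC p \<theta>" "\<theta> \<in> NC \<Longrightarrow> nrm p (snd \<theta>) \<le> nrmC p \<theta>"
  unfolding nrmC_def by (auto intro!: real_le_rsqrt)

lemma pair_real_scale: "x \<in> N' \<Longrightarrow> \<theta> \<in> NC \<Longrightarrow> pair_real x (c *\<^sub>R \<theta>) = complex_of_real c * pair_real x \<theta>"
  unfolding pair_real_def NC_def by (auto simp: N'_at_scale complex_eq_iff)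

lemma pair_real_diff: "x \<in> N' \<Longrightarrow> \<theta> \<in> NC \<Longrightarrow> \<eta> \<in> NC \<Longrightarrow> pair_real x (\<theta> - \<eta>) = pair_real x \<theta> - pair_real x \<eta>"
  unfolding pair_real_def NC_def by (auto simp: N'_linear_simps complex_eq_iff)

lemma pair_real_real: "x \<in> N' \<Longrightarrow> pair_real x (\<xi>, 0) = complex_of_real (x \<xi>)"
  by (simp add: pair_real_def complex_eq_iff)

lemma NC_openD:
  assumes "NC_open U" "0 \<in> U"
  obtains p \<epsilon> where "\<epsilon> > 0" "\<And>\<theta>. \<theta> \<in> NC \<Longrightarrow> nrmC p \<theta> < \<epsilon> \<Longrightarrow> \<theta> \<in> U"
proof -
  obtain p \<epsilon> where "\<epsilon> > 0" "\<forall>\<eta>\<in>NC. nrmC p (\<eta> - 0) < \<epsilon> \<longrightarrow> \<eta> \<in> U"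
    using assms unfolding NC_open_def by blast
  then show ?thesis using that[of \<epsilon> p] by simp
qed

end

locale analytic_measure = nuclear_triple Hs ip
  for Hs :: "nat \<Rightarrow> 'h::{real_inner, complete_space, second_countable_topology} set"
    and ip :: "nat \<Rightarrow> 'h \<Rightarrow> 'h \<Rightarrow> real" +
  fixes \<mu> :: "('h \<Rightarrow> real) measure"
  assumes analytic: "\<mu> \<in> Ma" and prob: "prob_space \<mu>"
begin

section \<open>Exponential moments and measurability\<close>

lemma space_\<mu>: "space \<mu> = N'"
proof -
  have "sets \<mu> = sets cylinder_algebra" using analytic by (simp add: Ma_def)
  then have "space \<mu> = space cylinder_algebra" by (rule sets_eq_imp_space_eq)
  then show ?thesis by (simp add: cylinder_algebra_def space_measure_of_conv)
qed

lemma measurable_eval [measurable]: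
  assumes "\<xi> \<in> N"
  shows "(\<lambda>x. x \<xi>) \<in> borel_measurable \<mu>"
proof (rule measurableI)
  fix A :: "real set" assume A: "A \<in> sets borel"
  have "{x \<in> N'. x \<xi> \<in> A} \<in> sets cylinder_algebra"
    unfolding cylinder_algebra_def using assms A by (intro in_measure_of) auto
  moreover have "(\<lambda>x. x \<xi>) -` A \<inter> space \<mu> = {x \<in> N'. x \<xi> \<in> A}" by (auto simp: space_\<mu>)
  ultimately show "(\<lambda>x. x \<xi>) -` A \<inter> space \<mu> \<in> sets \<mu>" using analytic by (simp add: Ma_def)
qed simp

lemma measurable_pair [measurable]:
  assumes "\<theta> \<in> NC"
  shows "(\<lambda>x. pair_real x \<theta>) \<in> borel_measurable \<mu>"
proof -
  have [measurable]: "fst \<theta> \<in> N" "snd \<theta> \<in> N" using assms by (auto simp: NC_def)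
  have "(\<lambda>x. complex_of_real (x (fst \<theta>)) + \<i> * complex_of_real (x (snd \<theta>))) \<in> borel_measurable \<mu>"
    by measurable
  then show ?thesis by (simp add: pair_real_def Complex_eq)
qed

text \<open>On real arguments the Laplace transform is the integral of a positive function, so its
  local boundedness is a bound on exponential moments.\<close>

lemma real_exponential_moments:
  "\<exists>p \<epsilon> B. \<epsilon> > 0 \<and> (\<forall>\<xi>\<in>N. nrm p \<xi> < \<epsilon> \<longrightarrow> integrable \<mu> (\<lambda>x. exp (x \<xi>)) \<and> (\<integral>x. exp (x \<xi>) \<partial>\<mu>) \<le> B)"
proof -
  obtain U where U: "NC_open U" "0 \<in> U" "\<And>\<theta>. \<theta> \<in> U \<Longrightarrow> integrable \<mu> (\<lambda>x. exp (pair_real x \<theta>))"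
    "NC_holomorphic_on (laplace \<mu>) U"
    using analytic unfolding Ma_def by blast
  obtain V where V: "NC_open V" "0 \<in> V" "bounded (laplace \<mu> ` (U \<inter> V))"
    using U(2,4) unfolding NC_holomorphic_on_def by blast
  obtain B where B: "\<And>\<theta>. \<theta> \<in> U \<inter> V \<Longrightarrow> cmod (laplace \<mu> \<theta>) \<le> B"
    using V(3) unfolding bounded_iff by blast
  obtain p1 e1 where 1: "e1 > 0" "\<And>\<theta>. \<theta> \<in> NC \<Longrightarrow> nrmC p1 \<theta> < e1 \<Longrightarrow> \<theta> \<in> U" using NC_openD[OF U(1,2)] by blast
  obtain p2 e2 where 2: "e2 > 0" "\<And>\<theta>. \<theta> \<in> NC \<Longrightarrow> nrmC p2 \<theta> < e2 \<Longrightarrow> \<theta> \<in> V" using NC_openD[OF V(1,2)] by blast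
  have "integrable \<mu> (\<lambda>x. exp (x \<xi>)) \<and> (\<integral>x. exp (x \<xi>) \<partial>\<mu>) \<le> B"
    if \<xi>: "\<xi> \<in> N" "nrm (max p1 p2) \<xi> < min e1 e2" for \<xi>
  proof -
    have NC: "(\<xi>, 0) \<in> NC" using \<xi> by (simp add: NC_I)
    have "nrm p1 \<xi> < e1" "nrm p2 \<xi> < e2"
      using nrm_le[of p1 "max p1 p2" \<xi>] nrm_le[of p2 "max p1 p2" \<xi>] \<xi> by auto
    then have m: "(\<xi>, 0) \<in> U" "(\<xi>, 0) \<in> V" using 1(2)[OF NC] 2(2)[OF NC] \<xi> by (auto simp: nrmC_real)
    have eq: "exp (pair_real x (\<xi>, 0)) = complex_of_real (exp (x \<xi>))" if "x \<in> space \<mu>" for x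
      using that by (simp add: space_\<mu> pair_real_real exp_of_real)
    have "integrable \<mu> (\<lambda>x. exp (pair_real x (\<xi>, 0))) = integrable \<mu> (\<lambda>x. complex_of_real (exp (x \<xi>)))"
      by (rule Bochner_Integration.integrable_cong[OF refl eq])
    then have "integrable \<mu> (\<lambda>x. complex_of_real (exp (x \<xi>)))" using U(3)[OF m(1)] by simp
    then have i: "integrable \<mu> (\<lambda>x. exp (x \<xi>))" by (simp add: complex_of_real_integrable_eq)
    have "laplace \<mu> (\<xi>, 0) = complex_of_real (\<integral>x. exp (x \<xi>) \<partial>\<mu>)"
      unfolding laplace_def integral_complex_of_real[symmetric]
      by (rule Bochner_Integration.integral_cong[OF refl eq])
    moreover have "cmod (laplace \<mu> (\<xi>, 0)) \<le> B" using B m by blast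
    ultimately have "(\<integral>x. exp (x \<xi>) \<partial>\<mu>) \<le> B" by simp
    then show ?thesis using i by blast
  qed
  moreover have "min e1 e2 > 0" using 1 2 by simp
  ultimately show ?thesis by blast
qed

text \<open>The integrand is dominated by four real exponentials: |a| + |b| \<le> max (2|a|) (2|b|),
  and exp (2|t|) \<le> exp (2t) + exp (-2t). Doubling the arguments halves the radius, and the four
  terms give 4 B.\<close>

lemma exponential_moments:
  "\<exists>p \<delta> A. \<delta> > 0 \<and> (\<forall>\<theta>\<in>NC. nrmC p \<theta> < \<delta> \<longrightarrow>
     integrable \<mu> (\<lambda>x. exp (cmod (pair_real x \<theta>))) \<and> (\<integral>x. exp (cmod (pair_real x \<theta>)) \<partial>\<mu>) \<le> A)"
proof -
  obtain p \<epsilon> B where e: "\<epsilon> > 0" and B': "\<forall>\<xi>\<in>N. nrm p \<xi> < \<epsilon> \<longrightarrow> integrable \<mu> (\<lambda>x. exp (x \<xi>)) \<and> (\<integral>x. exp (x \<xi>) \<partial>\<mu>) \<le> B"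
    using real_exponential_moments by blast
  note B = B'[rule_format]
  have *: "integrable \<mu> (\<lambda>x. exp (cmod (pair_real x \<theta>))) \<and> (\<integral>x. exp (cmod (pair_real x \<theta>)) \<partial>\<mu>) \<le> 4 * B"
    if \<theta>: "\<theta> \<in> NC" "nrmC p \<theta> < \<epsilon> / 2" for \<theta>
  proof -
    let ?a = "fst \<theta>" and ?b = "snd \<theta>"
    have N: "?a \<in> N" "?b \<in> N" using \<theta> by (auto simp: NC_def)
    have small: "nrm p (c *\<^sub>R ?a) < \<epsilon>" "nrm p (c *\<^sub>R ?b) < \<epsilon>" if "\<bar>c\<bar> = 2" for c
      using nrm_le_nrmC[OF \<theta>(1), of p] \<theta>(2) N that by (simp_all add: nrm_scale)
    let ?g = "\<lambda>x. (exp (x (2 *\<^sub>R ?a)) + exp (x ((-2) *\<^sub>R ?a))) + (exp (x (2 *\<^sub>R ?b)) + exp (x ((-2) *\<^sub>R ?b)))"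
    note BB = B[OF N_closed(4)[OF N(1)] small(1)[of 2]] B[OF N_closed(4)[OF N(1)] small(1)[of "-2"]]
      B[OF N_closed(4)[OF N(2)] small(2)[of 2]] B[OF N_closed(4)[OF N(2)] small(2)[of "-2"]]
    have gi: "integrable \<mu> ?g" using BB by (intro Bochner_Integration.integrable_add) auto
    have gB: "integral\<^sup>L \<mu> ?g \<le> 4 * B" using BB by simp
    have le: "norm (exp (cmod (pair_real x \<theta>))) \<le> ?g x" if "x \<in> space \<mu>" for x
    proof -
      have x: "x \<in> N'" using that by (simp add: space_\<mu>)
      have ab: "exp (2 * \<bar>t\<bar>) \<le> exp (2 * t) + exp (- (2 * t))" for t :: real
        by (cases "t \<ge> 0") (auto simp: abs_if)
      have "cmod (pair_real x \<theta>) \<le> \<bar>x ?a\<bar> + \<bar>x ?b\<bar>" unfolding pair_real_def using cmod_le[of "Complex (x ?a) (x ?b)"] by simp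
      also have "\<dots> \<le> max (2 * \<bar>x ?a\<bar>) (2 * \<bar>x ?b\<bar>)" by auto
      finally have "exp (cmod (pair_real x \<theta>)) \<le> exp (max (2 * \<bar>x ?a\<bar>) (2 * \<bar>x ?b\<bar>))" by simp
      also have "\<dots> \<le> exp (2 * \<bar>x ?a\<bar>) + exp (2 * \<bar>x ?b\<bar>)" by (auto simp: max_def)
      also have "\<dots> \<le> ?g x"
        unfolding N'_at_scale[OF x N(1)] N'_at_scale[OF x N(2)] using ab[of "x ?a"] ab[of "x ?b"] by simp
      finally show ?thesis by simp
    qed
    have m: "(\<lambda>x. exp (cmod (pair_real x \<theta>))) \<in> borel_measurable \<mu>" using \<theta>(1) by measurable
    show ?thesis using dominated_integral[OF gi m le] gB by simp
  qed
  have "\<epsilon> / 2 > 0" using e by simp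
  then show ?thesis using * by blast
qed

context
  fixes p :: nat and \<delta> A :: real
  assumes \<delta>: "\<delta> > 0"
    and exp_int: "\<And>\<theta>. \<theta> \<in> NC \<Longrightarrow> nrmC p \<theta> < \<delta> \<Longrightarrow> integrable \<mu> (\<lambda>x. exp (cmod (pair_real x \<theta>)))"
    and exp_le: "\<And>\<theta>. \<theta> \<in> NC \<Longrightarrow> nrmC p \<theta> < \<delta> \<Longrightarrow> (\<integral>x. exp (cmod (pair_real x \<theta>)) \<partial>\<mu>) \<le> A"
begin

text \<open>Comes from a^n \<le> n! exp a with \<theta> scaled to length \<delta> / 2. The summand 1
  gives positivity and covers \<theta> = 0 with n = 0.\<close>

definition moment_const :: "nat \<Rightarrow> real" where
  "moment_const n = fact n * \<bar>A\<bar> * (2 / \<delta>) ^ n + 1"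

lemma moment_const_pos: "moment_const n > 0"
  unfolding moment_const_def using \<delta> by (intro add_nonneg_pos) auto

lemma moment_bound:
  assumes \<theta>: "\<theta> \<in> NC"
  shows "integrable \<mu> (\<lambda>x. cmod (pair_real x \<theta>) ^ n)"
    and "(\<integral>x. cmod (pair_real x \<theta>) ^ n \<partial>\<mu>) \<le> moment_const n * nrmC p \<theta> ^ n"
proof -
  interpret prob_space \<mu> by (rule prob)
  have m: "(\<lambda>x. cmod (pair_real x \<theta>) ^ n) \<in> borel_measurable \<mu>" using \<theta> by measurable
  have "integrable \<mu> (\<lambda>x. cmod (pair_real x \<theta>) ^ n) \<and>
    (\<integral>x. cmod (pair_real x \<theta>) ^ n \<partial>\<mu>) \<le> moment_const n * nrmC p \<theta> ^ n"
  proof (cases "nrmC p \<theta> = 0")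
    case True
    then have "\<theta> = 0" using nrmC_eq_0[OF \<theta>] by simp
    have "integrable \<mu> (\<lambda>x. (0::real) ^ n)" by simp
    moreover have "norm (cmod (pair_real x \<theta>) ^ n) \<le> 0 ^ n" if "x \<in> space \<mu>" for x
    proof -
      have "pair_real x \<theta> = 0" using that \<open>\<theta> = 0\<close> by (simp add: space_\<mu> pair_real_def complex_eq_iff)
      then show ?thesis by simp
    qed
    ultimately have "integrable \<mu> (\<lambda>x. cmod (pair_real x \<theta>) ^ n) \<and> norm (\<integral>x. cmod (pair_real x \<theta>) ^ n \<partial>\<mu>) \<le> 0 ^ n"
      using dominated_integral[of \<mu> "\<lambda>x. 0 ^ n" "\<lambda>x. cmod (pair_real x \<theta>) ^ n"] m by (simp add: prob_space)
    moreover have "(0::real) ^ n \<le> moment_const n * 0 ^ n"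
      unfolding moment_const_def using \<delta> by (cases n) auto
    ultimately show ?thesis using True by auto
  next
    case False
    define t where "t = nrmC p \<theta>"
    have t: "t > 0" using False nrmC_nonneg[of p \<theta>] unfolding t_def by linarith
    define \<eta> where "\<eta> = (\<delta> / (2 * t)) *\<^sub>R \<theta>"
    have \<eta>: "\<eta> \<in> NC" "nrmC p \<eta> < \<delta>" using \<theta> t \<delta> by (simp_all add: \<eta>_def nrmC_scale t_def[symmetric])
    let ?c = "(2 * t / \<delta>) ^ n * fact n"
    have c0: "?c \<ge> 0" using t \<delta> by simp
    have le: "norm (cmod (pair_real x \<theta>) ^ n) \<le> ?c * exp (cmod (pair_real x \<eta>))" if "x \<in> space \<mu>" for x
    proof -
      have "pair_real x \<eta> = complex_of_real (\<delta> / (2 * t)) * pair_real x \<theta>"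
        unfolding \<eta>_def using that \<theta> pair_real_scale[of x \<theta>] by (simp add: space_\<mu>)
      then have "cmod (pair_real x \<eta>) = \<delta> / (2 * t) * cmod (pair_real x \<theta>)"
        using t \<delta> by (simp add: norm_mult norm_divide)
      then have "cmod (pair_real x \<theta>) = 2 * t / \<delta> * cmod (pair_real x \<eta>)" using t \<delta> by (simp add: field_simps)
      then have "cmod (pair_real x \<theta>) ^ n = ?c * (cmod (pair_real x \<eta>) ^ n / fact n)"
        by (simp add: power_mult_distrib power_divide)
      also have "\<dots> \<le> ?c * exp (cmod (pair_real x \<eta>))"
        using power_div_fact_le_exp(1)[of "cmod (pair_real x \<eta>)" n] c0 by (intro mult_left_mono) auto
      finally show ?thesis by simp
    qed
    have gi: "integrable \<mu> (\<lambda>x. ?c * exp (cmod (pair_real x \<eta>)))" using exp_int[OF \<eta>] by simp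
    have "norm (\<integral>x. cmod (pair_real x \<theta>) ^ n \<partial>\<mu>) \<le> (\<integral>x. ?c * exp (cmod (pair_real x \<eta>)) \<partial>\<mu>)"
      by (rule dominated_integral(2)[OF gi m le])
    also have "\<dots> \<le> ?c * \<bar>A\<bar>" using exp_le[OF \<eta>] c0 by (simp add: mult_left_mono order_trans[OF _ abs_ge_self])
    also have "\<dots> \<le> moment_const n * t ^ n"
      unfolding moment_const_def using t by (simp add: power_divide power_mult_distrib field_simps)
    finally show ?thesis using dominated_integral(1)[OF gi m le] by (simp add: t_def)
  qed
  then show "integrable \<mu> (\<lambda>x. cmod (pair_real x \<theta>) ^ n)"
    and "(\<integral>x. cmod (pair_real x \<theta>) ^ n \<partial>\<mu>) \<le> moment_const n * nrmC p \<theta> ^ n" by blast+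
qed

lemma integrable_power:
  assumes \<theta>: "\<theta> \<in> NC"
  shows "integrable \<mu> (\<lambda>x. pair_real x \<theta> ^ n)"
proof -
  have "(\<lambda>x. pair_real x \<theta> ^ n) \<in> borel_measurable \<mu>" using \<theta> by measurable
  then show ?thesis by (rule dominated_integral(1)[OF moment_bound(1)[OF \<theta>, of n]]) (simp add: norm_power)
qed

text \<open>Each vector is scaled to unit length, which is possible because it is nonzero, and the
  product of the pairings is bounded by the sum of their n-th powers. The final 1 in the constant
  accounts for the empty product.\<close>

lemma product_moment_bound:
  assumes es: "set es \<subseteq> N" "0 \<notin> set es"
  defines "n \<equiv> length es"
  shows "integrable \<mu> (\<lambda>x. prod_list (map x es))"
    and "\<bar>\<integral>x. prod_list (map x es) \<partial>\<mu>\<bar> \<le> (n * moment_const n + 1) * prod_list (map (nrm p) es)"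
proof -
  interpret prob_space \<mu> by (rule prob)
  define s where "s e = (1 / nrm p e) *\<^sub>R e" for e
  define P where "P = prod_list (map (nrm p) es)"
  have np: "nrm p e > 0" if "e \<in> set es" for e
  proof -
    have "e \<in> N" "e \<noteq> 0" using es that by auto
    then have "nrm p e \<noteq> 0" "nrm p e \<ge> 0" by (simp_all add: nrm_eq_0)
    then show ?thesis by simp
  qed
  have sN: "s e \<in> N" if "e \<in> set es" for e using that es by (auto simp: s_def)
  have s1: "nrmC p (s e, 0) = 1" if "e \<in> set es" for e
    using sN[OF that] np[OF that] that es by (auto simp: nrmC_real s_def nrm_scale)
  have P0: "P \<ge> 0" unfolding P_def using np by (intro prod_list_nonneg) (auto intro: less_imp_le)
  have m: "(\<lambda>x. prod_list (map x es)) \<in> borel_measurable \<mu>" using es(1)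
  proof (induction es)
    case (Cons e es)
    then have "(\<lambda>x. x e) \<in> borel_measurable \<mu>" "(\<lambda>x. prod_list (map x es)) \<in> borel_measurable \<mu>" by auto
    then show ?case by simp
  qed simp
  let ?g = "\<lambda>x. P * ((\<Sum>e\<leftarrow>es. cmod (pair_real x (s e, 0)) ^ n) + 1)"
  have si: "integrable \<mu> (\<lambda>x. \<Sum>e\<leftarrow>fs. cmod (pair_real x (s e, 0)) ^ n) \<and>
      (\<integral>x. (\<Sum>e\<leftarrow>fs. cmod (pair_real x (s e, 0)) ^ n) \<partial>\<mu>) \<le> length fs * moment_const n" if "set fs \<subseteq> set es" for fs
    using that
  proof (induction fs)
    case (Cons f fs)
    have f: "(s f, 0) \<in> NC" "nrmC p (s f, 0) = 1" using Cons sN s1 by (auto simp: NC_I)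
    show ?case using Cons moment_bound[OF f(1), of n] f(2) by (simp add: algebra_simps)
  qed simp
  have gi: "integrable \<mu> ?g" using si[of es] by simp
  have le: "norm (prod_list (map x es)) \<le> ?g x" if "x \<in> space \<mu>" for x
  proof (cases "es = []")
    case True
    then show ?thesis by (simp add: P_def)
  next
    case False
    have x: "x \<in> N'" using that by (simp add: space_\<mu>)
    have "norm (prod_list (map x fs)) = prod_list (map (nrm p) fs) * prod_list (map (\<lambda>e. cmod (pair_real x (s e, 0))) fs)"
      if "set fs \<subseteq> set es" for fs
      using that
    proof (induction fs)
      case (Cons f fs)
      have "x f = nrm p f * x (s f)"
        unfolding s_def using np[of f] x es Cons.prems by (simp add: N'_at_scale subsetD)
      then have "\<bar>x f\<bar> = nrm p f * cmod (pair_real x (s f, 0))"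
        using np[of f] x Cons.prems by (simp add: pair_real_real abs_mult)
      then show ?case using Cons by (simp add: abs_mult mult_ac)
    qed simp
    then have "norm (prod_list (map x es)) = P * prod_list (map (\<lambda>e. cmod (pair_real x (s e, 0))) es)"
      by (simp add: P_def)
    also have "\<dots> \<le> P * (\<Sum>e\<leftarrow>es. cmod (pair_real x (s e, 0)) ^ n)"
    proof (rule mult_left_mono[OF _ P0])
      have "prod_list (map (\<lambda>e. cmod (pair_real x (s e, 0))) es) \<le>
          (\<Sum>a\<leftarrow>map (\<lambda>e. cmod (pair_real x (s e, 0))) es. a ^ length (map (\<lambda>e. cmod (pair_real x (s e, 0))) es))"
        using False by (intro prod_list_le_sum_power) auto
      then show "prod_list (map (\<lambda>e. cmod (pair_real x (s e, 0))) es) \<le> (\<Sum>e\<leftarrow>es. cmod (pair_real x (s e, 0)) ^ n)"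
        by (simp add: n_def comp_def)
    qed
    also have "\<dots> \<le> ?g x" using P0 by (simp add: mult_left_mono)
    finally show ?thesis .
  qed
  show "integrable \<mu> (\<lambda>x. prod_list (map x es))" by (rule dominated_integral(1)[OF gi m le])
  have "\<bar>\<integral>x. prod_list (map x es) \<partial>\<mu>\<bar> \<le> integral\<^sup>L \<mu> ?g" using dominated_integral(2)[OF gi m le] by simp
  also have "\<dots> = P * ((\<integral>x. (\<Sum>e\<leftarrow>es. cmod (pair_real x (s e, 0)) ^ n) \<partial>\<mu>) + 1)"
    using si[of es] by (simp add: prob_space)
  also have "\<dots> \<le> P * (n * moment_const n + 1)"
    using si[of es] P0 by (intro mult_left_mono) (auto simp: n_def)
  finally show "\<bar>\<integral>x. prod_list (map x es) \<partial>\<mu>\<bar> \<le> (n * moment_const n + 1) * prod_list (map (nrm p) es)"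
    by (simp add: P_def mult.commute)
qed

text \<open>In \<open>cmod_power_diff_le\<close> the parameter t is the norm of
  \<open>\<eta> k - \<theta>\<close>: the n-th absolute moment of the difference divided by t is
  then at most \<open>moment_const n\<close>, so the moments differ by at most a fixed multiple of
  t.\<close>

lemma moment_continuous:
  assumes \<theta>: "\<theta> \<in> NC" and \<eta>: "\<And>k::nat. \<eta> k \<in> NC" and lim: "(\<lambda>k. nrmC p (\<eta> k - \<theta>)) \<longlonglongrightarrow> 0"
  shows "(\<lambda>k. \<integral>x. pair_real x (\<eta> k) ^ n \<partial>\<mu>) \<longlonglongrightarrow> (\<integral>x. pair_real x \<theta> ^ n \<partial>\<mu>)"
proof -
  let ?t = "\<lambda>k. nrmC p (\<eta> k - \<theta>)"
  let ?D = "n * 2 ^ n * (2 ^ n * (moment_const n * nrmC p \<theta> ^ n) + moment_const n)"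
  have "(\<lambda>k. (\<integral>x. pair_real x (\<eta> k) ^ n \<partial>\<mu>) - (\<integral>x. pair_real x \<theta> ^ n \<partial>\<mu>)) \<longlonglongrightarrow> 0"
  proof (rule Lim_null_comparison)
    show "(\<lambda>k. ?D * ?t k) \<longlonglongrightarrow> 0" using tendsto_mult_right_zero[OF lim] by blast
    have "\<forall>\<^sub>F k in sequentially. ?t k < 1" using order_tendstoD(2)[OF lim] by simp
    then show "\<forall>\<^sub>F k in sequentially. norm ((\<integral>x. pair_real x (\<eta> k) ^ n \<partial>\<mu>) - (\<integral>x. pair_real x \<theta> ^ n \<partial>\<mu>)) \<le> ?D * ?t k"
    proof eventually_elim
      case (elim k)
      define t where "t = ?t k"
      have dNC: "\<eta> k - \<theta> \<in> NC" using \<eta> \<theta> by simp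
      show ?case
      proof (cases "t = 0")
        case True
        then have "\<eta> k = \<theta>" using nrmC_eq_0[OF dNC] by (simp add: t_def)
        then show ?thesis using True by (simp add: t_def)
      next
        case False
        then have t: "t > 0" "t \<le> 1" using nrmC_nonneg[of p "\<eta> k - \<theta>"] elim by (auto simp: t_def less_le)
        let ?g = "\<lambda>x. (n * t * 2 ^ n) * (2 ^ n * cmod (pair_real x \<theta>) ^ n + (1 / t) ^ n * cmod (pair_real x (\<eta> k - \<theta>)) ^ n)"
        have gi: "integrable \<mu> ?g" using moment_bound(1)[OF \<theta>] moment_bound(1)[OF dNC] by simp
        have m: "(\<lambda>x. pair_real x (\<eta> k) ^ n - pair_real x \<theta> ^ n) \<in> borel_measurable \<mu>"
          using \<theta> \<eta>[of k] by measurable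
        have le: "norm (pair_real x (\<eta> k) ^ n - pair_real x \<theta> ^ n) \<le> ?g x" if "x \<in> space \<mu>" for x
          using cmod_power_diff_le[OF t, of "pair_real x (\<eta> k)" n "pair_real x \<theta>"] that \<theta> \<eta>[of k]
          by (simp add: space_\<mu> pair_real_diff power_divide)
        have "norm ((\<integral>x. pair_real x (\<eta> k) ^ n \<partial>\<mu>) - (\<integral>x. pair_real x \<theta> ^ n \<partial>\<mu>)) \<le> integral\<^sup>L \<mu> ?g"
          using dominated_integral(2)[OF gi m le] integrable_power[OF \<theta>] integrable_power[OF \<eta>] by simp
        also have "\<dots> = (n * t * 2 ^ n) * (2 ^ n * (\<integral>x. cmod (pair_real x \<theta>) ^ n \<partial>\<mu>) +
            (1 / t) ^ n * (\<integral>x. cmod (pair_real x (\<eta> k - \<theta>)) ^ n \<partial>\<mu>))"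
          using moment_bound(1)[OF \<theta>] moment_bound(1)[OF dNC] by simp
        also have "\<dots> \<le> (n * t * 2 ^ n) * (2 ^ n * (moment_const n * nrmC p \<theta> ^ n) + (1 / t) ^ n * (moment_const n * t ^ n))"
          using moment_bound(2)[OF \<theta>, of n] moment_bound(2)[OF dNC, of n] t
          by (intro mult_left_mono add_mono) (auto simp: t_def)
        also have "\<dots> = ?D * t" using t by (simp add: power_divide algebra_simps)
        finally show ?thesis by (simp add: t_def)
      qed
    qed
  qed
  then show ?thesis by (simp add: LIM_zero_iff)
qed

text \<open>The coefficients are the mixed moments on the basis of \<open>Hs q\<close>, square
  summable because the embedding into \<open>Hs p\<close> is Hilbert-Schmidt; q is the same for all
  n. On a power of \<theta> the truncated series is exactly the moment of the projection
  \<open>\<eta> k\<close> of \<theta>, which converges by \<open>moment_continuous\<close>.\<close>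

lemma moment_functional:
  "\<exists>q M. (\<forall>n. M n \<in> tens_neg q n) \<and> (\<forall>n. \<forall>\<theta>\<in>NC. M n (tpow \<theta> n) = (\<integral>x. pair_real x \<theta> ^ n \<partial>\<mu>))"
proof -
  obtain q where q: "p < q" "hilbert_schmidt_embedding q p" using nuclear[of p] by blast
  then have pq: "p \<le> q" by simp
  obtain c where c: "c \<ge> 0" "\<And>M. (\<Sum>e\<in>bas q M. (nrm p e)\<^sup>2) \<le> c"
    using hilbert_schmidt_bas_bounded[OF q(2) pq] by blast
  define m where "m es = complex_of_real (\<integral>x. prod_list (map x es) \<partial>\<mu>)" for es
  have es: "set es \<subseteq> N" "0 \<notin> set es" "length es = n" if "es \<in> tuples (bas q k) n" for es k n
  proof -
    show "set es \<subseteq> N" "length es = n" using that by auto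
    have "0 \<notin> bas q k"
    proof
      assume "0 \<in> bas q k"
      then have "ip q 0 0 = 1" using bas_on[of q k] unfolding H.on_def by metis
      then show False by simp
    qed
    then show "0 \<notin> set es" using that by auto
  qed
  have mb: "cmod (m es) \<le> (n * moment_const n + 1) * prod_list (map (nrm p) es)" if "es \<in> tuples (bas q k) n" for es k n
    using product_moment_bound(2)[OF es(1,2)[OF that]] es(3)[OF that] by (simp add: m_def)
  define T where "T n = (n * moment_const n + 1) * sqrt c ^ n" for n
  have T0: "T n \<ge> 0" for n unfolding T_def using c moment_const_pos[of n] by simp
  have TT: "(\<Sum>es\<in>tuples (bas q k) n. (cmod (m es))\<^sup>2) \<le> (T n)\<^sup>2" for k n
  proof -
    have "(sqrt c ^ n)\<^sup>2 = ((sqrt c)\<^sup>2) ^ n" by (simp only: power_mult[symmetric] mult.commute)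
    then have "(sqrt c ^ n)\<^sup>2 = c ^ n" using c by simp
    moreover have "(\<Sum>es\<in>tuples (bas q k) n. (cmod (m es))\<^sup>2) \<le> (n * moment_const n + 1)\<^sup>2 * c ^ n"
      by (rule kernel_square_sum_le[OF _ c(2)]) (rule mb)
    ultimately show ?thesis by (simp add: T_def power_mult_distrib)
  qed
  show ?thesis
  proof (intro exI[of _ q] exI[of _ "\<lambda>n. series_functional q n m"] conjI allI ballI)
    show "series_functional q n m \<in> tens_neg q n" for n
      by (rule series_functional_tens_neg[OF T0 TT])
    fix n \<theta> assume \<theta>: "\<theta> \<in> NC"
    have \<theta>N: "fst \<theta> \<in> N" "snd \<theta> \<in> N" using \<theta> by (auto simp: NC_def)
    define \<eta> where "\<eta> k = (H.prj q (bas q k) (fst \<theta>), H.prj q (bas q k) (snd \<theta>))" for k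
    have \<eta>: "\<eta> k \<in> NC" for k unfolding \<eta>_def by (intro NC_I) (simp_all add: H.prj_def)
    \<comment> \<open>Summing products over all tuples gives the n-th power of a single sum, and
      that sum is the pairing with \<open>\<eta> k\<close>.\<close>
    have part: "(\<Sum>es\<in>tuples (bas q k) n. m es * tpow \<theta> n (map (riesz q) es)) = (\<integral>x. pair_real x (\<eta> k) ^ n \<partial>\<mu>)" for k
    proof -
      let ?r = "\<lambda>e. pair_real (riesz q e) \<theta>"
      have "(\<Sum>es\<in>tuples (bas q k) n. m es * tpow \<theta> n (map (riesz q) es)) =
          (\<Sum>es\<in>tuples (bas q k) n. \<integral>x. complex_of_real (prod_list (map x es)) * prod_list (map ?r es) \<partial>\<mu>)"
      proof (intro sum.cong refl)
        fix es assume e: "es \<in> tuples (bas q k) n"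
        have "set (map (riesz q) es) \<subseteq> N'" using es(1)[OF e] by auto
        then have "tpow \<theta> n (map (riesz q) es) = prod_list (map ?r es)"
          using es(3)[OF e] by (simp add: tpow_def comp_def)
        then show "m es * tpow \<theta> n (map (riesz q) es) = (\<integral>x. complex_of_real (prod_list (map x es)) * prod_list (map ?r es) \<partial>\<mu>)"
          by (simp add: m_def)
      qed
      also have "\<dots> = (\<integral>x. (\<Sum>es\<in>tuples (bas q k) n. complex_of_real (prod_list (map x es)) * prod_list (map ?r es)) \<partial>\<mu>)"
        using product_moment_bound(1)[OF es(1,2)]
        by (intro Bochner_Integration.integral_sum[symmetric] integrable_mult_left integrable_of_real)
      also have "\<dots> = (\<integral>x. pair_real x (\<eta> k) ^ n \<partial>\<mu>)"
      proof (rule Bochner_Integration.integral_cong[OF refl])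
        fix x assume "x \<in> space \<mu>"
        then have x: "x \<in> N'" by (simp add: space_\<mu>)
        have pm: "complex_of_real (prod_list (map x es)) * prod_list (map ?r es) = prod_list (map (\<lambda>e. complex_of_real (x e) * ?r e) es)" for es
          by (induction es) (simp_all add: mult_ac)
        have "(\<Sum>e\<in>bas q k. complex_of_real (x e) * ?r e) = pair_real x (\<eta> k)"
          unfolding \<eta>_def H.prj_def pair_real_def riesz_def using x \<theta>N
          by (simp add: N'_at_sum N'_at_scale complex_eq_iff mult.commute)
        then show "(\<Sum>es\<in>tuples (bas q k) n. complex_of_real (prod_list (map x es)) * prod_list (map ?r es)) = pair_real x (\<eta> k) ^ n"
          unfolding pm sum_prod_list_tuples by simp
      qed
      finally show ?thesis .
    qed
    have "(\<lambda>k. nrmC p (\<eta> k - \<theta>)) \<longlonglongrightarrow> 0"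
    proof (rule Lim_null_comparison)
      have mc: "nrm q (\<xi> - H.prj q (bas q k) \<xi>) = nrm q (H.prj q (bas q k) \<xi> - \<xi>)" if "\<xi> \<in> N" for \<xi> k
        using H.nm_minus_commute[of \<xi> q "H.prj q (bas q k) \<xi>"] that by (simp add: nrm_eq H.prj_def)
      show "\<forall>\<^sub>F k in sequentially. norm (nrmC p (\<eta> k - \<theta>)) \<le> nrmC q (\<eta> k - \<theta>)"
        using nrmC_mono[OF pq] \<eta> \<theta> by (intro always_eventually) simp
      have "(\<lambda>k. nrmC q (\<eta> k - \<theta>)) \<longlonglongrightarrow> sqrt (0\<^sup>2 + 0\<^sup>2)"
        unfolding nrmC_def \<eta>_def using bas_lim[OF \<theta>N(1), of q] bas_lim[OF \<theta>N(2), of q]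
        by (intro tendsto_intros) (simp_all add: mc \<theta>N)
      then show "(\<lambda>k. nrmC q (\<eta> k - \<theta>)) \<longlonglongrightarrow> 0" by simp
    qed
    then have "(\<lambda>k. \<integral>x. pair_real x (\<eta> k) ^ n \<partial>\<mu>) \<longlonglongrightarrow> (\<integral>x. pair_real x \<theta> ^ n \<partial>\<mu>)"
      by (rule moment_continuous[OF \<theta> \<eta>])
    moreover have "(\<lambda>k. \<integral>x. pair_real x (\<eta> k) ^ n \<partial>\<mu>) \<longlonglongrightarrow> series_functional q n m (tpow \<theta> n)"
      using series_limit[OF T0[of n] TT tpow_tens[OF \<theta>, of n]] by (simp add: part)
    ultimately show "series_functional q n m (tpow \<theta> n) = (\<integral>x. pair_real x \<theta> ^ n \<partial>\<mu>)"
      using LIMSEQ_unique by blast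
  qed
qed

text \<open>The exponential series is integrated term by term: the integrals of the absolute terms
  have partial sums at most A, since the integrands sum to less than
  \<open>exp (cmod (pair_real x \<theta>))\<close> or that value. Each single term is therefore at
  most A as well.\<close>

lemma laplace_sums:
  assumes \<theta>: "\<theta> \<in> NC" "nrmC p \<theta> < \<delta>"
  shows "(\<lambda>n. (\<integral>x. pair_real x \<theta> ^ n \<partial>\<mu>) / fact n) sums laplace \<mu> \<theta>"
    and "cmod ((\<integral>x. pair_real x \<theta> ^ n \<partial>\<mu>) / fact n) \<le> A"
proof -
  let ?f = "\<lambda>n x. pair_real x \<theta> ^ n / fact n"
  have nf: "cmod (?f n x) = cmod (pair_real x \<theta>) ^ n / fact n" for n x by (simp add: norm_divide norm_power)
  have i: "integrable \<mu> (?f n)" for n using integrable_power[OF \<theta>(1)] by simp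
  have ex: "(\<lambda>n. ?f n x) sums exp (pair_real x \<theta>)" for x
    using exp_converges[of "pair_real x \<theta>"] by (simp add: scaleR_conv_of_real field_simps)
  have part: "(\<Sum>n<k. \<integral>x. cmod (?f n x) \<partial>\<mu>) \<le> A" for k
  proof -
    have "(\<Sum>n<k. \<integral>x. cmod (?f n x) \<partial>\<mu>) = (\<integral>x. (\<Sum>n<k. cmod (?f n x)) \<partial>\<mu>)"
      using i by (intro Bochner_Integration.integral_sum[symmetric] integrable_norm)
    also have "\<dots> \<le> (\<integral>x. exp (cmod (pair_real x \<theta>)) \<partial>\<mu>)"
      using power_div_fact_le_exp(2) i exp_int[OF \<theta>]
      by (intro integral_mono Bochner_Integration.integrable_sum integrable_norm) (auto simp: nf)
    also have "\<dots> \<le> A" by (rule exp_le[OF \<theta>])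
    finally show ?thesis .
  qed
  have "(\<lambda>n. integral\<^sup>L \<mu> (?f n)) sums (\<integral>x. (\<Sum>n. ?f n x) \<partial>\<mu>)"
  proof (rule sums_integral[OF i])
    show "AE x in \<mu>. summable (\<lambda>n. norm (?f n x))"
    proof (rule AE_I2)
      fix x
      show "summable (\<lambda>n. norm (?f n x))"
        unfolding nf using sums_summable[OF exp_converges[of "cmod (pair_real x \<theta>)"]] by (simp add: field_simps)
    qed
    show "summable (\<lambda>n. \<integral>x. norm (?f n x) \<partial>\<mu>)"
      by (rule summableI_nonneg_bounded[of _ A]) (use part in auto)
  qed
  then show "(\<lambda>n. (\<integral>x. pair_real x \<theta> ^ n \<partial>\<mu>) / fact n) sums laplace \<mu> \<theta>"
    unfolding laplace_def using sums_unique[OF ex] by simp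
  have "cmod ((\<integral>x. pair_real x \<theta> ^ n \<partial>\<mu>) / fact n) = cmod (integral\<^sup>L \<mu> (?f n))" by simp
  also have "\<dots> \<le> (\<integral>x. cmod (?f n x) \<partial>\<mu>)" by (rule integral_norm_bound)
  also have "\<dots> \<le> (\<Sum>n<Suc n. \<integral>x. cmod (?f n x) \<partial>\<mu>)"
    by (rule member_le_sum[of n "{..<Suc n}" "\<lambda>n. \<integral>x. cmod (?f n x) \<partial>\<mu>"]) auto
  also have "\<dots> \<le> A" by (rule part)
  finally show "cmod ((\<integral>x. pair_real x \<theta> ^ n \<partial>\<mu>) / fact n) \<le> A" .
qed

end

text \<open>Division by n! turns moments into Taylor coefficients of the Laplace transform.
  Closeness to 1 near the origin keeps the transform away from 0, as the quotient in
  \<open>e_mu\<close> demands.\<close>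

lemma moment_kernel_exists:
  "\<exists>M p \<delta>. \<delta> > 0 \<and> (\<forall>n. M n \<in> tens_dual n) \<and> M 0 = unit_kernel 0 \<and>
    (\<forall>\<theta>\<in>NC. nrmC p \<theta> < \<delta> \<longrightarrow> (\<lambda>n. M n (tpow \<theta> n)) sums laplace \<mu> \<theta> \<and> cmod (laplace \<mu> \<theta> - 1) \<le> 1 / 2)"
proof -
  interpret prob_space \<mu> by (rule prob)
  obtain p \<delta> A where \<delta>: "\<delta> > 0" and e: "\<forall>\<theta>\<in>NC. nrmC p \<theta> < \<delta> \<longrightarrow>
     integrable \<mu> (\<lambda>x. exp (cmod (pair_real x \<theta>))) \<and> (\<integral>x. exp (cmod (pair_real x \<theta>)) \<partial>\<mu>) \<le> A"
    using exponential_moments by blast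
  note ei = e[rule_format, THEN conjunct1] and el = e[rule_format, THEN conjunct2]
  obtain q M where M': "\<forall>n. M n \<in> tens_neg q n" and Mv': "\<forall>n. \<forall>\<theta>\<in>NC. M n (tpow \<theta> n) = (\<integral>x. pair_real x \<theta> ^ n \<partial>\<mu>)"
    using moment_functional[OF \<delta> ei el] by blast
  note M = M'[rule_format] and Mv = Mv'[rule_format]
  define K where "K n = (\<lambda>\<phi>. (1 / fact n) * M n \<phi>)" for n
  have K: "K n \<in> tens_dual n" for n
    unfolding K_def using tens_neg_scale[OF M] tens_neg_dual by blast
  have Kv: "K n (tpow \<theta> n) = (\<integral>x. pair_real x \<theta> ^ n \<partial>\<mu>) / fact n" if "\<theta> \<in> NC" for n \<theta>
    using Mv[OF that] by (simp add: K_def)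
  have K0v: "K 0 (tpow \<theta> 0) = 1" if "\<theta> \<in> NC" for \<theta> using Kv[OF that, of 0] by (simp add: prob_space)
  have "K 0 = unit_kernel 0"
  proof (rule tens_dual_eqI[OF K unit_kernel_dual])
    fix \<theta> assume \<theta>: "\<theta> \<in> NC"
    show "K 0 (tpow \<theta> 0) = unit_kernel 0 (tpow \<theta> 0)"
      using K0v[OF \<theta>] symbol_unit[OF \<theta>] by (metis fps_one_nth symbol_nth)
  qed
  \<comment> \<open>On the ball shrunk by s the n-th term is at most |A| s^n, and the tail from n =
    1 on is at most |A| s / (1 - s), where |A| s \<le> 1/4 and 1 / (1 - s) \<le> 2.\<close>
  moreover define s where "s = 1 / (4 * (1 + \<bar>A\<bar>))"
  have s: "0 < s" "s \<le> 1 / 2" "4 * \<bar>A\<bar> * s \<le> 1" unfolding s_def by (auto simp: field_simps add_pos_nonneg)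
  have "(\<lambda>n. K n (tpow \<theta> n)) sums laplace \<mu> \<theta> \<and> cmod (laplace \<mu> \<theta> - 1) \<le> 1 / 2"
    if \<theta>: "\<theta> \<in> NC" "nrmC p \<theta> < s * \<delta>" for \<theta>
  proof -
    have "s * \<delta> \<le> \<delta>" using s \<delta> by simp
    then have th: "nrmC p \<theta> < \<delta>" using \<theta>(2) by linarith
    have sums: "(\<lambda>n. K n (tpow \<theta> n)) sums laplace \<mu> \<theta>"
      using laplace_sums(1)[OF \<delta> ei el \<theta>(1) th] Kv[OF \<theta>(1)] by simp
    define \<eta> where "\<eta> = (1 / s) *\<^sub>R \<theta>"
    have \<eta>: "\<eta> \<in> NC" "nrmC p \<eta> < \<delta>" using \<theta> s by (simp_all add: \<eta>_def nrmC_scale field_simps)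
    have \<theta>\<eta>: "\<theta> = s *\<^sub>R \<eta>" using s by (simp add: \<eta>_def)
    have bd: "cmod (K n (tpow \<theta> n)) \<le> \<bar>A\<bar> * s ^ n" for n
    proof -
      have "(\<integral>x. pair_real x \<theta> ^ n \<partial>\<mu>) = (\<integral>x. complex_of_real (s ^ n) * pair_real x \<eta> ^ n \<partial>\<mu>)"
      proof (rule Bochner_Integration.integral_cong[OF refl])
        fix x assume "x \<in> space \<mu>"
        then show "pair_real x \<theta> ^ n = complex_of_real (s ^ n) * pair_real x \<eta> ^ n"
          unfolding \<theta>\<eta> using pair_real_scale[OF _ \<eta>(1), of x s] by (simp add: space_\<mu> power_mult_distrib)
      qed
      then have "cmod (K n (tpow \<theta> n)) = s ^ n * cmod ((\<integral>x. pair_real x \<eta> ^ n \<partial>\<mu>) / fact n)"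
        using s by (simp add: Kv[OF \<theta>(1)] norm_mult norm_divide norm_power)
      also have "\<dots> \<le> s ^ n * \<bar>A\<bar>"
        using laplace_sums(2)[OF \<delta> ei el \<eta>, of n] s by (intro mult_left_mono) auto
      finally show ?thesis by (simp add: mult.commute)
    qed
    have sh: "(\<lambda>n. K (Suc n) (tpow \<theta> (Suc n))) sums (laplace \<mu> \<theta> - 1)"
      using sums K0v[OF \<theta>(1)] sums_Suc_iff[of "\<lambda>n. K n (tpow \<theta> n)" "laplace \<mu> \<theta> - 1"] by simp
    have gs: "(\<lambda>n. (\<bar>A\<bar> * s) * s ^ n) sums ((\<bar>A\<bar> * s) * (1 / (1 - s)))"
      using s by (intro sums_mult geometric_sums) auto
    have "cmod (laplace \<mu> \<theta> - 1) \<le> (\<bar>A\<bar> * s) * (1 / (1 - s))"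
      using norm_sums_le[OF sh gs] bd[of "Suc _"] by (simp add: mult_ac)
    also have "\<dots> \<le> (1 / 4) * 2" using s by (intro mult_mono) (auto simp: field_simps)
    finally show ?thesis using sums by simp
  qed
  ultimately show ?thesis using K s \<delta> by (intro exI[of _ K] exI[of _ p] exI[of _ "s * \<delta>"]) auto
qed

end

section \<open>Power series along complex lines\<close>

lemma power_series_on_ball:
  fixes a :: "nat \<Rightarrow> complex"
  assumes "r > 0" "\<And>t. t \<in> ball 0 r \<Longrightarrow> (\<lambda>n. a n * t ^ n) sums g t"
  shows "g holomorphic_on ball 0 r" "g has_fps_expansion Abs_fps a"
proof -
  show "g holomorphic_on ball 0 r" using assms(2) by (intro power_series_holomorphic[of 0 r a]) simp
  have "eventually (\<lambda>t. t \<in> ball 0 r) (nhds (0::complex))"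
    using assms(1) by (intro eventually_nhds_in_open) auto
  then have "eventually (\<lambda>t. (\<lambda>n. fps_nth (Abs_fps a) n * t ^ n) sums g t) (nhds 0)"
    by eventually_elim (use assms(2) in simp)
  then show "g has_fps_expansion Abs_fps a" by (rule has_fps_expansionI)
qed

text \<open>The terms of the series at a point r inside the radius of convergence are bounded. The
  maxima with 1 ensure that powers of the constants do not decrease with the exponent.\<close>

lemma fps_coefficients_geometric:
  fixes F :: "complex fps"
  assumes "f has_fps_expansion F"
  obtains A s where "A \<ge> 1" "s \<ge> 1" "\<And>n. cmod (fps_nth F n) \<le> A * s ^ n"
proof -
  have "fps_conv_radius F > 0" using assms by (simp add: has_fps_expansion_def)
  then obtain r where r: "0 < ereal r" "ereal r < fps_conv_radius F" using ereal_dense2 by blast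
  then have r0: "r > 0" by simp
  have "summable (\<lambda>n. fps_nth F n * of_real r ^ n)"
    using r r0 by (intro summable_fps) (simp add: fps_conv_radius_def)
  then have "(\<lambda>n. fps_nth F n * of_real r ^ n) \<longlonglongrightarrow> 0" by (rule summable_LIMSEQ_zero)
  then have "Bseq (\<lambda>n. fps_nth F n * of_real r ^ n)" by (simp add: convergentI convergent_imp_Bseq)
  then obtain B where B: "B > 0" "\<And>n. cmod (fps_nth F n * of_real r ^ n) \<le> B" by (auto elim: BseqE)
  show ?thesis
  proof (rule that[of "max 1 B" "max 1 (1 / r)"])
    fix n
    have "cmod (fps_nth F n) * r ^ n \<le> B" using B(2)[of n] r0 by (simp add: norm_mult norm_power)
    then have "cmod (fps_nth F n) \<le> B * (1 / r) ^ n" using r0 by (simp add: power_divide field_simps)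
    also have "\<dots> \<le> max 1 B * max 1 (1 / r) ^ n" using B(1) r0 by (intro mult_mono power_mono) auto
    finally show "cmod (fps_nth F n) \<le> max 1 B * max 1 (1 / r) ^ n" .
  qed simp_all
qed

context nuclear_triple
begin

section \<open>Balls and complex lines in the complexified space\<close>

lemma nrmC_triangle:
  assumes "\<theta> \<in> NC" "\<eta> \<in> NC"
  shows "nrmC p (\<theta> + \<eta>) \<le> nrmC p \<theta> + nrmC p \<eta>"
proof -
  have N: "fst \<theta> \<in> N" "snd \<theta> \<in> N" "fst \<eta> \<in> N" "snd \<eta> \<in> N" using assms by (auto simp: NC_def)
  have tri: "nrm p (\<xi> + \<zeta>) \<le> nrm p \<xi> + nrm p \<zeta>" if "\<xi> \<in> N" "\<zeta> \<in> N" for \<xi> \<zeta>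
    unfolding nrm_eq using that by (intro H.nm_triangle) auto
  have "nrmC p (\<theta> + \<eta>) \<le> sqrt ((nrm p (fst \<theta>) + nrm p (fst \<eta>))\<^sup>2 + (nrm p (snd \<theta>) + nrm p (snd \<eta>))\<^sup>2)"
    unfolding nrmC_def using N tri by (intro real_sqrt_le_mono add_mono power_mono) auto
  also have "\<dots> \<le> nrmC p \<theta> + nrmC p \<eta>"
    unfolding nrmC_def by (rule real_sqrt_sum_squares_triangle_ineq)
  finally show ?thesis .
qed

lemma NC_open_ball: "NC_open {\<theta> \<in> NC. nrmC p \<theta> < \<epsilon>}"
  unfolding NC_open_def
proof (intro conjI ballI)
  fix \<theta> assume \<theta>: "\<theta> \<in> {\<theta> \<in> NC. nrmC p \<theta> < \<epsilon>}"
  have "\<eta> \<in> {\<theta> \<in> NC. nrmC p \<theta> < \<epsilon>}" if "\<eta> \<in> NC" "nrmC p (\<eta> - \<theta>) < \<epsilon> - nrmC p \<theta>" for \<eta>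
    using nrmC_triangle[of "\<eta> - \<theta>" \<theta> p] that \<theta> by simp
  then show "\<exists>q. \<exists>\<delta>>0. \<forall>\<eta>\<in>NC. nrmC q (\<eta> - \<theta>) < \<delta> \<longrightarrow> \<eta> \<in> {\<theta> \<in> NC. nrmC p \<theta> < \<epsilon>}"
    using \<theta> by (intro exI[of _ p] exI[of _ "\<epsilon> - nrmC p \<theta>"]) auto
qed auto

lemma nrmC_0 [simp]: "nrmC p 0 = 0"
  by (simp add: nrmC_def)

lemma cscale_NC [simp]: "\<theta> \<in> NC \<Longrightarrow> cscale c \<theta> \<in> NC"
  by (auto simp: cscale_def NC_def)

lemma nrmC_cscale:
  assumes "\<theta> \<in> NC"
  shows "nrmC p (cscale c \<theta>) = cmod c * nrmC p \<theta>"
proof -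
  have N: "fst \<theta> \<in> Hs p" "snd \<theta> \<in> Hs p" using assms by (auto simp: NC_def)
  have "(nrm p (Re c *\<^sub>R fst \<theta> - Im c *\<^sub>R snd \<theta>))\<^sup>2 + (nrm p (Im c *\<^sub>R fst \<theta> + Re c *\<^sub>R snd \<theta>))\<^sup>2 =
      ((Re c)\<^sup>2 + (Im c)\<^sup>2) * ((nrm p (fst \<theta>))\<^sup>2 + (nrm p (snd \<theta>))\<^sup>2)"
    using N by (simp add: nrm_sq)
      (simp add: H.left_add H.right_add H.left_diff H.right_diff H.left_scale H.right_scale
        H.sym[of "snd \<theta>" p "fst \<theta>"] power2_eq_square algebra_simps)
  then show ?thesis unfolding nrmC_def cscale_def cmod_def by (simp add: real_sqrt_mult)
qed

lemma pair_real_cscale: "x \<in> N' \<Longrightarrow> \<theta> \<in> NC \<Longrightarrow> pair_real x (cscale c \<theta>) = c * pair_real x \<theta>"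
  unfolding pair_real_def cscale_def NC_def
  by (auto simp: N'_linear_simps complex_eq_iff)

lemma cscale_1 [simp]: "cscale 1 \<theta> = \<theta>"
  by (simp add: cscale_def)

lemma tpow_cscale:
  assumes \<theta>: "\<theta> \<in> NC"
  shows "tpow (cscale c \<theta>) n = (\<lambda>xs. c ^ n * tpow \<theta> n xs)"
proof
  fix xs :: "('h \<Rightarrow> real) list"
  have "prod_list (map (\<lambda>x. pair_real x (cscale c \<theta>)) ys) = c ^ length ys * prod_list (map (\<lambda>x. pair_real x \<theta>) ys)"
    if "set ys \<subseteq> N'" for ys
    using that by (induction ys) (simp_all add: pair_real_cscale[OF _ \<theta>])
  then show "tpow (cscale c \<theta>) n xs = c ^ n * tpow \<theta> n xs" by (auto simp: tpow_def)
qed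

lemma tens_dual_cscale:
  assumes "K \<in> tens_dual n" "\<theta> \<in> NC"
  shows "K (tpow (cscale c \<theta>) n) = K (tpow \<theta> n) * c ^ n"
proof -
  obtain p where "K \<in> tens_neg p n" using assms by (auto simp: tens_dual_def)
  then show ?thesis using tens_neg_scale_arg[of K p n "tpow \<theta> n" "c ^ n"] assms(2) by (simp add: tpow_cscale)
qed

text \<open>Along each complex line both families are the Taylor coefficients of the same function
  of one variable. A short piece of the line lies in the ball, whatever the size of
  \<theta>.\<close>

lemma kernel_unique_if_sums:
  assumes K: "\<And>n. K n \<in> tens_dual n" and L: "\<And>n. L n \<in> tens_dual n" and "\<epsilon> > 0"
    and Ks: "\<And>\<theta>. \<theta> \<in> NC \<Longrightarrow> nrmC p \<theta> < \<epsilon> \<Longrightarrow> (\<lambda>n. K n (tpow \<theta> n)) sums f \<theta>"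
    and Ls: "\<And>\<theta>. \<theta> \<in> NC \<Longrightarrow> nrmC p \<theta> < \<epsilon> \<Longrightarrow> (\<lambda>n. L n (tpow \<theta> n)) sums f \<theta>"
  shows "K = L"
proof (rule kernel_eqI[OF K L])
  fix \<theta> assume \<theta>: "\<theta> \<in> NC"
  define r where "r = \<epsilon> / (nrmC p \<theta> + 1)"
  have r: "r > 0" using \<open>\<epsilon> > 0\<close> by (simp add: r_def add_nonneg_pos)
  have small: "nrmC p (cscale t \<theta>) < \<epsilon>" if "t \<in> ball 0 r" for t
  proof -
    have "cmod t * (nrmC p \<theta> + 1) < \<epsilon>" using that by (simp add: r_def pos_less_divide_eq add_nonneg_pos)
    moreover have "cmod t * nrmC p \<theta> \<le> cmod t * (nrmC p \<theta> + 1)" by (intro mult_left_mono) auto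
    ultimately show ?thesis using nrmC_cscale[OF \<theta>, of p t] by linarith
  qed
  have "(\<lambda>t. f (cscale t \<theta>)) has_fps_expansion Abs_fps (\<lambda>n. K n (tpow \<theta> n))"
    using Ks[OF cscale_NC[OF \<theta>] small] tens_dual_cscale[OF K \<theta>] by (intro power_series_on_ball(2)[OF r]) simp
  moreover have "(\<lambda>t. f (cscale t \<theta>)) has_fps_expansion Abs_fps (\<lambda>n. L n (tpow \<theta> n))"
    using Ls[OF cscale_NC[OF \<theta>] small] tens_dual_cscale[OF L \<theta>] by (intro power_series_on_ball(2)[OF r]) simp
  ultimately show "symbol K \<theta> = symbol L \<theta>" unfolding symbol_def by (rule fps_expansion_unique_complex)
qed

section \<open>Polynomials\<close>

text \<open>At t x with t real, the difference of both sides is a polynomial in t with infinitely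
  many roots, so each homogeneous part vanishes on the diagonal and polarization applies. The
  continuation by 0 makes different degrees k and l comparable.\<close>

lemma poly_fun_coefficients_unique:
  assumes \<phi>: "\<And>n. \<phi> n \<in> tens n" and \<psi>: "\<And>n. \<psi> n \<in> tens n" and eq: "poly_fun k \<phi> = poly_fun l \<psi>"
  shows "(if n \<le> k then \<phi> n else (\<lambda>_. 0)) = (if n \<le> l then \<psi> n else (\<lambda>_. 0))"
proof -
  define \<phi>' where "\<phi>' n = (if n \<le> k then \<phi> n else (\<lambda>_. 0))" for n
  define \<psi>' where "\<psi>' n = (if n \<le> l then \<psi> n else (\<lambda>_. 0))" for n
  have T: "\<phi>' n \<in> tens n" "\<psi>' n \<in> tens n" for n using \<phi> \<psi> by (auto simp: \<phi>'_def \<psi>'_def)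
  let ?m = "max (max k l) n"
  have pad: "poly_fun k \<phi> x = (\<Sum>j\<le>?m. \<phi>' j (replicate j x))" "poly_fun l \<psi> x = (\<Sum>j\<le>?m. \<psi>' j (replicate j x))" if "x \<in> N'" for x
    unfolding poly_fun_def \<phi>'_def \<psi>'_def using that
    by (simp_all, intro sum.mono_neutral_cong_left; auto)+
  have "\<phi>' n = \<psi>' n"
  proof (rule sf_eq_if_diagonal_eq[OF tens_sf[OF T(1)] tens_sf[OF T(2)]])
    fix x assume x: "x \<in> N'"
    define c where "c j = \<phi>' j (replicate j x) - \<psi>' j (replicate j x)" for j
    have "(\<Sum>j\<le>?m. c j * complex_of_real t ^ j) = 0" for t
    proof -
      have tx: "(\<lambda>\<xi>. t * x \<xi>) \<in> N'" using x by (rule N'_scale)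
      have "(\<Sum>j\<le>?m. \<phi>' j (replicate j (\<lambda>\<xi>. t * x \<xi>))) = (\<Sum>j\<le>?m. \<psi>' j (replicate j (\<lambda>\<xi>. t * x \<xi>)))"
        using pad[OF tx] eq by simp
      moreover have "\<phi>' j (replicate j (\<lambda>\<xi>. t * x \<xi>)) = complex_of_real t ^ j * \<phi>' j (replicate j x)" for j
        using sf_replicate_scale[OF tens_sf[OF T(1)[of j]] x, of j t "[]"] by simp
      moreover have "\<psi>' j (replicate j (\<lambda>\<xi>. t * x \<xi>)) = complex_of_real t ^ j * \<psi>' j (replicate j x)" for j
        using sf_replicate_scale[OF tens_sf[OF T(2)[of j]] x, of j t "[]"] by simp
      ultimately show ?thesis by (simp add: c_def sum_subtractf algebra_simps)
    qed
    then have "range complex_of_real \<subseteq> {z. (\<Sum>j\<le>?m. c j * z ^ j) = 0}" by auto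
    moreover have "infinite (range complex_of_real)"
      by (simp add: finite_image_iff inj_on_def infinite_UNIV_char_0)
    ultimately have "infinite {z. (\<Sum>j\<le>?m. c j * z ^ j) = 0}" using finite_subset by blast
    then have "c n = 0" unfolding polyfun_finite_roots by auto
    then show "\<phi>' n (replicate n x) = \<psi>' n (replicate n x)" by (simp add: c_def)
  qed
  then show ?thesis by (simp add: \<phi>'_def \<psi>'_def)
qed

lemma tens_dual_at_0: "L \<in> tens_dual n \<Longrightarrow> L (\<lambda>_. 0) = 0"
  using tens_neg_at_0 by (auto simp: tens_dual_def)

lemma pairing_cut:
  assumes A: "\<And>n. A n \<in> tens_dual n" and "m \<le> M"
  shows "pairing m A \<phi> = (\<Sum>n\<le>M. fact n * A n (if n \<le> m then \<phi> n else (\<lambda>_. 0)))"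
  unfolding pairing_def using assms(2) tens_dual_at_0[OF A]
  by (intro sum.mono_neutral_cong_left) auto

text \<open>The pairing with the ordinary coefficients of a polynomial. For A in the dual the choice
  has only one possible value, since \<open>poly_fun_coefficients_unique\<close> determines the
  coefficients up to zeros in high degree.\<close>

definition poly_functional ::
  "(nat \<Rightarrow> (('h \<Rightarrow> real) list \<Rightarrow> complex) \<Rightarrow> complex) \<Rightarrow> (('h \<Rightarrow> real) \<Rightarrow> complex) \<Rightarrow> complex" where
  "poly_functional A f = (if f \<in> polys
     then (SOME z. \<exists>m \<phi>. (\<forall>n. \<phi> n \<in> tens n) \<and> f = poly_fun m \<phi> \<and> z = pairing m A \<phi>) else 0)"

lemma poly_functional_eq:
  assumes A: "\<And>n. A n \<in> tens_dual n" and \<phi>: "\<And>n. \<phi> n \<in> tens n"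
  shows "poly_functional A (poly_fun m \<phi>) = pairing m A \<phi>"
proof -
  have P: "poly_fun m \<phi> \<in> polys" using \<phi> unfolding polys_def by blast
  have "(SOME z. \<exists>k \<psi>. (\<forall>n. \<psi> n \<in> tens n) \<and> poly_fun m \<phi> = poly_fun k \<psi> \<and> z = pairing k A \<psi>) = pairing m A \<phi>"
  proof (rule some_equality)
    show "\<exists>k \<psi>. (\<forall>n. \<psi> n \<in> tens n) \<and> poly_fun m \<phi> = poly_fun k \<psi> \<and> pairing m A \<phi> = pairing k A \<psi>"
      using \<phi> by blast
    fix z assume "\<exists>k \<psi>. (\<forall>n. \<psi> n \<in> tens n) \<and> poly_fun m \<phi> = poly_fun k \<psi> \<and> z = pairing k A \<psi>"
    then obtain k \<psi> where k: "\<And>n. \<psi> n \<in> tens n" "poly_fun m \<phi> = poly_fun k \<psi>" "z = pairing k A \<psi>" by blast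
    show "z = pairing m A \<phi>"
      unfolding k(3) pairing_cut[OF A max.cobounded1[of k m]] pairing_cut[OF A max.cobounded2[of m k]]
      using poly_fun_coefficients_unique[OF \<phi> k(1,2)] by simp
  qed
  then show ?thesis using P by (simp add: poly_functional_def)
qed

lemma polys_common_degree:
  assumes "f \<in> polys" "g \<in> polys"
  obtains m \<phi> \<psi> where "\<And>n. \<phi> n \<in> tens n" "\<And>n. \<psi> n \<in> tens n" "f = poly_fun m \<phi>" "g = poly_fun m \<psi>"
proof -
  obtain k \<phi> where k: "\<And>n. \<phi> n \<in> tens n" "f = poly_fun k \<phi>" using assms(1) unfolding polys_def by blast
  obtain l \<psi> where l: "\<And>n. \<psi> n \<in> tens n" "g = poly_fun l \<psi>" using assms(2) unfolding polys_def by blast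
  let ?m = "max k l"
  have pad: "poly_fun j \<omega> = poly_fun ?m (\<lambda>n. if n \<le> j then \<omega> n else (\<lambda>_. 0))" if "j \<le> ?m" for j and \<omega> :: "nat \<Rightarrow> ('h \<Rightarrow> real) list \<Rightarrow> complex"
    unfolding poly_fun_def using that by (intro ext if_cong refl sum.mono_neutral_cong_left) auto
  show ?thesis
  proof (rule that[of "\<lambda>n. if n \<le> k then \<phi> n else (\<lambda>_. 0)" "\<lambda>n. if n \<le> l then \<psi> n else (\<lambda>_. 0)" ?m])
    show "f = poly_fun ?m (\<lambda>n. if n \<le> k then \<phi> n else (\<lambda>_. 0))" unfolding k(2) by (rule pad) simp
    show "g = poly_fun ?m (\<lambda>n. if n \<le> l then \<psi> n else (\<lambda>_. 0))" unfolding l(2) by (rule pad) simp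
  qed (use k l in auto)
qed

text \<open>The direct sum topology lets the index \<open>q n\<close> and the constant n!
  \<open>C n\<close> depend freely on the degree, so every family of kernels yields a continuous
  functional.\<close>

lemma poly_functional_dual:
  assumes A: "\<And>n. A n \<in> tens_dual n"
  shows "poly_functional A \<in> polys_dual"
proof -
  have lin: "poly_functional A (\<lambda>x. c * f x + d * g x) = c * poly_functional A f + d * poly_functional A g"
    if f: "f \<in> polys" and g: "g \<in> polys" for f g c d
  proof -
    obtain m \<phi> \<psi> where p: "\<And>n. \<phi> n \<in> tens n" "\<And>n. \<psi> n \<in> tens n" "f = poly_fun m \<phi>" "g = poly_fun m \<psi>"
      using polys_common_degree[OF f g] by blast
    define \<omega> where "\<omega> n xs = c * \<phi> n xs + d * \<psi> n xs" for n xs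
    have \<omega>: "\<omega> n \<in> tens n" for n unfolding \<omega>_def using p tens_comb by blast
    have "(\<lambda>x. c * f x + d * g x) = poly_fun m \<omega>"
      unfolding p poly_fun_def \<omega>_def by (auto simp: fun_eq_iff sum.distrib sum_distrib_left)
    moreover have "A n (\<omega> n) = c * A n (\<phi> n) + d * A n (\<psi> n)" for n
    proof -
      obtain q where "A n \<in> tens_neg q n" using A[of n] by (auto simp: tens_dual_def)
      then show ?thesis unfolding \<omega>_def using tens_negD(1) p by blast
    qed
    ultimately show ?thesis
      using poly_functional_eq[OF A] p \<omega> by (simp add: pairing_def sum.distrib sum_distrib_left algebra_simps)
  qed
  have "\<forall>n. \<exists>q C. bounded_by q n (A n) C"
  proof
    fix n
    obtain q where "A n \<in> tens_neg q n" using A[of n] by (auto simp: tens_dual_def)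
    then show "\<exists>q C. bounded_by q n (A n) C" using tens_neg_bounded by blast
  qed
  then obtain q C where C: "\<And>n. bounded_by (q n) n (A n) (C n)" by metis
  have "cmod (poly_functional A (poly_fun m \<phi>)) \<le> (\<Sum>n\<le>m. (fact n * C n) * tnorm (q n) n (\<phi> n))"
    if \<phi>: "\<forall>n. \<phi> n \<in> tens n" for m \<phi>
  proof -
    have "cmod (pairing m A \<phi>) \<le> (\<Sum>n\<le>m. cmod (fact n * A n (\<phi> n)))" unfolding pairing_def by (rule norm_sum)
    also have "\<dots> \<le> (\<Sum>n\<le>m. fact n * (C n * tnorm (q n) n (\<phi> n)))"
      unfolding norm_mult using bounded_byD[OF C] \<phi> by (intro sum_mono mult_mono) auto
    finally show ?thesis using poly_functional_eq[OF A] \<phi> by (simp add: mult.assoc)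
  qed
  then have "\<exists>q c. \<forall>m \<phi>. (\<forall>n. \<phi> n \<in> tens n) \<longrightarrow> cmod (poly_functional A (poly_fun m \<phi>)) \<le> (\<Sum>n\<le>m. c n * tnorm (q n) n (\<phi> n))"
    by (intro exI[of _ q] exI[of _ "\<lambda>n. fact n * C n"] allI impI)
  then show ?thesis unfolding polys_dual_def using lin by (auto simp: poly_functional_def)
qed

section \<open>Convolution powers with geometric bounds\<close>

lemma bounded_by_conv:
  assumes "\<And>k. k \<le> n \<Longrightarrow> bounded_by p k (K k) (C k)" "\<And>k. k \<le> n \<Longrightarrow> bounded_by p k (L k) (D k)"
    and "\<And>k. k \<le> n \<Longrightarrow> L k \<in> tens_neg p k"
  shows "bounded_by p n (conv K L n) (\<Sum>k\<le>n. C k * D (n - k))"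
proof -
  have "bounded_by p n (\<lambda>\<phi>. \<Sum>k\<le>n. 1 * tprod k (n - k) (K k) (L (n - k)) \<phi>) (\<Sum>k\<le>n. cmod 1 * (C k * D (n - k)))"
  proof (rule bounded_by_sum)
    fix k assume "k \<in> {..n}"
    then show "bounded_by p n (tprod k (n - k) (K k) (L (n - k))) (C k * D (n - k))"
      using bounded_by_tprod[of p k "K k" "C k" "n - k" "L (n - k)" "D (n - k)"] assms by simp
  qed simp
  then show ?thesis by (simp add: conv_def[abs_def])
qed

primrec conv_power ::
  "(nat \<Rightarrow> (('h \<Rightarrow> real) list \<Rightarrow> complex) \<Rightarrow> complex) \<Rightarrow> nat \<Rightarrow> nat \<Rightarrow> (('h \<Rightarrow> real) list \<Rightarrow> complex) \<Rightarrow> complex" where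
  "conv_power G 0 = unit_kernel"
| "conv_power G (Suc i) = conv G (conv_power G i)"

lemma conv_power_tens_neg: "(\<And>n. G n \<in> tens_neg p n) \<Longrightarrow> conv_power G i n \<in> tens_neg p n"
  by (induction i arbitrary: n) (auto simp: unit_kernel_tens_neg intro: conv_tens_neg)

lemma symbol_conv_power:
  assumes G: "\<And>n. G n \<in> tens_neg p n" and \<theta>: "\<theta> \<in> NC"
  shows "symbol (conv_power G i) \<theta> = symbol G \<theta> ^ i"
proof (induction i)
  case 0
  then show ?case using symbol_unit[OF \<theta>] by simp
next
  case (Suc i)
  have "G k \<in> tens_dual k" "conv_power G i k \<in> tens_dual k" for k
    using G conv_power_tens_neg[OF G] tens_neg_dual by blast+
  then show ?case using Suc symbol_conv[OF _ _ \<theta>, of G "conv_power G i"] by simp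
qed

text \<open>With the same R on both factors each convolution would cost n + 1 equal terms. Passing
  to 2 R makes the terms geometric: they add up to C (2 C)^i R^n times a sum of powers of 2, which
  is at most 2^(n+1), so the cost is one factor 2 per convolution.\<close>

lemma bounded_by_conv_power:
  assumes G: "\<And>n. G n \<in> tens_neg p n" "\<And>n. bounded_by p n (G n) (C * R ^ n)" and C: "C \<ge> 1" "R \<ge> 1"
  shows "bounded_by p n (conv_power G i n) ((2 * C) ^ i * (2 * R) ^ n)"
proof (induction i arbitrary: n)
  case 0
  show ?case
    using unit_kernel_bounded[of p n] C by (auto intro: bounded_by_mono)
next
  case (Suc i)
  have "bounded_by p n (conv G (conv_power G i) n) (\<Sum>k\<le>n. (C * R ^ k) * ((2 * C) ^ i * (2 * R) ^ (n - k)))"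
    using G(2) Suc conv_power_tens_neg[OF G(1)] by (intro bounded_by_conv)
  moreover have "(\<Sum>k\<le>n. (C * R ^ k) * ((2 * C) ^ i * (2 * R) ^ (n - k))) \<le> (2 * C) ^ Suc i * (2 * R) ^ n"
  proof -
    have "(\<Sum>k\<le>n. (C * R ^ k) * ((2 * C) ^ i * (2 * R) ^ (n - k))) = (\<Sum>k\<le>n. C * (2 * C) ^ i * R ^ n * 2 ^ (n - k))"
    proof (intro sum.cong refl)
      fix k assume "k \<in> {..n}"
      then have "R ^ n = R ^ k * R ^ (n - k)" by (simp add: power_add[symmetric])
      then show "(C * R ^ k) * ((2 * C) ^ i * (2 * R) ^ (n - k)) = C * (2 * C) ^ i * R ^ n * 2 ^ (n - k)"
        by (simp add: power_mult_distrib)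
    qed
    also have "\<dots> = C * (2 * C) ^ i * R ^ n * (\<Sum>k\<le>n. 2 ^ (n - k))" by (simp add: sum_distrib_left)
    also have "(\<Sum>k\<le>n. (2::real) ^ (n - k)) = (\<Sum>k\<le>n. 2 ^ k)"
      by (rule sum.reindex_bij_witness[where i = "\<lambda>k. n - k" and j = "\<lambda>k. n - k"]) auto
    also have "\<dots> \<le> 2 ^ Suc n" by (induction n) auto
    finally show ?thesis using C by (simp add: power_mult_distrib mult_ac mult_left_mono)
  qed
  ultimately show ?case by (auto intro: bounded_by_mono)
qed

end

context analytic_measure
begin

section \<open>The Appell system\<close>

definition moment_kernel :: "nat \<Rightarrow> (('h \<Rightarrow> real) list \<Rightarrow> complex) \<Rightarrow> complex" where
  "moment_kernel = (SOME M. \<exists>p \<delta>. \<delta> > 0 \<and> (\<forall>n. M n \<in> tens_dual n) \<and> M 0 = unit_kernel 0 \<and>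
    (\<forall>\<theta>\<in>NC. nrmC p \<theta> < \<delta> \<longrightarrow> (\<lambda>n. M n (tpow \<theta> n)) sums laplace \<mu> \<theta> \<and> cmod (laplace \<mu> \<theta> - 1) \<le> 1 / 2))"

lemma moment_kernel_props:
  "\<exists>p \<delta>. \<delta> > 0 \<and> (\<forall>n. moment_kernel n \<in> tens_dual n) \<and> moment_kernel 0 = unit_kernel 0 \<and>
    (\<forall>\<theta>\<in>NC. nrmC p \<theta> < \<delta> \<longrightarrow> (\<lambda>n. moment_kernel n (tpow \<theta> n)) sums laplace \<mu> \<theta> \<and> cmod (laplace \<mu> \<theta> - 1) \<le> 1 / 2)"
  unfolding moment_kernel_def by (rule someI_ex[OF moment_kernel_exists])

lemma moment_kernel_dual: "moment_kernel n \<in> tens_dual n"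
  and moment_kernel_0: "moment_kernel 0 = unit_kernel 0"
  using moment_kernel_props by blast+

abbreviation appell_kernel :: "nat \<Rightarrow> (('h \<Rightarrow> real) list \<Rightarrow> complex) \<Rightarrow> complex" where
  "appell_kernel \<equiv> inv_kernel moment_kernel"

lemma appell_kernel_dual: "appell_kernel n \<in> tens_dual n"
  by (rule inv_kernel_dual[OF moment_kernel_dual])

lemma symbol_appell_kernel: "\<theta> \<in> NC \<Longrightarrow> symbol appell_kernel \<theta> * symbol moment_kernel \<theta> = 1"
  by (rule symbol_inv_kernel[OF moment_kernel_dual moment_kernel_0])

text \<open>Checked on symbols, where convolution is the commutative product of power
  series.\<close>

lemma conv_cancel:
  assumes K: "\<And>n. K n \<in> tens_dual n"
  shows "conv (conv K moment_kernel) appell_kernel = K" "conv (conv K appell_kernel) moment_kernel = K"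
proof -
  have 1: "conv K moment_kernel n \<in> tens_dual n" for n by (rule conv_dual[OF K moment_kernel_dual])
  have 2: "conv K appell_kernel n \<in> tens_dual n" for n by (rule conv_dual[OF K appell_kernel_dual])
  show "conv (conv K moment_kernel) appell_kernel = K"
  proof (rule kernel_eqI[OF conv_dual[OF 1 appell_kernel_dual] K])
    fix \<theta> assume \<theta>: "\<theta> \<in> NC"
    show "symbol (conv (conv K moment_kernel) appell_kernel) \<theta> = symbol K \<theta>"
      unfolding symbol_conv[OF 1 appell_kernel_dual \<theta>] symbol_conv[OF K moment_kernel_dual \<theta>]
      using symbol_appell_kernel[OF \<theta>] by (simp add: mult.assoc mult.commute[of "symbol moment_kernel \<theta>"])
  qed
  show "conv (conv K appell_kernel) moment_kernel = K"
  proof (rule kernel_eqI[OF conv_dual[OF 2 moment_kernel_dual] K])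
    fix \<theta> assume \<theta>: "\<theta> \<in> NC"
    show "symbol (conv (conv K appell_kernel) moment_kernel) \<theta> = symbol K \<theta>"
      unfolding symbol_conv[OF 2 moment_kernel_dual \<theta>] symbol_conv[OF K appell_kernel_dual \<theta>]
      using symbol_appell_kernel[OF \<theta>] by (simp add: mult.assoc)
  qed
qed

text \<open>The formal product of the two symbols has to sum to the actual quotient. For |t| < 2 the
  point \<open>cscale t \<theta>\<close> stays in the ball of radius \<delta>, where the Laplace
  transform does not vanish; the quotient is thus holomorphic on this disc and its Taylor series
  converges to it at t = 1.\<close>

lemma e_mu_sums:
  assumes x: "x \<in> N'"
  shows "\<exists>p \<delta>. \<delta> > 0 \<and> (\<forall>\<theta>\<in>NC. nrmC p \<theta> < \<delta> \<longrightarrow>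
    (\<lambda>n. conv (power_kernel x) appell_kernel n (tpow \<theta> n)) sums e_mu \<mu> \<theta> (x, \<lambda>_. 0))"
proof -
  obtain p \<delta> where \<delta>: "\<delta> > 0" and s: "\<forall>\<theta>\<in>NC. nrmC p \<theta> < \<delta> \<longrightarrow>
      (\<lambda>n. moment_kernel n (tpow \<theta> n)) sums laplace \<mu> \<theta> \<and> cmod (laplace \<mu> \<theta> - 1) \<le> 1 / 2"
    using moment_kernel_props by blast
  have "(\<lambda>n. conv (power_kernel x) appell_kernel n (tpow \<theta> n)) sums e_mu \<mu> \<theta> (x, \<lambda>_. 0)"
    if \<theta>: "\<theta> \<in> NC" "nrmC p \<theta> < \<delta> / 2" for \<theta>
  proof -
    define l where "l t = laplace \<mu> (cscale t \<theta>)" for t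
    have small: "nrmC p (cscale t \<theta>) < \<delta>" if "t \<in> ball 0 2" for t
    proof -
      have "cmod t * nrmC p \<theta> \<le> 2 * nrmC p \<theta>" using that by (intro mult_right_mono) auto
      then show ?thesis using \<theta> by (simp add: nrmC_cscale)
    qed
    have ls: "(\<lambda>n. moment_kernel n (tpow \<theta> n) * t ^ n) sums l t" if "t \<in> ball 0 2" for t
      unfolding l_def tens_dual_cscale[OF moment_kernel_dual \<theta>(1), symmetric]
      using s small[OF that] \<theta>(1) by simp
    have l: "l holomorphic_on ball 0 2" "l has_fps_expansion symbol moment_kernel \<theta>"
      unfolding symbol_def using power_series_on_ball[of 2, OF _ ls] by simp_all
    have lnz: "l t \<noteq> 0" if "t \<in> ball 0 2" for t
    proof
      assume "l t = 0"
      then have "cmod (laplace \<mu> (cscale t \<theta>) - 1) = 1" by (simp add: l_def)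
      then show False using s small[OF that] \<theta>(1) by fastforce
    qed
    define h where "h t = exp (pair_real x \<theta> * t) * inverse (l t)" for t
    have hol: "h holomorphic_on eball 0 (ereal 2)"
      unfolding h_def eball_ereal using l(1) lnz by (intro holomorphic_intros) auto
    have "fps_nth (symbol moment_kernel \<theta>) 0 \<noteq> 0"
      using symbol_appell_kernel[OF \<theta>(1)] by (metis fps_mult_nth_0 fps_one_nth mult_zero_right zero_neq_one)
    then have "h has_fps_expansion fps_exp (pair_real x \<theta>) * inverse (symbol moment_kernel \<theta>)"
      unfolding h_def by (intro has_fps_expansion_mult has_fps_expansion_exp has_fps_expansion_inverse l(2))
    moreover have "inverse (symbol moment_kernel \<theta>) = symbol appell_kernel \<theta>"
      using symbol_appell_kernel[OF \<theta>(1)] by (simp add: fps_inverse_unique mult.commute)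
    moreover have "symbol (conv (power_kernel x) appell_kernel) \<theta> = fps_exp (pair_real x \<theta>) * symbol appell_kernel \<theta>"
      by (simp add: symbol_conv[OF power_kernel_dual[OF x] appell_kernel_dual \<theta>(1)] symbol_power_kernel[OF x \<theta>(1)])
    ultimately have "h has_fps_expansion symbol (conv (power_kernel x) appell_kernel) \<theta>" by simp
    from has_fps_expansion_imp_sums_complex[OF this hol, of 1]
    have "(\<lambda>n. conv (power_kernel x) appell_kernel n (tpow \<theta> n)) sums h 1" by simp
    moreover have "pair_real (\<lambda>_. 0) \<theta> = 0" by (simp add: pair_real_def complex_eq_iff)
    then have "h 1 = e_mu \<mu> \<theta> (x, \<lambda>_. 0)"
      by (simp add: h_def l_def e_mu_def pair_cplx_def divide_inverse)
    ultimately show ?thesis by simp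
  qed
  moreover have "\<delta> / 2 > 0" using \<delta> by simp
  ultimately show ?thesis by blast
qed

text \<open>Resolves the definite description. Any competing family, divided by n!, has the same
  sums as the convolution on a common ball and hence coincides with it.\<close>

lemma appell_eq:
  assumes x: "x \<in> N'"
  shows "appell \<mu> (x, \<lambda>_. 0) = (\<lambda>n \<phi>. fact n * conv (power_kernel x) appell_kernel n \<phi>)"
proof -
  let ?C = "conv (power_kernel x) appell_kernel"
  have C: "?C n \<in> tens_dual n" for n by (rule conv_dual[OF power_kernel_dual[OF x] appell_kernel_dual])
  have scale: "(\<lambda>\<phi>. c * L \<phi>) \<in> tens_dual n" if L: "L \<in> tens_dual n" for L c n
  proof -
    obtain q where "L \<in> tens_neg q n" using L by (auto simp: tens_dual_def)
    then show ?thesis using tens_neg_scale tens_neg_dual by blast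
  qed
  obtain p \<delta> where \<delta>: "\<delta> > 0" and s: "\<forall>\<theta>\<in>NC. nrmC p \<theta> < \<delta> \<longrightarrow> (\<lambda>n. ?C n (tpow \<theta> n)) sums e_mu \<mu> \<theta> (x, \<lambda>_. 0)"
    using e_mu_sums[OF x] by blast
  show ?thesis
    unfolding appell_def
  proof (rule the_equality)
    let ?U = "{\<theta> \<in> NC. nrmC p \<theta> < \<delta>}"
    have "NC_open ?U" "0 \<in> ?U" using NC_open_ball \<delta> by auto
    moreover have "\<forall>\<theta>\<in>?U. (\<lambda>n. fact n * ?C n (tpow \<theta> n) / fact n) sums e_mu \<mu> \<theta> (x, \<lambda>_. 0)" using s by simp
    ultimately show "(\<forall>n. (\<lambda>\<phi>. fact n * ?C n \<phi>) \<in> tens_dual n) \<and>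
        (\<exists>U. NC_open U \<and> 0 \<in> U \<and> (\<forall>\<theta>\<in>U. (\<lambda>n. fact n * ?C n (tpow \<theta> n) / fact n) sums e_mu \<mu> \<theta> (x, \<lambda>_. 0)))"
      using scale[OF C] by blast
  next
    fix P assume P: "(\<forall>n. P n \<in> tens_dual n) \<and>
        (\<exists>U. NC_open U \<and> 0 \<in> U \<and> (\<forall>\<theta>\<in>U. (\<lambda>n. P n (tpow \<theta> n) / fact n) sums e_mu \<mu> \<theta> (x, \<lambda>_. 0)))"
    then obtain U where U: "NC_open U" "0 \<in> U" "\<And>\<theta>. \<theta> \<in> U \<Longrightarrow> (\<lambda>n. P n (tpow \<theta> n) / fact n) sums e_mu \<mu> \<theta> (x, \<lambda>_. 0)"
      by blast
    obtain q \<epsilon> where \<epsilon>: "\<epsilon> > 0" "\<And>\<theta>. \<theta> \<in> NC \<Longrightarrow> nrmC q \<theta> < \<epsilon> \<Longrightarrow> \<theta> \<in> U" using NC_openD[OF U(1,2)] by blast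
    have "(\<lambda>n \<phi>. (1 / fact n) * P n \<phi>) = ?C"
    proof (rule kernel_unique_if_sums[where p = "max p q" and \<epsilon> = "min \<delta> \<epsilon>" and f = "\<lambda>\<theta>. e_mu \<mu> \<theta> (x, \<lambda>_. 0)"])
      show "(\<lambda>\<phi>. (1 / fact n) * P n \<phi>) \<in> tens_dual n" for n using scale P by blast
      show "?C n \<in> tens_dual n" for n by (rule C)
      show "min \<delta> \<epsilon> > 0" using \<delta> \<epsilon> by simp
      fix \<theta> assume \<theta>: "\<theta> \<in> NC" "nrmC (max p q) \<theta> < min \<delta> \<epsilon>"
      have "nrmC p \<theta> < \<delta>" "nrmC q \<theta> < \<epsilon>"
        using nrmC_mono[of p "max p q" \<theta>] nrmC_mono[of q "max p q" \<theta>] \<theta> by auto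
      then show "(\<lambda>n. (1 / fact n) * P n (tpow \<theta> n)) sums e_mu \<mu> \<theta> (x, \<lambda>_. 0)" "(\<lambda>n. ?C n (tpow \<theta> n)) sums e_mu \<mu> \<theta> (x, \<lambda>_. 0)"
        using U(3)[OF \<epsilon>(2)[OF \<theta>(1)]] s \<theta>(1) by simp_all
    qed
    then have "?C n \<phi> = (1 / fact n) * P n \<phi>" for n \<phi> by metis
    then show "P = (\<lambda>n \<phi>. fact n * ?C n \<phi>)" by (simp add: fun_eq_iff)
  qed
qed

lemma poly_fun_pairing:
  "x \<in> N' \<Longrightarrow> (\<And>n. \<phi> n \<in> tens n) \<Longrightarrow> poly_fun m \<phi> x = pairing m (power_kernel x) \<phi>"
  by (simp add: poly_fun_def pairing_def power_kernel_def)

lemma appell_poly_pairing: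
  "x \<in> N' \<Longrightarrow> appell_poly \<mu> m \<phi> x = pairing m (conv (power_kernel x) appell_kernel) \<phi>"
  by (simp add: appell_poly_def pairing_def appell_eq)

text \<open>For fixed x both sides are pairings with kernels that differ by the factor
  \<open>appell_kernel\<close>, and \<open>pairing_transfer\<close> moves this factor to the
  coefficients.\<close>

lemma appell_poly_eq_poly_fun:
  assumes \<phi>: "\<And>n. \<phi> n \<in> tens n"
  shows "appell_poly \<mu> m \<phi> = poly_fun m (transfer appell_kernel m \<phi>)"
proof
  fix x
  show "appell_poly \<mu> m \<phi> x = poly_fun m (transfer appell_kernel m \<phi>) x"
  proof (cases "x \<in> N'")
    case True
    show ?thesis
      unfolding appell_poly_pairing[OF True] poly_fun_pairing[OF True transfer_tens[OF appell_kernel_dual \<phi>]]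
      by (rule pairing_transfer[OF power_kernel_dual[OF True] appell_kernel_dual \<phi>, symmetric])
  next
    case False
    then show ?thesis by (simp add: appell_poly_def poly_fun_def)
  qed
qed

text \<open>The converse change of coefficients, by the inverse kernel. The Appell polynomials
  therefore exhaust all polynomials, so that an element of \<open>polys_dual\<close> is determined
  by its expansion.\<close>

lemma poly_fun_eq_appell_poly:
  assumes \<phi>: "\<And>n. \<phi> n \<in> tens n"
  shows "poly_fun m \<phi> = appell_poly \<mu> m (transfer moment_kernel m \<phi>)"
proof
  fix x
  show "poly_fun m \<phi> x = appell_poly \<mu> m (transfer moment_kernel m \<phi>) x"
  proof (cases "x \<in> N'")
    case True
    show ?thesis
      unfolding appell_poly_pairing[OF True] poly_fun_pairing[OF True \<phi>]
        pairing_transfer[OF conv_dual[OF power_kernel_dual[OF True] appell_kernel_dual] moment_kernel_dual \<phi>]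
        conv_cancel(2)[OF power_kernel_dual[OF True]] ..
  next
    case False
    then show ?thesis by (simp add: appell_poly_def poly_fun_def)
  qed
qed

section \<open>Distributions and their kernels\<close>

text \<open>Tested on coefficient sequences concentrated in the single degree n, which isolates n!
  times the n-th kernel.\<close>

lemma Q_expansion_unique:
  assumes K: "Q_expansion \<mu> \<Phi> K" and L: "Q_expansion \<mu> \<Phi> L"
  shows "K = L"
proof (intro ext)
  fix n \<phi>
  have D: "\<And>n. K n \<in> tens_dual n" "\<And>n. L n \<in> tens_dual n" using K L by (auto simp: Q_expansion_def)
  show "K n \<phi> = L n \<phi>"
  proof (cases "\<phi> \<in> tens n")
    case True
    define \<psi> where "\<psi> k = (if k = n then \<phi> else (\<lambda>_. 0))" for k
    have T: "\<forall>k. \<psi> k \<in> tens k" using True by (simp add: \<psi>_def)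
    have val: "(\<Sum>k\<le>n. fact k * M k (\<psi> k)) = fact n * M n \<phi>" if "\<And>k. M k \<in> tens_dual k" for M
    proof -
      have "(\<Sum>k\<le>n. fact k * M k (\<psi> k)) = (\<Sum>k\<le>n. if k = n then fact n * M n \<phi> else 0)"
        using tens_dual_at_0[OF that] by (intro sum.cong) (auto simp: \<psi>_def)
      then show ?thesis by simp
    qed
    have "(\<Sum>k\<le>n. fact k * K k (\<psi> k)) = (\<Sum>k\<le>n. fact k * L k (\<psi> k))"
      using K L T unfolding Q_expansion_def by metis
    then show ?thesis unfolding val[OF D(1)] val[OF D(2)] by simp
  next
    case False
    obtain p q where "K n \<in> tens_neg p n" "L n \<in> tens_neg q n" using D[of n] by (auto simp: tens_dual_def)
    then show ?thesis using False by (simp add: tens_negD(2))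
  qed
qed

lemma kernels_eq: "Q_expansion \<mu> \<Phi> K \<Longrightarrow> kernels \<mu> \<Phi> = K"
  unfolding kernels_def using Q_expansion_unique by (intro the_equality) blast+

text \<open>The terms of the convergent weighted square sum are bounded by some B, so the squared
  norms are at most B R^n with R = 2^q. Since C = B + 1 and R are at least 1, this is below (C
  R^n)^2.\<close>

lemma distribution_kernels:
  assumes "\<Phi> \<in> distributions \<mu>"
  shows "Q_expansion \<mu> \<Phi> (kernels \<mu> \<Phi>)" "\<Phi> \<in> polys_dual"
    "\<exists>p C R. C \<ge> 1 \<and> R \<ge> 1 \<and> (\<forall>n. kernels \<mu> \<Phi> n \<in> tens_neg p n) \<and>
      (\<forall>n. bounded_by p n (kernels \<mu> \<Phi> n) (C * R ^ n))"
proof -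
  obtain p q where "\<Phi> \<in> distributions_pq \<mu> p q" using assms by (auto simp: distributions_def)
  then obtain K where \<Phi>: "\<Phi> \<in> polys_dual" and K: "Q_expansion \<mu> \<Phi> K" "\<And>n. K n \<in> tens_neg p n"
    and sm: "summable (\<lambda>n. (1 / 2) ^ (q * n) * (dnorm p n (K n))\<^sup>2)"
    unfolding distributions_pq_def by blast
  have "(\<lambda>n. (1 / 2) ^ (q * n) * (dnorm p n (K n))\<^sup>2) \<longlonglongrightarrow> 0" using sm by (rule summable_LIMSEQ_zero)
  then have "Bseq (\<lambda>n. (1 / 2) ^ (q * n) * (dnorm p n (K n))\<^sup>2)" by (simp add: convergentI convergent_imp_Bseq)
  then obtain B where B: "B > 0" "\<And>n. norm ((1 / 2) ^ (q * n) * (dnorm p n (K n))\<^sup>2) \<le> B" by (auto elim: BseqE)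
  define C where "C = B + 1"
  define R where "R = (2::real) ^ q"
  have CR: "C \<ge> 1" "R \<ge> 1" using B by (auto simp: C_def R_def)
  have "bounded_by p n (K n) (C * R ^ n)" for n
  proof -
    have d0: "dnorm p n (K n) \<ge> 0" using bounded_by_nonneg[OF bounded_by_dnorm[OF K(2)]] .
    have "(1 / R) ^ n * (dnorm p n (K n))\<^sup>2 \<le> B"
      using B(2)[of n] by (simp add: R_def power_mult power_divide)
    then have "(dnorm p n (K n))\<^sup>2 \<le> B * R ^ n" using CR by (simp add: power_divide field_simps)
    also have "\<dots> \<le> C\<^sup>2 * (R ^ n)\<^sup>2"
    proof (rule mult_mono)
      have "B \<le> C" "C \<le> C\<^sup>2" using CR by (auto simp: C_def power2_eq_square mult_le_cancel_left1)
      then show "B \<le> C\<^sup>2" by linarith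
      have "R ^ n \<ge> 1" using CR by (simp add: one_le_power)
      then have "R ^ n * 1 \<le> R ^ n * R ^ n" by (intro mult_left_mono) auto
      then show "R ^ n \<le> (R ^ n)\<^sup>2" by (simp only: power2_eq_square mult_1_right)
    qed (use CR in auto)
    finally have "(dnorm p n (K n))\<^sup>2 \<le> (C * R ^ n)\<^sup>2" by (simp add: power_mult_distrib)
    then have "dnorm p n (K n) \<le> C * R ^ n" by (rule power2_le_imp_le) (use CR in auto)
    then show ?thesis using bounded_by_mono[OF bounded_by_dnorm[OF K(2)] order_refl] by blast
  qed
  then show "\<exists>p C R. C \<ge> 1 \<and> R \<ge> 1 \<and> (\<forall>n. kernels \<mu> \<Phi> n \<in> tens_neg p n) \<and>
      (\<forall>n. bounded_by p n (kernels \<mu> \<Phi> n) (C * R ^ n))"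
    unfolding kernels_eq[OF K(1)] using CR K(2) by blast
  show "Q_expansion \<mu> \<Phi> (kernels \<mu> \<Phi>)" "\<Phi> \<in> polys_dual"
    using K(1) \<Phi> by (simp_all add: kernels_eq[OF K(1)])
qed

text \<open>Both parts compare with a geometric series of ratio at most 1/2. The second omits degree
  0 and is linear in the norm of \<theta>: for small \<theta> the transform stays in a prescribed
  disc around its value at 0.\<close>

lemma kernel_sums:
  assumes K: "\<And>n. bounded_by p n (K n) (C * R ^ n)" and R: "R \<ge> 1" and \<theta>: "\<theta> \<in> NC" "R * nrmC p \<theta> \<le> 1 / 2"
  shows "summable (\<lambda>n. K n (tpow \<theta> n))"
    and "cmod (\<Sum>n. K (Suc n) (tpow \<theta> (Suc n))) \<le> 2 * C * R * nrmC p \<theta>"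
proof -
  let ?u = "R * nrmC p \<theta>"
  have C0: "C \<ge> 0" using bounded_by_nonneg[OF K[of 0]] by simp
  have u: "?u \<ge> 0" "?u < 1" using R \<theta>(2) by (simp_all)
  have bd: "cmod (K n (tpow \<theta> n)) \<le> C * ?u ^ n" for n
  proof -
    have "cmod (K n (tpow \<theta> n)) \<le> C * R ^ n * tnorm p n (tpow \<theta> n)" using bounded_byD[OF K] \<theta> by simp
    also have "\<dots> \<le> C * R ^ n * nrmC p \<theta> ^ n"
      using tnorm_tpow_le[OF \<theta>(1)] C0 R by (intro mult_left_mono) auto
    finally show ?thesis by (simp add: power_mult_distrib)
  qed
  show s: "summable (\<lambda>n. K n (tpow \<theta> n))"
    by (rule summable_comparison_test'[of "\<lambda>n. C * ?u ^ n" 0]) (use bd u in \<open>auto intro: summable_mult summable_geometric\<close>)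
  have "(\<lambda>n. K (Suc n) (tpow \<theta> (Suc n))) sums (\<Sum>n. K (Suc n) (tpow \<theta> (Suc n)))"
    using s by (intro summable_sums) (subst summable_Suc_iff[of "\<lambda>n. K n (tpow \<theta> n)"])
  moreover have "(\<lambda>n. (C * ?u) * ?u ^ n) sums ((C * ?u) * (1 / (1 - ?u)))"
    using u by (intro sums_mult geometric_sums) auto
  moreover have "cmod (K (Suc n) (tpow \<theta> (Suc n))) \<le> (C * ?u) * ?u ^ n" for n using bd[of "Suc n"] by (simp add: mult_ac)
  ultimately have "cmod (\<Sum>n. K (Suc n) (tpow \<theta> (Suc n))) \<le> (C * ?u) * (1 / (1 - ?u))" by (rule norm_sums_le)
  also have "\<dots> \<le> (C * ?u) * 2" using u \<theta>(2) C0 by (intro mult_left_mono) (auto simp: field_simps)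
  finally show "cmod (\<Sum>n. K (Suc n) (tpow \<theta> (Suc n))) \<le> 2 * C * R * nrmC p \<theta>" by (simp add: mult_ac)
qed

lemma S_transform_sums:
  assumes \<Phi>: "\<Phi> \<in> distributions \<mu>"
  shows "\<exists>p \<epsilon>. \<epsilon> > 0 \<and> (\<forall>\<theta>\<in>NC. nrmC p \<theta> < \<epsilon> \<longrightarrow> (\<lambda>n. kernels \<mu> \<Phi> n (tpow \<theta> n)) sums S_transform \<mu> \<Phi> \<theta>)"
proof -
  obtain p C R where R: "R \<ge> 1" and K': "\<forall>n. bounded_by p n (kernels \<mu> \<Phi> n) (C * R ^ n)"
    using distribution_kernels(3)[OF \<Phi>] by blast
  note K = K'[rule_format]
  have "(\<lambda>n. kernels \<mu> \<Phi> n (tpow \<theta> n)) sums S_transform \<mu> \<Phi> \<theta>" if "\<theta> \<in> NC" "nrmC p \<theta> < 1 / (2 * R)" for \<theta>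
  proof -
    have "R * nrmC p \<theta> \<le> 1 / 2" using that(2) R by (simp add: field_simps)
    then show ?thesis unfolding S_transform_def using kernel_sums(1)[OF K R that(1)] by (intro summable_sums)
  qed
  moreover have "1 / (2 * R) > 0" using R by simp
  ultimately show ?thesis by blast
qed

text \<open>Equal germs give equal sums on a common ball, hence equal kernels; the values on Appell
  polynomials then agree, and these are all polynomials. Outside \<open>polys\<close> both
  functionals are 0 by definition.\<close>

lemma distribution_unique:
  assumes \<Phi>: "\<Phi> \<in> distributions \<mu>" and \<Psi>: "\<Psi> \<in> distributions \<mu>"
    and g: "germ_eq (S_transform \<mu> \<Phi>) f" "germ_eq (S_transform \<mu> \<Psi>) f"
  shows "\<Phi> = \<Psi>"
proof -
  note Q = distribution_kernels(1,2)[OF \<Phi>] and Q' = distribution_kernels(1,2)[OF \<Psi>]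
  obtain p1 e1 where 1: "e1 > 0" "\<forall>\<theta>\<in>NC. nrmC p1 \<theta> < e1 \<longrightarrow> (\<lambda>n. kernels \<mu> \<Phi> n (tpow \<theta> n)) sums S_transform \<mu> \<Phi> \<theta>"
    using S_transform_sums[OF \<Phi>] by blast
  obtain p2 e2 where 2: "e2 > 0" "\<forall>\<theta>\<in>NC. nrmC p2 \<theta> < e2 \<longrightarrow> (\<lambda>n. kernels \<mu> \<Psi> n (tpow \<theta> n)) sums S_transform \<mu> \<Psi> \<theta>"
    using S_transform_sums[OF \<Psi>] by blast
  obtain U where U: "NC_open U" "0 \<in> U" "\<And>\<theta>. \<theta> \<in> U \<Longrightarrow> S_transform \<mu> \<Phi> \<theta> = f \<theta>" using g(1) unfolding germ_eq_def by blast
  obtain V where V: "NC_open V" "0 \<in> V" "\<And>\<theta>. \<theta> \<in> V \<Longrightarrow> S_transform \<mu> \<Psi> \<theta> = f \<theta>" using g(2) unfolding germ_eq_def by blast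
  obtain p3 e3 where 3: "e3 > 0" "\<And>\<theta>. \<theta> \<in> NC \<Longrightarrow> nrmC p3 \<theta> < e3 \<Longrightarrow> \<theta> \<in> U" using NC_openD[OF U(1,2)] by blast
  obtain p4 e4 where 4: "e4 > 0" "\<And>\<theta>. \<theta> \<in> NC \<Longrightarrow> nrmC p4 \<theta> < e4 \<Longrightarrow> \<theta> \<in> V" using NC_openD[OF V(1,2)] by blast
  define P where "P = max (max p1 p2) (max p3 p4)"
  define e where "e = min (min e1 e2) (min e3 e4)"
  have P: "p1 \<le> P" "p2 \<le> P" "p3 \<le> P" "p4 \<le> P" by (simp_all add: P_def)
  have e: "e \<le> e1" "e \<le> e2" "e \<le> e3" "e \<le> e4" "e > 0" using 1 2 3 4 by (simp_all add: e_def)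
  have "kernels \<mu> \<Phi> = kernels \<mu> \<Psi>"
  proof (rule kernel_unique_if_sums[where p = P and \<epsilon> = e and f = f])
    show "kernels \<mu> \<Phi> n \<in> tens_dual n" "kernels \<mu> \<Psi> n \<in> tens_dual n" for n
      using Q(1) Q'(1) by (auto simp: Q_expansion_def)
    show "e > 0" by (rule e)
    fix \<theta> assume \<theta>: "\<theta> \<in> NC" "nrmC P \<theta> < e"
    have "nrmC p1 \<theta> < e1" "nrmC p2 \<theta> < e2" "nrmC p3 \<theta> < e3" "nrmC p4 \<theta> < e4"
      using P[THEN nrmC_mono, OF \<theta>(1)] e \<theta>(2) by linarith+
    then show "(\<lambda>n. kernels \<mu> \<Phi> n (tpow \<theta> n)) sums f \<theta>" "(\<lambda>n. kernels \<mu> \<Psi> n (tpow \<theta> n)) sums f \<theta>"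
      using 1(2)[rule_format, OF \<theta>(1)] 2(2)[rule_format, OF \<theta>(1)] 3(2)[OF \<theta>(1)] 4(2)[OF \<theta>(1)]
        U(3)[of \<theta>] V(3)[of \<theta>] by simp_all
  qed
  note eq = this
  show ?thesis
  proof
    fix f
    show "\<Phi> f = \<Psi> f"
    proof (cases "f \<in> polys")
      case True
      then obtain m \<phi> where \<phi>: "\<forall>n. \<phi> n \<in> tens n" "f = poly_fun m \<phi>" unfolding polys_def by blast
      define \<psi> where "\<psi> = transfer moment_kernel m \<phi>"
      have T: "\<forall>n. \<psi> n \<in> tens n" unfolding \<psi>_def using transfer_tens[OF moment_kernel_dual] \<phi>(1) by blast
      have f: "f = appell_poly \<mu> m \<psi>" unfolding \<phi>(2) \<psi>_def using poly_fun_eq_appell_poly \<phi>(1) by blast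
      have "\<Phi> f = (\<Sum>n\<le>m. fact n * kernels \<mu> \<Phi> n (\<psi> n))" "\<Psi> f = (\<Sum>n\<le>m. fact n * kernels \<mu> \<Psi> n (\<psi> n))"
        using Q(1) Q'(1) T unfolding Q_expansion_def f by blast+
      then show ?thesis using eq by simp
    next
      case False
      then show ?thesis using Q(2) Q'(2) unfolding polys_dual_def by auto
    qed
  qed
qed

text \<open>The constant 1 is the Appell polynomial of degree 0 with coefficient the 0-th power of
  \<theta>. This form is the same for every \<theta>, so the equation may be used at any
  point.\<close>

lemma gen_expectation_eq:
  assumes Q: "Q_expansion \<mu> \<Phi> K" and \<theta>: "\<theta> \<in> NC"
  shows "gen_expectation \<Phi> = K 0 (tpow \<theta> 0)"
proof -
  define \<phi> where "\<phi> n = tpow \<theta> n" for n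
  have "(\<lambda>x. if x \<in> N' then 1 else 0) = appell_poly \<mu> 0 \<phi>"
  proof
    fix x
    show "(if x \<in> N' then 1 else 0) = appell_poly \<mu> 0 \<phi> x"
    proof (cases "x \<in> N'")
      case True
      have "conv (power_kernel x) appell_kernel 0 (tpow \<theta> 0) = fps_nth (symbol (conv (power_kernel x) appell_kernel) \<theta>) 0" by simp
      also have "\<dots> = fps_nth (fps_exp (pair_real x \<theta>) * symbol appell_kernel \<theta>) 0"
        by (simp only: symbol_conv[OF power_kernel_dual[OF True] appell_kernel_dual \<theta>] symbol_power_kernel[OF True \<theta>])
      also have "\<dots> = unit_kernel 0 (tpow \<theta> 0)" by (simp add: inv_kernel.simps[of moment_kernel 0])
      also have "\<dots> = 1" using symbol_unit[OF \<theta>] by (metis fps_one_nth symbol_nth)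
      finally show ?thesis using True by (simp add: appell_poly_pairing pairing_def \<phi>_def)
    next
      case False
      then show ?thesis by (simp add: appell_poly_def)
    qed
  qed
  moreover have "\<forall>n. \<phi> n \<in> tens n" using \<theta> by (simp add: \<phi>_def)
  ultimately show ?thesis using Q unfolding gen_expectation_def Q_expansion_def by (simp add: \<phi>_def)
qed

text \<open>Convolution with \<open>moment_kernel\<close> passes from Appell coefficients to
  ordinary ones: on an Appell polynomial it meets the transfer by the inverse
  \<open>appell_kernel\<close>, and the two cancel.\<close>

lemma distribution_from_kernel:
  assumes K: "\<And>n. K n \<in> tens_neg p n" "\<And>n. bounded_by p n (K n) (C * R ^ n)" and R: "R \<ge> 1"
  defines "\<Psi> \<equiv> poly_functional (conv K moment_kernel)"
  shows "\<Psi> \<in> distributions \<mu>" "kernels \<mu> \<Psi> = K"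
proof -
  have KD: "K n \<in> tens_dual n" for n using K(1) tens_neg_dual by blast
  have D: "conv K moment_kernel n \<in> tens_dual n" for n by (rule conv_dual[OF KD moment_kernel_dual])
  have "\<Psi> (appell_poly \<mu> m \<phi>) = (\<Sum>n\<le>m. fact n * K n (\<phi> n))" if \<phi>: "\<forall>n. \<phi> n \<in> tens n" for m \<phi>
  proof -
    have \<phi>': "\<And>n. \<phi> n \<in> tens n" using \<phi> by blast
    have "\<Psi> (appell_poly \<mu> m \<phi>) = pairing m (conv K moment_kernel) (transfer appell_kernel m \<phi>)"
      unfolding \<Psi>_def appell_poly_eq_poly_fun[OF \<phi>']
      by (rule poly_functional_eq[OF D transfer_tens[OF appell_kernel_dual \<phi>']])
    also have "\<dots> = pairing m K \<phi>"
      unfolding pairing_transfer[OF D appell_kernel_dual \<phi>'] conv_cancel(1)[OF KD] ..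
    finally show ?thesis by (simp add: pairing_def)
  qed
  then have Q: "Q_expansion \<mu> \<Psi> K" unfolding Q_expansion_def using KD by blast
  then show "kernels \<mu> \<Psi> = K" by (rule kernels_eq)
  \<comment> \<open>Chosen so that R^2 / 2^q \<le> 1/2, which makes the weighted square sum
    geometric.\<close>
  obtain q where q: "2 * R\<^sup>2 < 2 ^ q" using real_arch_pow[of 2 "2 * R\<^sup>2"] by auto
  have C0: "C \<ge> 0" using bounded_by_nonneg[OF K(2)[of 0]] by simp
  have "summable (\<lambda>n. (1 / 2) ^ (q * n) * (dnorm p n (K n))\<^sup>2)"
  proof (rule summable_comparison_test'[of "\<lambda>n. C\<^sup>2 * (1 / 2) ^ n" 0])
    show "summable (\<lambda>n. C\<^sup>2 * (1 / 2) ^ n)" by (intro summable_mult summable_geometric) simp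
    fix n
    have d: "0 \<le> dnorm p n (K n)" "dnorm p n (K n) \<le> C * R ^ n"
      using bounded_by_nonneg[OF bounded_by_dnorm[OF K(1)]] dnorm_le[OF K(2)] by auto
    have "(1 / 2) ^ (q * n) * (dnorm p n (K n))\<^sup>2 \<le> (1 / 2) ^ (q * n) * (C * R ^ n)\<^sup>2"
      using d by (intro mult_left_mono power_mono) auto
    also have "\<dots> = C\<^sup>2 * (R\<^sup>2 / 2 ^ q) ^ n"
      by (simp add: power_mult_distrib power_divide power_mult[symmetric] mult.commute)
    also have "\<dots> \<le> C\<^sup>2 * (1 / 2) ^ n"
      using q by (intro mult_left_mono power_mono) (auto simp: field_simps)
    finally show "norm ((1 / 2) ^ (q * n) * (dnorm p n (K n))\<^sup>2) \<le> C\<^sup>2 * (1 / 2) ^ n" by simp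
  qed
  then have "\<Psi> \<in> distributions_pq \<mu> p q"
    unfolding distributions_pq_def using Q K(1) poly_functional_dual[OF D] \<Psi>_def by blast
  then show "\<Psi> \<in> distributions \<mu>" unfolding distributions_def by blast
qed

section \<open>Analytic functions of distributions\<close>

lemma analytic_composition_exists:
  assumes \<Phi>: "\<Phi> \<in> distributions \<mu>" and F: "F analytic_on {gen_expectation \<Phi>}"
  shows "\<exists>\<Psi>\<in>distributions \<mu>. germ_eq (S_transform \<mu> \<Psi>) (\<lambda>\<theta>. F (S_transform \<mu> \<Phi> \<theta>))"
proof -
  obtain p C R where CR: "C \<ge> 1" "R \<ge> 1"
    and K': "\<forall>n. kernels \<mu> \<Phi> n \<in> tens_neg p n" "\<forall>n. bounded_by p n (kernels \<mu> \<Phi> n) (C * R ^ n)"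
    using distribution_kernels(3)[OF \<Phi>] by blast
  note K = K'[rule_format] and Q = distribution_kernels(1)[OF \<Phi>]
  define z0 where "z0 = gen_expectation \<Phi>"
  define G where "G n = (if n = 0 then (\<lambda>_. 0) else kernels \<mu> \<Phi> n)" for n
  have G: "G n \<in> tens_neg p n" for n using K(1) by (simp add: G_def)
  have Gb: "bounded_by p n (G n) (C * R ^ n)" for n
    using K(2) CR by (auto simp: G_def bounded_by_def)
  have GD: "G n \<in> tens_dual n" for n using G tens_neg_dual by blast
  define a where "a = fps_expansion F z0"
  have a: "(\<lambda>w. F (z0 + w)) has_fps_expansion a"
    unfolding a_def z0_def by (rule analytic_at_imp_has_fps_expansion[OF F])
  obtain A s where A: "A \<ge> 1" "s \<ge> 1" "\<And>n. cmod (fps_nth a n) \<le> A * s ^ n"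
    using fps_coefficients_geometric[OF a] by blast
  \<comment> \<open>The sum stops at i = n because the i-th power of a series without constant term
    starts in degree i or later; this matches the coefficient formula
    \<open>fps_compose_nth\<close>.\<close>
  define L where "L n = (\<lambda>\<phi>. \<Sum>i\<le>n. fps_nth a i * conv_power G i n \<phi>)" for n
  \<comment> \<open>The factor s comes from the Taylor coefficients of F, 2 C and 2 R from the
    convolution powers, and the leading 2 from the n + 1 \<le> 2^n summands.\<close>
  define D where "D = 2 * (s * (2 * C)) * (2 * R)"
  have D1: "D \<ge> 1"
  proof -
    have "1 * 1 * 1 \<le> 2 * (s * (2 * C)) * (2 * R)" using A CR by (intro mult_mono) (auto intro: mult_ge1_I)
    then show ?thesis by (simp add: D_def)
  qed
  have L: "L n \<in> tens_neg p n" for n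
    unfolding L_def by (intro tens_neg_sum conv_power_tens_neg[OF G]) simp
  have Lb: "bounded_by p n (L n) (A * D ^ n)" for n
  proof -
    have "bounded_by p n (L n) (\<Sum>i\<le>n. cmod (fps_nth a i) * ((2 * C) ^ i * (2 * R) ^ n))"
      unfolding L_def by (intro bounded_by_sum bounded_by_conv_power[OF G Gb CR]) simp
    moreover have "(\<Sum>i\<le>n. cmod (fps_nth a i) * ((2 * C) ^ i * (2 * R) ^ n)) \<le> A * D ^ n"
    proof -
      have sC: "s * (2 * C) \<ge> 1" using A CR by (intro mult_ge1_I) auto
      have "cmod (fps_nth a i) * ((2 * C) ^ i * (2 * R) ^ n) \<le> A * (s * (2 * C)) ^ n * (2 * R) ^ n" if "i \<le> n" for i
      proof -
        have "cmod (fps_nth a i) * ((2 * C) ^ i * (2 * R) ^ n) \<le> A * s ^ i * ((2 * C) ^ i * (2 * R) ^ n)"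
          using A(3) CR by (intro mult_right_mono) auto
        also have "\<dots> = A * (s * (2 * C)) ^ i * (2 * R) ^ n" by (simp add: power_mult_distrib)
        also have "\<dots> \<le> A * (s * (2 * C)) ^ n * (2 * R) ^ n"
          using A CR sC that by (intro mult_right_mono mult_left_mono power_increasing) auto
        finally show ?thesis .
      qed
      then have "(\<Sum>i\<le>n. cmod (fps_nth a i) * ((2 * C) ^ i * (2 * R) ^ n)) \<le> (\<Sum>i\<le>n. A * (s * (2 * C)) ^ n * (2 * R) ^ n)"
        by (intro sum_mono) auto
      also have "\<dots> = real (Suc n) * (A * (s * (2 * C)) ^ n * (2 * R) ^ n)" by simp
      also have "\<dots> \<le> 2 ^ n * (A * (s * (2 * C)) ^ n * (2 * R) ^ n)"
      proof (rule mult_right_mono)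
        have "Suc n \<le> 2 ^ n" by (induction n) auto
        then show "real (Suc n) \<le> 2 ^ n" by (metis of_nat_le_iff of_nat_numeral of_nat_power)
      qed (use A CR in auto)
      also have "\<dots> = A * D ^ n" by (simp only: D_def power_mult_distrib mult_ac)
      finally show ?thesis .
    qed
    ultimately show ?thesis using bounded_by_mono by blast
  qed
  define \<Psi> where "\<Psi> = poly_functional (conv L moment_kernel)"
  have \<Psi>: "\<Psi> \<in> distributions \<mu>" "kernels \<mu> \<Psi> = L"
    unfolding \<Psi>_def using distribution_from_kernel[OF L Lb D1] by blast+
  have symL: "fps_nth (fps_compose a (symbol G \<theta>)) n = L n (tpow \<theta> n)" if "\<theta> \<in> NC" for \<theta> n
    unfolding fps_compose_nth L_def symbol_conv_power[OF G that, symmetric] by (simp add: atLeast0AtMost)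
  obtain \<rho> where \<rho>: "\<rho> > 0" "F holomorphic_on ball z0 \<rho>"
    using F unfolding analytic_on_def z0_def by blast
  \<comment> \<open>For |t| < 2 the first entry makes R times the norm of
    \<open>cscale t \<theta>\<close> at most 1/2, so the series converge; the second gives |g t| <
    \<rho>, so that z0 + g t stays in the disc where F is holomorphic.\<close>
  define \<delta> where "\<delta> = min (1 / (4 * R)) (\<rho> / (4 * C * R))"
  have \<delta>: "\<delta> > 0" using \<rho> CR by (simp add: \<delta>_def)
  have "S_transform \<mu> \<Psi> \<theta> = F (S_transform \<mu> \<Phi> \<theta>)" if \<theta>: "\<theta> \<in> NC" "nrmC p \<theta> < \<delta>" for \<theta>
  proof -
    define g where "g t = S_transform \<mu> \<Phi> (cscale t \<theta>) - z0" for t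
    have "(\<lambda>n. G n (tpow \<theta> n) * t ^ n) sums g t \<and> cmod (g t) < \<rho>" if t: "t \<in> ball 0 2" for t
    proof -
      let ?\<eta> = "cscale t \<theta>"
      have \<eta>: "?\<eta> \<in> NC" using \<theta> by simp
      have le: "nrmC p ?\<eta> \<le> 2 * nrmC p \<theta>"
        unfolding nrmC_cscale[OF \<theta>(1)] using t by (intro mult_right_mono) auto
      have 1: "nrmC p \<theta> < 1 / (4 * R)" "nrmC p \<theta> < \<rho> / (4 * C * R)" using \<theta>(2) by (auto simp: \<delta>_def)
      have small: "R * nrmC p ?\<eta> \<le> 1 / 2"
      proof -
        have "R * nrmC p ?\<eta> \<le> R * (2 * nrmC p \<theta>)" using le CR by (intro mult_left_mono) auto
        also have "\<dots> \<le> 1 / 2" using 1(1) CR by (simp add: field_simps)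
        finally show ?thesis .
      qed
      have "(\<lambda>n. kernels \<mu> \<Phi> n (tpow ?\<eta> n)) sums S_transform \<mu> \<Phi> ?\<eta>"
        unfolding S_transform_def using kernel_sums(1)[OF K(2) CR(2) \<eta> small] by (rule summable_sums)
      then have "(\<lambda>n. kernels \<mu> \<Phi> (Suc n) (tpow ?\<eta> (Suc n))) sums (S_transform \<mu> \<Phi> ?\<eta> - kernels \<mu> \<Phi> 0 (tpow ?\<eta> 0))"
        using sums_Suc_iff[of "\<lambda>n. kernels \<mu> \<Phi> n (tpow ?\<eta> n)" "S_transform \<mu> \<Phi> ?\<eta> - kernels \<mu> \<Phi> 0 (tpow ?\<eta> 0)"] by simp
      then have sh: "(\<lambda>n. kernels \<mu> \<Phi> (Suc n) (tpow ?\<eta> (Suc n))) sums g t"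
        using gen_expectation_eq[OF Q \<eta>] by (simp add: g_def z0_def)
      then have "(\<lambda>n. G (Suc n) (tpow ?\<eta> (Suc n))) sums g t" by (simp add: G_def)
      then have "(\<lambda>n. G n (tpow ?\<eta> n)) sums g t"
        using sums_Suc_iff[of "\<lambda>n. G n (tpow ?\<eta> n)" "g t"] by (simp add: G_def)
      moreover have "cmod (g t) < \<rho>"
      proof -
        have "cmod (g t) \<le> 2 * C * R * nrmC p ?\<eta>"
          using kernel_sums(2)[OF K(2) CR(2) \<eta> small] sums_unique[OF sh] by simp
        also have "\<dots> \<le> 2 * C * R * (2 * nrmC p \<theta>)" using le CR by (intro mult_left_mono) auto
        also have "\<dots> < \<rho>" using 1(2) CR by (simp add: field_simps)
        finally show ?thesis .
      qed
      ultimately show ?thesis using tens_dual_cscale[OF GD \<theta>(1)] by simp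
    qed
    then have gs: "\<And>t. t \<in> ball 0 2 \<Longrightarrow> (\<lambda>n. G n (tpow \<theta> n) * t ^ n) sums g t"
      and gb: "\<And>t. t \<in> ball 0 2 \<Longrightarrow> cmod (g t) < \<rho>" by blast+
    have g: "g holomorphic_on ball 0 2" "g has_fps_expansion symbol G \<theta>"
      unfolding symbol_def using power_series_on_ball[of 2, OF _ gs] by simp_all
    \<comment> \<open>Analytic and formal composition meet here: h is holomorphic on the disc of
      radius 2 with expansion \<open>fps_compose a (symbol G \<theta>)\<close>, so evaluation at t =
      1 sums the kernels L.\<close>
    define h where "h = (\<lambda>w. F (z0 + w)) \<circ> g"
    have "(\<lambda>w. F (z0 + w)) holomorphic_on ball 0 \<rho>"
    proof -
      have "F \<circ> (\<lambda>w. z0 + w) holomorphic_on ball 0 \<rho>"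
        by (rule holomorphic_on_compose_gen[OF _ \<rho>(2)]) (auto intro!: holomorphic_intros simp: dist_norm)
      then show ?thesis by (simp add: comp_def)
    qed
    then have hol: "h holomorphic_on eball 0 (ereal 2)"
      unfolding h_def eball_ereal using g(1) gb by (intro holomorphic_on_compose_gen[of g "ball 0 2"]) auto
    have "h has_fps_expansion fps_compose a (symbol G \<theta>)"
      unfolding h_def by (rule has_fps_expansion_compose[OF a g(2)]) (simp add: G_def)
    from has_fps_expansion_imp_sums_complex[OF this hol, of 1]
    have "(\<lambda>n. L n (tpow \<theta> n)) sums h 1" using symL[OF \<theta>(1)] by simp
    then have "S_transform \<mu> \<Psi> \<theta> = h 1" unfolding S_transform_def \<Psi>(2) by (rule sums_unique[symmetric])
    also have "h 1 = F (S_transform \<mu> \<Phi> \<theta>)" by (simp add: h_def g_def)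
    finally show ?thesis .
  qed
  then have "germ_eq (S_transform \<mu> \<Psi>) (\<lambda>\<theta>. F (S_transform \<mu> \<Phi> \<theta>))"
    unfolding germ_eq_def using NC_open_ball[of p \<delta>] \<delta>
    by (intro exI[of _ "{\<theta> \<in> NC. nrmC p \<theta> < \<delta>}"]) auto
  then show ?thesis using \<Psi>(1) by blast
qed

end

theorem theorem39:
  fixes Hs :: "nat \<Rightarrow> 'h::{real_inner, complete_space, second_countable_topology} set"
    and ip :: "nat \<Rightarrow> 'h \<Rightarrow> 'h \<Rightarrow> real"
    and \<mu> :: "('h \<Rightarrow> real) measure"
    and \<Phi> :: "(('h \<Rightarrow> real) \<Rightarrow> complex) \<Rightarrow> complex"
    and F :: "complex \<Rightarrow> complex"
  assumes "nuclear_triple Hs ip"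
    and "\<mu> \<in> hilbert_scale.Ma Hs ip"
    and "prob_space \<mu>"
    and "hilbert_scale.nondegenerate Hs ip \<mu>"
    and "\<Phi> \<in> hilbert_scale.distributions Hs ip \<mu>"
    and "F analytic_on {hilbert_scale.gen_expectation Hs ip \<Phi>}"
  shows "\<exists>!\<Psi>. \<Psi> \<in> hilbert_scale.distributions Hs ip \<mu> \<and>
           hilbert_scale.germ_eq Hs ip
             (hilbert_scale.S_transform Hs ip \<mu> \<Psi>)
             (\<lambda>\<theta>. F (hilbert_scale.S_transform Hs ip \<mu> \<Phi> \<theta>))"
proof -
  interpret analytic_measure Hs ip \<mu>
    using assms(1-3) by (simp add: analytic_measure_def analytic_measure_axioms_def)
  show ?thesis
    using analytic_composition_exists[OF assms(5,6)] distribution_unique by blast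
qed

end
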